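(* Let $(K,v)$ be an arbitrary valued field. Let $\mathcal{L}_{\mathrm{fin}}(\mathcal{T}_{\mathbb{Q}})/\!\sim_{\mathrm{ok}}$ be the set of Okutsu equivalence classes of finite leaves of $\mathcal{T}_{\mathbb{Q}}$, and let $$ \mathbb{T}^{\mathrm{prim}}=\{(\rho,t)\mid \rho\in\mathrm{Prim}(\mathcal{T}_{\mathrm{sme}}),\ t\in\mathbf{td}(\rho)\} $$ be the set of all tangent vectors based on primitive nodes. There is a canonical bijective mapping $$ \mathbb{T}^{\mathrm{prim}}\longrightarrow \mathcal{L}_{\mathrm{fin}}(\mathcal{T}_{\mathbb{Q}})/\!\sim_{\mathrm{ok}},\qquad (\rho,[\phi]_\rho)\longmapsto \big[\,[\rho;\,\phi,\infty]\,\big]_{\mathrm{ok}}, $$ whose inverse mapping is $[\mathfrak{f}]_{\mathrm{ok}}\mapsto (\rho(\mathfrak{f}),\mathbf{t}(\rho(\mathfrak{f}),\mathfrak{f}))$.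
   Context: **Valuations and trees.** $(K,v)$ is a valued field, $\Gamma=v(K^* )$, $\Gamma_{\mathbb{Q}}=\Gamma\otimes\mathbb{Q}$ its divisible hull. For an ordered abelian group $\Lambda\supset\Gamma$, $\mathcal{T}(\Lambda)$ is the set of all valuations $\mu\colon K[x]\to\Lambda\cup\{\infty\}$ with $\mu|_K=v$; the support $\mathrm{supp}(\mu)=\mu^{-1}(\infty)$ (a prime ideal) may be nonzero. It is partially ordered by $\mu\le\nu\iff\mu(f)\le\nu(f)$ for all $f\in K[x]$. A leaf is a maximal element; a finite leaf is a leaf with nonzero support (every valuation with nonzero support is a leaf); non-leaves are inner nodes. A node is an inner node if and only if $\mathrm{KP}(\mu)\neq\emptyset$, where $\mathrm{KP}(\mu)$ denotes the set of key polynomials for $\mu$. Put $\mathcal{T}_{\mathbb{Q}}=\mathcal{T}(\Gamma_{\mathbb{Q}})$ and let $\mathcal{L}_{\mathrm{fin}}(\mathcal{T}_{\mathbb{Q}})$ be its set of finite leaves. **Key polynomials.** For $\alpha$ in the value group $\Gamma_\mu$ of $\mu$ let $\mathcal{P}_\alpha=\{g\mid\mu(g)\ge\alpha\}\supset\mathcal{P}_\alpha^+=\{g\mid\mu(g)>\alpha\}$, and $\mathcal{G}_\mu=\bigoplus_{\alpha\in\Gamma_\mu}\mathcal{P}_\alpha/\mathcal{P}_\alpha^+$ (an integral domain). Let $\mathrm{in}_\mu g$ be the class of $g$ in $\mathcal{P}_{\mu(g)}/\mathcal{P}^+_{\mu(g)}$ if $\mu(g)<\infty$, and $\mathrm{in}_\mu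 g=0$ otherwise. Write $g\sim_\mu h$ if $\mathrm{in}_\mu g=\mathrm{in}_\mu h$, and $h\mid_\mu g$ if $\mathrm{in}_\mu h\mid\mathrm{in}_\mu g$ in $\mathcal{G}_\mu$. A polynomial $g$ is $\mu$-irreducible if $\mathrm{in}_\mu g$ generates a nonzero prime ideal, and $\mu$-minimal if $g\nmid_\mu f$ for all nonzero $f$ with $\deg f<\deg g$. A key polynomial for $\mu$ is a monic polynomial that is both $\mu$-minimal and $\mu$-irreducible; $\mathrm{KP}(\mu)$ is the set of these. $\mathbf{td}(\mu)=\mathrm{KP}(\mu)/\!\sim_\mu$ is the set of tangent directions $[\phi]_\mu$. If $\mathrm{KP}(\mu)\ne\emptyset$ and $\phi\in\mathrm{KP}(\mu)$ has minimal degree, put $\deg(\mu)=\deg(\phi)$, $\mathrm{sv}(\mu)=\mu(\phi)$ (independent of $\phi$). For $\mu<\nu$, $\mathbf{t}(\mu,\nu)$ is the set of monic $\phi$ of minimal degree with $\mu(\phi)<\nu(\phi)$; it is a tangent direction of $\mu$. **Augmentations.** For $\phi\in\mathrm{KP}(\mu)$ and $\gamma\in\Lambda\cup\{\infty\}$ with $\gamma>\mu(\phi)$, the ordinary augmentation $\nu=[\mu;\phi,\gamma]$ is defined on $\phi$-expansions $f=\sum_s a_s\phi^s$ ($\deg a_s<\deg\phi$) by $\nu(f)=\min_s\{\mu(a_s)+s\gamma\}$. Let $\mathcal{A}=(\rho_i)_{i\in A}$ be a totally ordered family in $\mathcal{T}_{\mathbb{Q}}$ without maximal element, with $i\mapsto\rho_i$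 an isomorphism of ordered sets. A polynomial $f$ is $\mathcal{A}$-stable if for some $i$, $\rho_i(f)=\rho_j(f)$ for all $j>i$; then $\rho_{\mathcal{A}}(f)$ denotes this stable value. $\mathrm{KP}_\infty(\mathcal{A})$ is the set of monic $\mathcal{A}$-unstable polynomials of minimal degree; that degree is $\deg_\infty(\mathcal{A})$ ($=\infty$ if there are none). $\mathcal{A}$ is an essential continuous family if $\deg(\rho_i)$ is constant, equal to $\deg(\mathcal{A})$, for large $i$, and $\deg(\mathcal{A})<\deg_\infty(\mathcal{A})<\infty$. For $\phi\in\mathrm{KP}_\infty(\mathcal{A})$ and $\gamma>\rho_i(\phi)$ for all $i$, the limit augmentation $[\mathcal{A};\phi,\gamma]$ is $\sum_s a_s\phi^s\mapsto\min_s\{\rho_{\mathcal{A}}(a_s)+s\gamma\}$ (on $\phi$-expansions). **The set $\Gamma_{\mathrm{sme}}$ and the tree $\mathcal{T}_{\mathrm{sme}}$.** An extension $\Gamma\subset\Lambda$ of ordered abelian groups is small if $\Lambda/\Delta$ is cyclic, where $\Delta$ is the relative divisible hull of $\Gamma$ in $\Lambda$. Fix a totally ordered real vector space $\mathbb{R}_{\mathrm{sme}}\supset\Gamma_{\mathbb{Q}}$ such that every small extension of $\Gamma$ admits an order-preserving embedding into $\mathbb{R}_{\mathrm{sme}}$ that is the identity on $\Gamma$ (constructed by Kuhlmann–Nart). Elements $x,y\in\mathbb{R}_{\mathrm{sme}}$ are equivalent if there is an isomorphism of ordered groups $\langle\Gamma,x\rangle\to\langle\Gamma,y\rangle$ sending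 $x$ to $y$ and fixing $\Gamma$. $\Gamma_{\mathrm{sme}}$ is a fixed (canonical) set of representatives of this relation, with $\Gamma_{\mathbb{Q}}\subset\Gamma_{\mathrm{sme}}\subset\mathbb{R}_{\mathrm{sme}}$. The map $x\mapsto(\{\gamma\in\Gamma_{\mathbb{Q}}:\gamma\le x\},\{\gamma\in\Gamma_{\mathbb{Q}}:\gamma\ge x\})$ is an order isomorphism from $\Gamma_{\mathrm{sme}}$ onto the set of quasicuts of $\Gamma_{\mathbb{Q}}$ (pairs $(D^L,D^R)$ with $D^L\le D^R$, $D^L\cup D^R=\Gamma_{\mathbb{Q}}$, $\#(D^L\cap D^R)\le1$, ordered by $(D^L,D^R)\le(E^L,E^R)\iff D^L\subset E^L,\ D^R\supset E^R$). In particular every subset of $\Gamma_{\mathbb{Q}}$ has a supremum in $\Gamma_{\mathrm{sme}}$; $-\infty:=\min\Gamma_{\mathrm{sme}}$. Let $$\mathcal{T}_{\mathrm{sme}}=\mathcal{T}_{\mathbb{Q}}\cup\{\rho\in\mathcal{T}(\mathbb{R}_{\mathrm{sme}})\mid\rho\text{ inner node},\ \mathrm{sv}(\rho)\in\Gamma_{\mathrm{sme}}\}.$$ **Primitive nodes.** For an essential continuous family $\mathcal{A}$ in $\mathcal{T}_{\mathbb{Q}}$ and $\phi\in\mathrm{KP}_\infty(\mathcal{A})$ put $\gamma_{\mathcal{A}}=\sup\{\rho_i(\phi)\mid i\in A\}\in\Gamma_{\mathrm{sme}}$ and $\mu_{\mathcal{A}}=[\mathcal{A};\phi,\gamma_{\mathcal{A}}]$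 (independent of $\phi$). By convention $\mathcal{A}=\emptyset$ is also admitted as an essential continuous family, with $\gamma_\emptyset=-\infty$ and $\mu_\emptyset=\omega_{-\infty}$, the root of $\mathcal{T}_{\mathrm{sme}}$: $\omega_{-\infty}(\sum_s a_sx^s)=\min_s\{v(a_s)+s\cdot(-\infty)\}$, with $-\infty$ viewed as an element of $\mathbb{R}_{\mathrm{sme}}$; $\mathrm{KP}(\omega_{-\infty})=\{x-a\mid a\in K\}$. A limit-primitive node is a node of the form $\mu_{\mathcal{A}}$ for an essential continuous family $\mathcal{A}$ in $\mathcal{T}_{\mathbb{Q}}$ (including $\mathcal{A}=\emptyset$). An ordinary-primitive node is an inner node $\mu\in\mathcal{T}_{\mathbb{Q}}$ such that $\mathrm{KP}_{\mathrm{str}}(\mu)=\{\phi\in\mathrm{KP}(\mu)\mid\deg\phi>\deg\mu\}$ is nonempty. $\mathrm{Prim}(\mathcal{T}_{\mathrm{sme}})$ is the set of all primitive nodes (of either kind). Put $\mathcal{P}_\rho(\phi)=\{[\rho;\phi,\gamma]\mid\gamma\in\Gamma_{\mathrm{sme}}\cup\{\infty\},\ \rho(\phi)<\gamma\le\infty\}$, and $\mathcal{P}(\rho)=\bigcup_{\phi\in\mathrm{KP}_{\mathrm{str}}(\rho)}\mathcal{P}_\rho(\phi)$ if $\rho$ is ordinary-primitive, $\mathcal{P}(\rho)=\{\rho\}\cup\bigcup_{\phi\in\mathrm{KP}(\rho)}\mathcal{P}_\rho(\phi)$ if $\rho$ is limit-primitive. It is known that every inner node or finite leaf of $\mathcal{T}_{\mathrm{sme}}$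 lies in $\mathcal{P}(\rho)$ for a unique primitive node $\rho$. For a finite leaf $\mathfrak{f}$ this node is denoted $\rho(\mathfrak{f})$ (the previous primitive node of $\mathfrak{f}$). **Okutsu equivalence.** For $\mathfrak{f},\mathfrak{f}'\in\mathcal{L}_{\mathrm{fin}}(\mathcal{T}_{\mathbb{Q}})$: $\mathfrak{f}\sim_{\mathrm{ok}}\mathfrak{f}'$ iff $\rho(\mathfrak{f})=\rho(\mathfrak{f}')$ and $\mathbf{t}(\rho(\mathfrak{f}),\mathfrak{f})=\mathbf{t}(\rho(\mathfrak{f}),\mathfrak{f}')$. The class of $\mathfrak{f}$ is $[\mathfrak{f}]_{\mathrm{ok}}$.
   Formalization: For ordinary-primitive ρ only tangent directions of strong key polynomials (deg φ > deg ρ) are admitted in T^prim; with all of td(ρ) injectivity fails, e.g. K=ℝ trivially valued: all (μ_0,[x−a]), μ_0 the trivial valuation, and (ω_{−∞},[x]) have the same image. *)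

theory Defs
  imports
    Complex_Main
    "HOL-Library.Extended_Nat"
    "HOL-Computational_Algebra.Polynomial"
    "HOL-Algebra.Ideal"
    "HOL-Algebra.Divisibility"
    "HOL-Algebra.Product_Groups"
begin

section \<open>Ordered groups with a largest element added\<close>

datatype 'g vext = Fin 'g | Infty

instantiation vext :: (linorder) linorder
begin

fun less_eq_vext :: "'a vext \<Rightarrow> 'a vext \<Rightarrow> bool" where
  "less_eq_vext _ Infty = True"
| "less_eq_vext Infty (Fin _) = False"
| "less_eq_vext (Fin a) (Fin b) = (a \<le> b)"

definition less_vext :: "'a vext \<Rightarrow> 'a vext \<Rightarrow> bool" where
  "less_vext x y \<longleftrightarrow> x \<le> y \<and> \<not> y \<le> x"

instance
proof
  fix x y z :: "'a vext"
  show "x < y \<longleftrightarrow> x \<le> y \<and> \<not> y \<le> x" by (simp add: less_vext_def)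
  show "x \<le> x" by (cases x) auto
  show "x \<le> y \<Longrightarrow> y \<le> z \<Longrightarrow> x \<le> z" by (cases x; cases y; cases z) auto
  show "x \<le> y \<Longrightarrow> y \<le> x \<Longrightarrow> x = y" by (cases x; cases y) auto
  show "x \<le> y \<or> y \<le> x" by (cases x; cases y) auto
qed

end

instantiation vext :: (comm_monoid_add) comm_monoid_add
begin

definition zero_vext :: "'a vext" where
  "zero_vext = Fin 0"

fun plus_vext :: "'a vext \<Rightarrow> 'a vext \<Rightarrow> 'a vext" where
  "plus_vext (Fin a) (Fin b) = Fin (a + b)"
| "plus_vext Infty _ = Infty"
| "plus_vext (Fin _) Infty = Infty"

instance
proof
  fix x y z :: "'a vext"
  show "x + y + z = x + (y + z)" by (cases x; cases y; cases z) (auto simp: add.assoc)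
  show "x + y = y + x" by (cases x; cases y) (auto simp: add.commute)
  show "0 + x = x" by (cases x) (auto simp: zero_vext_def)
qed

end

section \<open>Valuations and trees\<close>

definition is_valuation ::
  "('a::comm_ring_1 \<Rightarrow> 'g::linordered_ab_group_add vext) \<Rightarrow> bool" where
  "is_valuation \<mu> \<longleftrightarrow> \<mu> 0 = Infty \<and> \<mu> 1 = 0 \<and>
     (\<forall>f g. \<mu> (f * g) = \<mu> f + \<mu> g) \<and> (\<forall>f g. min (\<mu> f) (\<mu> g) \<le> \<mu> (f + g))"

text \<open>If \<open>v\<close> is a valuation on a field, then \<open>v a = Infty\<close> forces \<open>a = 0\<close>.\<close>

definition value_group :: "('k::field \<Rightarrow> 'g vext) \<Rightarrow> 'g set" where
  "value_group v = {\<gamma>. \<exists>a. a \<noteq> 0 \<and> v a = Fin \<gamma>}"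

definition div_hull :: "'r::real_vector set \<Rightarrow> 'r set" where
  "div_hull \<Gamma> = {x. \<exists>n>0. real n *\<^sub>R x \<in> \<Gamma>}"

text \<open>All trees live in the functions with values in the ambient ordered group \<open>'r\<close> (the
  space written \<open>\<real>\<close> with index sme), and the order between nodes is the pointwise
  order on functions.\<close>

definition tree :: "('k::field \<Rightarrow> 'r vext) \<Rightarrow> 'r set \<Rightarrow>
    ('k poly \<Rightarrow> 'r::linordered_ab_group_add vext) set" where
  "tree v \<Lambda> = {\<mu>. is_valuation \<mu> \<and> range \<mu> \<subseteq> insert Infty (Fin ` \<Lambda>) \<and> (\<forall>a. \<mu> [:a:] = v a)}"

definition val_support :: "('a \<Rightarrow> 'g vext) \<Rightarrow> 'a set" where
  "val_support \<mu> = {f. \<mu> f = Infty}"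

definition leaf :: "('a \<Rightarrow> 'g::linorder vext) set \<Rightarrow> ('a \<Rightarrow> 'g vext) \<Rightarrow> bool" where
  "leaf T \<mu> \<longleftrightarrow> \<mu> \<in> T \<and> \<not> (\<exists>\<nu>\<in>T. \<mu> < \<nu>)"

definition inner_node :: "('a \<Rightarrow> 'g::linorder vext) set \<Rightarrow> ('a \<Rightarrow> 'g vext) \<Rightarrow> bool" where
  "inner_node T \<mu> \<longleftrightarrow> \<mu> \<in> T \<and> \<not> leaf T \<mu>"

definition finite_leaves ::
  "('a::zero \<Rightarrow> 'g::linorder vext) set \<Rightarrow> ('a \<Rightarrow> 'g vext) set" where
  "finite_leaves T = {\<mu>. leaf T \<mu> \<and> val_support \<mu> \<noteq> {0}}"

section \<open>The graded algebra of a valuation\<close>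

text \<open>The group generated by the finite values of \<open>\<mu>\<close>, i.e. the value group of the valuation
  induced by \<open>\<mu>\<close> on the fraction field of the quotient by the support.\<close>

definition val_group :: "('k::field poly \<Rightarrow> 'r::linordered_ab_group_add vext) \<Rightarrow> 'r set" where
  "val_group \<mu> = {\<alpha>. \<exists>f g. \<mu> f \<noteq> Infty \<and> \<mu> g \<noteq> Infty \<and> \<mu> f = \<mu> g + Fin \<alpha>}"

definition P_ge :: "('k::field poly \<Rightarrow> 'r::linordered_ab_group_add vext) \<Rightarrow> 'r \<Rightarrow> 'k poly set" where
  "P_ge \<mu> \<alpha> = {g. Fin \<alpha> \<le> \<mu> g}"

definition P_gt :: "('k::field poly \<Rightarrow> 'r::linordered_ab_group_add vext) \<Rightarrow> 'r \<Rightarrow> 'k poly set" where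
  "P_gt \<mu> \<alpha> = {g. Fin \<alpha> < \<mu> g}"

definition P_grp ::
  "('k::field poly \<Rightarrow> 'r::linordered_ab_group_add vext) \<Rightarrow> 'r \<Rightarrow> 'k poly monoid" where
  "P_grp \<mu> \<alpha> = \<lparr>carrier = P_ge \<mu> \<alpha>, mult = (+), one = 0\<rparr>"

definition gr_sum ::
  "('k::field poly \<Rightarrow> 'r::linordered_ab_group_add vext) \<Rightarrow> ('r \<Rightarrow> 'k poly set) monoid" where
  "gr_sum \<mu> = sum_group (val_group \<mu>) (\<lambda>\<alpha>. P_grp \<mu> \<alpha> Mod P_gt \<mu> \<alpha>)"

text \<open>The product extends the products of homogeneous classes
  \<open>(f + P_gt \<mu> \<alpha>) (g + P_gt \<mu> \<beta>) = f g + P_gt \<mu> (\<alpha> + \<beta>)\<close> bilinearly; \<open>a\<close> and \<open>b\<close> below are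
  choices of representatives of the components of \<open>A\<close> and \<open>B\<close>, and the sum runs over
  the finite support of \<open>A\<close>.\<close>

definition gr_mult :: "('k::field poly \<Rightarrow> 'r::linordered_ab_group_add vext) \<Rightarrow>
    ('r \<Rightarrow> 'k poly set) \<Rightarrow> ('r \<Rightarrow> 'k poly set) \<Rightarrow> ('r \<Rightarrow> 'k poly set)" where
  "gr_mult \<mu> A B = (\<lambda>\<gamma>\<in>val_group \<mu>.
     {h. \<exists>a b. (\<forall>\<alpha>\<in>val_group \<mu>. a \<alpha> \<in> A \<alpha> \<and> b \<alpha> \<in> B \<alpha>) \<and>
        h - (\<Sum>\<alpha> | \<alpha> \<in> val_group \<mu> \<and> A \<alpha> \<noteq> P_gt \<mu> \<alpha>. a \<alpha> * b (\<gamma> - \<alpha>)) \<in> P_gt \<mu> \<gamma>})"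

definition in_form :: "('k::field poly \<Rightarrow> 'r::linordered_ab_group_add vext) \<Rightarrow>
    'k poly \<Rightarrow> ('r \<Rightarrow> 'k poly set)" where
  "in_form \<mu> g = (\<lambda>\<alpha>\<in>val_group \<mu>.
     if \<mu> g = Fin \<alpha> then P_gt \<mu> \<alpha> #>\<^bsub>P_grp \<mu> \<alpha>\<^esub> g else P_gt \<mu> \<alpha>)"

definition gr_alg ::
  "('k::field poly \<Rightarrow> 'r::linordered_ab_group_add vext) \<Rightarrow> ('r \<Rightarrow> 'k poly set) ring" where
  "gr_alg \<mu> = \<lparr>carrier = carrier (gr_sum \<mu>), mult = gr_mult \<mu>, one = in_form \<mu> 1,
     zero = \<one>\<^bsub>gr_sum \<mu>\<^esub>, add = (\<otimes>\<^bsub>gr_sum \<mu>\<^esub>)\<rparr>"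

section \<open>Key polynomials and tangent directions\<close>

definition mu_equiv ::
  "('k::field poly \<Rightarrow> 'r::linordered_ab_group_add vext) \<Rightarrow> 'k poly \<Rightarrow> 'k poly \<Rightarrow> bool" where
  "mu_equiv \<mu> g h \<longleftrightarrow> in_form \<mu> g = in_form \<mu> h"

definition mu_divides ::
  "('k::field poly \<Rightarrow> 'r::linordered_ab_group_add vext) \<Rightarrow> 'k poly \<Rightarrow> 'k poly \<Rightarrow> bool" where
  "mu_divides \<mu> h g \<longleftrightarrow> in_form \<mu> h divides\<^bsub>gr_alg \<mu>\<^esub> in_form \<mu> g"

definition mu_irreducible ::
  "('k::field poly \<Rightarrow> 'r::linordered_ab_group_add vext) \<Rightarrow> 'k poly \<Rightarrow> bool" where
  "mu_irreducible \<mu> g \<longleftrightarrow> primeideal (PIdl\<^bsub>gr_alg \<mu>\<^esub> (in_form \<mu> g)) (gr_alg \<mu>) \<and>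
     PIdl\<^bsub>gr_alg \<mu>\<^esub> (in_form \<mu> g) \<noteq> {\<zero>\<^bsub>gr_alg \<mu>\<^esub>}"

definition mu_minimal ::
  "('k::field poly \<Rightarrow> 'r::linordered_ab_group_add vext) \<Rightarrow> 'k poly \<Rightarrow> bool" where
  "mu_minimal \<mu> g \<longleftrightarrow> (\<forall>f. f \<noteq> 0 \<and> degree f < degree g \<longrightarrow> \<not> mu_divides \<mu> g f)"

definition KP :: "('k::field poly \<Rightarrow> 'r::linordered_ab_group_add vext) \<Rightarrow> 'k poly set" where
  "KP \<mu> = {\<phi>. lead_coeff \<phi> = 1 \<and> mu_minimal \<mu> \<phi> \<and> mu_irreducible \<mu> \<phi>}"

definition tdir ::
  "('k::field poly \<Rightarrow> 'r::linordered_ab_group_add vext) \<Rightarrow> 'k poly \<Rightarrow> 'k poly set" where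
  "tdir \<mu> \<phi> = {\<psi> \<in> KP \<mu>. mu_equiv \<mu> \<phi> \<psi>}"

definition td :: "('k::field poly \<Rightarrow> 'r::linordered_ab_group_add vext) \<Rightarrow> 'k poly set set" where
  "td \<mu> = KP \<mu> // {(\<phi>, \<psi>). \<phi> \<in> KP \<mu> \<and> \<psi> \<in> KP \<mu> \<and> mu_equiv \<mu> \<phi> \<psi>}"

definition deg_val :: "('k::field poly \<Rightarrow> 'r::linordered_ab_group_add vext) \<Rightarrow> nat" where
  "deg_val \<mu> = (LEAST d. \<exists>\<phi>\<in>KP \<mu>. degree \<phi> = d)"

definition sv :: "('k::field poly \<Rightarrow> 'r::linordered_ab_group_add vext) \<Rightarrow> 'r vext" where
  "sv \<mu> = (THE s. \<exists>\<phi>\<in>KP \<mu>. degree \<phi> = deg_val \<mu> \<and> s = \<mu> \<phi>)"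

definition KP_str :: "('k::field poly \<Rightarrow> 'r::linordered_ab_group_add vext) \<Rightarrow> 'k poly set" where
  "KP_str \<mu> = {\<phi> \<in> KP \<mu>. deg_val \<mu> < degree \<phi>}"

text \<open>The set \<open>t(\<mu>, \<nu>)\<close>, used for \<open>\<mu> < \<nu>\<close>.\<close>

definition tangent :: "('k::field poly \<Rightarrow> 'r::linordered_ab_group_add vext) \<Rightarrow>
    ('k poly \<Rightarrow> 'r vext) \<Rightarrow> 'k poly set" where
  "tangent \<mu> \<nu> = {\<phi>. lead_coeff \<phi> = 1 \<and> \<mu> \<phi> < \<nu> \<phi> \<and>
     (\<forall>\<psi>. lead_coeff \<psi> = 1 \<and> \<mu> \<psi> < \<nu> \<psi> \<longrightarrow> degree \<phi> \<le> degree \<psi>)}"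

section \<open>Augmentations\<close>

text \<open>\<open>exp_coeff \<phi> f s\<close> is the coefficient of \<open>\<phi> ^ s\<close> in the \<open>\<phi>\<close>-expansion of \<open>f\<close>; see
  the two lemmas below.\<close>

definition exp_coeff :: "'k::field poly \<Rightarrow> 'k poly \<Rightarrow> nat \<Rightarrow> 'k poly" where
  "exp_coeff \<phi> f s = (f div \<phi> ^ s) mod \<phi>"

lemma degree_exp_coeff:
  assumes "0 < degree \<phi>"
  shows "degree (exp_coeff \<phi> f s) < degree \<phi>"
proof -
  have "\<phi> \<noteq> 0" using assms by auto
  then show ?thesis
    unfolding exp_coeff_def using assms degree_mod_less[of \<phi> "f div \<phi> ^ s"] by auto
qed

lemma sum_exp_coeff:
  fixes f \<phi> :: "'k::field poly"
  assumes "0 < degree \<phi>"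
  shows "f = (\<Sum>s\<le>degree f. exp_coeff \<phi> f s * \<phi> ^ s)"
proof -
  have partial: "f = (\<Sum>s<n. exp_coeff \<phi> f s * \<phi> ^ s) + (f div \<phi> ^ n) * \<phi> ^ n" for n
  proof (induction n)
    case 0
    show ?case by simp
  next
    case (Suc n)
    have "f div \<phi> ^ n = exp_coeff \<phi> f n + (f div \<phi> ^ Suc n) * \<phi>"
      unfolding exp_coeff_def power_Suc2 poly_div_mult_right
      by (metis add.commute div_mult_mod_eq)
    then have "(f div \<phi> ^ n) * \<phi> ^ n
        = exp_coeff \<phi> f n * \<phi> ^ n + (f div \<phi> ^ Suc n) * \<phi> ^ Suc n"
      by (metis distrib_right mult.assoc power_Suc)
    with Suc show ?case by (simp add: add.assoc)
  qed
  have "\<phi> \<noteq> 0" using assms by auto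
  then have "degree (\<phi> ^ Suc (degree f)) = Suc (degree f) * degree \<phi>"
    by (rule degree_power_eq)
  moreover have "Suc (degree f) \<le> Suc (degree f) * degree \<phi>"
    using mult_le_mono2[of 1 "degree \<phi>" "Suc (degree f)"] assms by simp
  ultimately have "degree f < degree (\<phi> ^ Suc (degree f))"
    by linarith
  then have "f div \<phi> ^ Suc (degree f) = 0"
    by (rule div_poly_less)
  with partial[of "Suc (degree f)"] show ?thesis
    by (simp add: lessThan_Suc_atMost)
qed

text \<open>The function sending \<open>\<Sum>s. a s * \<phi> ^ s\<close> to \<open>Min s. w (a s) + s \<gamma>\<close>.\<close>

definition expansion_min :: "('k::field poly \<Rightarrow> 'r::linordered_ab_group_add vext) \<Rightarrow>
    'k poly \<Rightarrow> 'r vext \<Rightarrow> 'k poly \<Rightarrow> 'r vext" where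
  "expansion_min w \<phi> \<gamma> f = Min ((\<lambda>s. w (exp_coeff \<phi> f s) + (\<Sum>_<s. \<gamma>)) ` {..degree f})"

definition ord_aug :: "('k::field poly \<Rightarrow> 'r::linordered_ab_group_add vext) \<Rightarrow>
    'k poly \<Rightarrow> 'r vext \<Rightarrow> 'k poly \<Rightarrow> 'r vext" where
  "ord_aug \<mu> \<phi> \<gamma> = expansion_min \<mu> \<phi> \<gamma>"

text \<open>A totally ordered family \<open>(\<rho> i)\<close>, with \<open>i \<mapsto> \<rho> i\<close> an isomorphism of ordered sets, is
  represented by the set of its members; all notions below depend only on this set.\<close>

definition stable :: "('a \<Rightarrow> 'r::linorder vext) set \<Rightarrow> 'a \<Rightarrow> bool" where
  "stable \<A> f \<longleftrightarrow> (\<exists>\<rho>\<in>\<A>. \<forall>\<sigma>\<in>\<A>. \<rho> < \<sigma> \<longrightarrow> \<rho> f = \<sigma> f)"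

definition stable_value :: "('a \<Rightarrow> 'r::linorder vext) set \<Rightarrow> 'a \<Rightarrow> 'r vext" where
  "stable_value \<A> f = (THE w. \<exists>\<rho>\<in>\<A>. \<rho> f = w \<and> (\<forall>\<sigma>\<in>\<A>. \<rho> < \<sigma> \<longrightarrow> \<sigma> f = w))"

definition KP_inf :: "('k::field poly \<Rightarrow> 'r::linorder vext) set \<Rightarrow> 'k poly set" where
  "KP_inf \<A> = {\<phi>. lead_coeff \<phi> = 1 \<and> \<not> stable \<A> \<phi> \<and>
     (\<forall>\<psi>. lead_coeff \<psi> = 1 \<and> \<not> stable \<A> \<psi> \<longrightarrow> degree \<phi> \<le> degree \<psi>)}"

text \<open>Recall that the infimum of the empty set is \<open>\<infinity>\<close> in \<open>enat\<close>.\<close>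

definition deg_inf :: "('k::field poly \<Rightarrow> 'r::linorder vext) set \<Rightarrow> enat" where
  "deg_inf \<A> = (INF \<phi>\<in>KP_inf \<A>. enat (degree \<phi>))"

text \<open>This is the notion for nonempty families; the conventional case of the empty family is
  treated separately in \<open>limit_primitive\<close>.\<close>

definition essential_family ::
  "('k::field \<Rightarrow> 'r::{linordered_ab_group_add,ordered_real_vector} vext) \<Rightarrow>
    ('k poly \<Rightarrow> 'r vext) set \<Rightarrow> bool" where
  "essential_family v \<A> \<longleftrightarrow>
     \<A> \<noteq> {} \<and> \<A> \<subseteq> tree v (div_hull (value_group v)) \<and>
     (\<forall>\<rho>\<in>\<A>. \<forall>\<sigma>\<in>\<A>. \<rho> \<le> \<sigma> \<or> \<sigma> \<le> \<rho>) \<and> (\<forall>\<rho>\<in>\<A>. \<exists>\<sigma>\<in>\<A>. \<rho> < \<sigma>) \<and>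
     (\<exists>m. (\<exists>\<rho>\<in>\<A>. \<forall>\<sigma>\<in>\<A>. \<rho> \<le> \<sigma> \<longrightarrow> deg_val \<sigma> = m) \<and> enat m < deg_inf \<A> \<and> deg_inf \<A> < \<infinity>)"

definition lim_aug :: "('k::field poly \<Rightarrow> 'r::linordered_ab_group_add vext) set \<Rightarrow>
    'k poly \<Rightarrow> 'r vext \<Rightarrow> 'k poly \<Rightarrow> 'r vext" where
  "lim_aug \<A> \<phi> \<gamma> = expansion_min (stable_value \<A>) \<phi> \<gamma>"

section \<open>Small extensions and the set of representatives\<close>

definition ordered_group :: "'a monoid \<Rightarrow> 'a rel \<Rightarrow> bool" where
  "ordered_group G r \<longleftrightarrow> comm_group G \<and> linear_order_on (carrier G) r \<and>
     (\<forall>x y z. x \<in> carrier G \<and> y \<in> carrier G \<and> z \<in> carrier G \<and> (x, y) \<in> r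
        \<longrightarrow> (x \<otimes>\<^bsub>G\<^esub> z, y \<otimes>\<^bsub>G\<^esub> z) \<in> r)"

text \<open>\<open>(G, r)\<close> is an extension of the ordered group \<open>\<Gamma>\<close> by means of the embedding \<open>\<iota>\<close>.\<close>

definition ordered_extension ::
  "'r::linordered_ab_group_add set \<Rightarrow> 'a monoid \<Rightarrow> 'a rel \<Rightarrow> ('r \<Rightarrow> 'a) \<Rightarrow> bool" where
  "ordered_extension \<Gamma> G r \<iota> \<longleftrightarrow> ordered_group G r \<and> \<iota> \<in> \<Gamma> \<rightarrow> carrier G \<and>
     (\<forall>\<gamma>\<in>\<Gamma>. \<forall>\<delta>\<in>\<Gamma>. \<iota> (\<gamma> + \<delta>) = \<iota> \<gamma> \<otimes>\<^bsub>G\<^esub> \<iota> \<delta> \<and> ((\<iota> \<gamma>, \<iota> \<delta>) \<in> r \<longleftrightarrow> \<gamma> \<le> \<delta>))"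

definition rel_div_hull :: "'a monoid \<Rightarrow> 'a set \<Rightarrow> 'a set" where
  "rel_div_hull G H = {x \<in> carrier G. \<exists>n::nat. n > 0 \<and> x [^]\<^bsub>G\<^esub> n \<in> H}"

definition small_extension ::
  "'r::linordered_ab_group_add set \<Rightarrow> 'a monoid \<Rightarrow> 'a rel \<Rightarrow> ('r \<Rightarrow> 'a) \<Rightarrow> bool" where
  "small_extension \<Gamma> G r \<iota> \<longleftrightarrow> ordered_extension \<Gamma> G r \<iota> \<and>
     cyclic_group (G Mod rel_div_hull G (\<iota> ` \<Gamma>))"

text \<open>Every small extension of \<open>\<Gamma>\<close> embeds into the ambient space over \<open>\<Gamma>\<close>. As an abelian group,
  a small extension is \<open>\<Delta>\<close> or \<open>\<Delta> \<times> \<int>\<close> for a subgroup \<open>\<Delta>\<close> of the divisible hull of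
  \<open>\<Gamma>\<close> (ordered groups are torsion-free); hence up to isomorphism all of them have a
  carrier contained in \<open>'r \<times> int\<close>.\<close>

definition embeds_small_extensions ::
  "'r::{linordered_ab_group_add,ordered_real_vector} set \<Rightarrow> bool" where
  "embeds_small_extensions \<Gamma> \<longleftrightarrow>
     (\<forall>(G :: ('r \<times> int) monoid) r \<iota>. small_extension \<Gamma> G r \<iota> \<longrightarrow>
        (\<exists>j :: 'r \<times> int \<Rightarrow> 'r.
           (\<forall>x\<in>carrier G. \<forall>y\<in>carrier G.
              j (x \<otimes>\<^bsub>G\<^esub> y) = j x + j y \<and> (j x \<le> j y \<longleftrightarrow> (x, y) \<in> r)) \<and>
           (\<forall>\<gamma>\<in>\<Gamma>. j (\<iota> \<gamma>) = \<gamma>)))"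

text \<open>The subgroup generated by a subgroup \<open>\<Gamma>\<close> and \<open>x\<close>.\<close>

definition adjoin :: "'r::real_vector set \<Rightarrow> 'r \<Rightarrow> 'r set" where
  "adjoin \<Gamma> x = {\<gamma> + of_int n *\<^sub>R x | \<gamma> n. \<gamma> \<in> \<Gamma>}"

definition sme_equiv ::
  "'r::{linordered_ab_group_add,ordered_real_vector} set \<Rightarrow> 'r \<Rightarrow> 'r \<Rightarrow> bool" where
  "sme_equiv \<Gamma> x y \<longleftrightarrow> (\<exists>\<sigma>. bij_betw \<sigma> (adjoin \<Gamma> x) (adjoin \<Gamma> y) \<and>
     (\<forall>a\<in>adjoin \<Gamma> x. \<forall>b\<in>adjoin \<Gamma> x. \<sigma> (a + b) = \<sigma> a + \<sigma> b \<and> (\<sigma> a \<le> \<sigma> b \<longleftrightarrow> a \<le> b)) \<and>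
     \<sigma> x = y \<and> (\<forall>\<gamma>\<in>\<Gamma>. \<sigma> \<gamma> = \<gamma>))"

definition sme_representatives ::
  "'r::{linordered_ab_group_add,ordered_real_vector} set \<Rightarrow> 'r set \<Rightarrow> bool" where
  "sme_representatives \<Gamma> S \<longleftrightarrow> div_hull \<Gamma> \<subseteq> S \<and> (\<forall>x. \<exists>!y. y \<in> S \<and> sme_equiv \<Gamma> x y)"

definition sup_in :: "'r::linorder set \<Rightarrow> 'r vext set \<Rightarrow> 'r" where
  "sup_in S X = (THE \<gamma>. \<gamma> \<in> S \<and> (\<forall>x\<in>X. x \<le> Fin \<gamma>) \<and>
     (\<forall>\<delta>\<in>S. (\<forall>x\<in>X. x \<le> Fin \<delta>) \<longrightarrow> \<gamma> \<le> \<delta>))"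

section \<open>Primitive nodes and Okutsu equivalence\<close>

text \<open>From here on \<open>v\<close> is the valuation of the base field, and \<open>S\<close> is the set of representatives.\<close>

definition T_Q :: "('k::field \<Rightarrow> 'r::{linordered_ab_group_add,ordered_real_vector} vext) \<Rightarrow>
    ('k poly \<Rightarrow> 'r vext) set" where
  "T_Q v = tree v (div_hull (value_group v))"

definition T_sme :: "('k::field \<Rightarrow> 'r::{linordered_ab_group_add,ordered_real_vector} vext) \<Rightarrow>
    'r set \<Rightarrow> ('k poly \<Rightarrow> 'r vext) set" where
  "T_sme v S = T_Q v \<union> {\<rho>. inner_node (tree v UNIV) \<rho> \<and> sv \<rho> \<in> Fin ` S}"

text \<open>The node \<open>\<omega>\<close> with index \<open>-\<infinity>\<close>, where \<open>-\<infinity>\<close> is the least element of \<open>S\<close>.\<close>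

definition root_node :: "('k::field \<Rightarrow> 'r::{linordered_ab_group_add,ordered_real_vector} vext) \<Rightarrow>
    'r set \<Rightarrow> 'k poly \<Rightarrow> 'r vext" where
  "root_node v S f =
     Min ((\<lambda>s. v (coeff f s) + (\<Sum>_<s. Fin (LEAST x. x \<in> S))) ` {..degree f})"

definition limit_primitive ::
  "('k::field \<Rightarrow> 'r::{linordered_ab_group_add,ordered_real_vector} vext) \<Rightarrow>
    'r set \<Rightarrow> ('k poly \<Rightarrow> 'r vext) \<Rightarrow> bool" where
  "limit_primitive v S \<mu> \<longleftrightarrow> \<mu> = root_node v S \<or>
     (\<exists>\<A> \<phi>. essential_family v \<A> \<and> \<phi> \<in> KP_inf \<A> \<and>
        \<mu> = lim_aug \<A> \<phi> (Fin (sup_in S ((\<lambda>\<rho>. \<rho> \<phi>) ` \<A>))))"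

definition ordinary_primitive ::
  "('k::field \<Rightarrow> 'r::{linordered_ab_group_add,ordered_real_vector} vext) \<Rightarrow>
    ('k poly \<Rightarrow> 'r vext) \<Rightarrow> bool" where
  "ordinary_primitive v \<mu> \<longleftrightarrow> inner_node (T_Q v) \<mu> \<and> KP_str \<mu> \<noteq> {}"

definition Prim :: "('k::field \<Rightarrow> 'r::{linordered_ab_group_add,ordered_real_vector} vext) \<Rightarrow>
    'r set \<Rightarrow> ('k poly \<Rightarrow> 'r vext) set" where
  "Prim v S = {\<mu> \<in> T_sme v S. limit_primitive v S \<mu> \<or> ordinary_primitive v \<mu>}"

definition aug_path ::
  "'r set \<Rightarrow> ('k::field poly \<Rightarrow> 'r::{linordered_ab_group_add,ordered_real_vector} vext) \<Rightarrow>
    'k poly \<Rightarrow> ('k poly \<Rightarrow> 'r vext) set" where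
  "aug_path S \<rho> \<phi> = {ord_aug \<rho> \<phi> \<gamma> | \<gamma>. \<gamma> \<in> insert Infty (Fin ` S) \<and> \<rho> \<phi> < \<gamma>}"

definition prim_set ::
  "('k::field \<Rightarrow> 'r::{linordered_ab_group_add,ordered_real_vector} vext) \<Rightarrow>
    'r set \<Rightarrow> ('k poly \<Rightarrow> 'r vext) \<Rightarrow> ('k poly \<Rightarrow> 'r vext) set" where
  "prim_set v S \<rho> =
     (if ordinary_primitive v \<rho> then (\<Union>\<phi>\<in>KP_str \<rho>. aug_path S \<rho> \<phi>)
      else insert \<rho> (\<Union>\<phi>\<in>KP \<rho>. aug_path S \<rho> \<phi>))"

definition prev_prim ::
  "('k::field \<Rightarrow> 'r::{linordered_ab_group_add,ordered_real_vector} vext) \<Rightarrow>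
    'r set \<Rightarrow> ('k poly \<Rightarrow> 'r vext) \<Rightarrow> ('k poly \<Rightarrow> 'r vext)" where
  "prev_prim v S f = (THE \<rho>. \<rho> \<in> Prim v S \<and> f \<in> prim_set v S \<rho>)"

definition okutsu :: "('k::field \<Rightarrow> 'r::{linordered_ab_group_add,ordered_real_vector} vext) \<Rightarrow>
    'r set \<Rightarrow> ('k poly \<Rightarrow> 'r vext) rel" where
  "okutsu v S = {(f, f'). f \<in> finite_leaves (T_Q v) \<and> f' \<in> finite_leaves (T_Q v) \<and>
     prev_prim v S f = prev_prim v S f' \<and>
     tangent (prev_prim v S f) f = tangent (prev_prim v S f) f'}"

text \<open>The tangent directions based at a primitive node \<open>\<rho>\<close> are those pointing into
  \<open>prim_set v S \<rho>\<close>: all of \<open>td \<rho>\<close> if \<open>\<rho>\<close> is limit-primitive, and the classes of strong key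
  polynomials if \<open>\<rho>\<close> is ordinary-primitive. In the second case \<open>td \<rho>\<close> also contains classes of
  key polynomials \<open>\<phi>\<close> of degree \<open>deg_val \<rho>\<close>; the previous primitive node of
  \<open>ord_aug \<rho> \<phi> Infty\<close> is then not \<open>\<rho>\<close>, so these directions must be left out.\<close>

definition prim_td ::
  "('k::field \<Rightarrow> 'r::{linordered_ab_group_add,ordered_real_vector} vext) \<Rightarrow>
    ('k poly \<Rightarrow> 'r vext) \<Rightarrow> 'k poly set set" where
  "prim_td v \<rho> = (if ordinary_primitive v \<rho> then {t \<in> td \<rho>. t \<subseteq> KP_str \<rho>} else td \<rho>)"

definition prim_tangent_vectors ::
  "('k::field \<Rightarrow> 'r::{linordered_ab_group_add,ordered_real_vector} vext) \<Rightarrow>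
    'r set \<Rightarrow> (('k poly \<Rightarrow> 'r vext) \<times> 'k poly set) set" where
  "prim_tangent_vectors v S = {(\<rho>, t). \<rho> \<in> Prim v S \<and> t \<in> prim_td v \<rho>}"

end

theory Submission
  imports Defs "HOL-Library.Poly_Mapping"
begin

text \<open>Let \<open>F\<close> be a finite leaf and \<open>p\<close> the monic generator of its support. The nodes below \<open>F\<close> are
  totally ordered, and their directions towards \<open>F\<close> have degree at most \<open>deg p\<close>. If \<open>deg p = 1\<close>, then \<open>p\<close> is a
  direction from the root. If \<open>deg p > 1\<close> and no smaller degree occurs, then \<open>[\<omega>; x, F x]\<close>, with
  \<open>\<omega>\<close> the root, is the primitive node sought. Otherwise let \<open>k\<close> be the largest degree below \<open>deg p\<close>
  that occurs. If there is a last node \<open>\<mu>\<close> with direction \<open>\<phi>\<close> of degree \<open>k\<close>,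
  then \<open>[\<mu>; \<phi>, F \<phi>]\<close> is an ordinary-primitive node from which \<open>p\<close> points to \<open>F\<close>. Otherwise the nodes with
  direction of degree \<open>k\<close> form a family without maximum; if some polynomial \<open>\<phi>\<close> of minimal degree \<open>< deg p\<close> is
  unstable, its limit augmentation with value \<open>F \<phi>\<close> is ordinary-primitive, and if not, the family is
  essential, \<open>p\<close> is a limit key polynomial and the node is limit-primitive.

  Uniqueness rests on one division with remainder: if \<open>\<rho> < \<sigma>\<close> and \<open>\<theta>\<close> is a direction from \<open>\<rho>\<close> to \<open>\<sigma>\<close>, then
  every key polynomial of \<open>\<sigma>\<close> has degree at least \<open>deg \<theta>\<close>. So no node of degree less than \<open>deg p\<close> can lie
  strictly between a node with direction \<open>p\<close> and \<open>F\<close>; an ordinary-primitive node is such a node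
  itself, and a limit-primitive node is approached from below by such nodes.\<close>

section \<open>Values and valuations\<close>

text \<open>Key polynomials are defined through ideals of \<open>gr_alg \<mu>\<close>, whereas nodes
  are compared through inequalities between values. The bridge is \<open>hdiv\<close>: divisibility
  of the initial form of f by that of \<phi> amounts to one inequality
  \<open>\<mu> f < \<mu> (f - h * \<phi>)\<close>, apart from infinite values, and primality has to
  be checked on homogeneous elements only. If \<theta> is a direction from \<mu> to \<nu>, the
  nonzero polynomials whose value grows are exactly those divisible by \<theta> in this sense, so
  \<theta> is a key polynomial because both valuations are multiplicative. The obstacle at
  limit-primitive nodes is that their singular value must be the least upper bound in
  \<open>S\<close> of a set without maximum, hence lie outside the divisible hull. It is obtained by
  ordering \<open>\<Gamma> \<times> \<int>\<close> so that the generator sits in the given cut,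
  embedding this small extension in the ambient space and passing to the representative in
  \<open>S\<close>. Since the value is incommensurable, all key polynomials of such a node share one
  degree and one value.\<close>

lemma vext_less_simps [simp]:
  "Fin a < Fin b \<longleftrightarrow> a < b" "Fin a < Infty" "\<not> Infty < x"
  by (auto simp: less_vext_def)

lemma vext_le_simps [simp]: "Infty \<le> x \<longleftrightarrow> x = Infty" "x \<le> Infty"
  by (cases x; simp)+

lemma vext_less_Infty_iff: "x < Infty \<longleftrightarrow> x \<noteq> Infty"
  by (cases x) auto

lemma vext_plus_Infty [simp]: "Infty + x = Infty" "x + Infty = Infty"
  by (cases x; simp)+

lemma vext_plus_eq_Infty [simp]: "x + y = Infty \<longleftrightarrow> x = Infty \<or> y = Infty"
  by (cases x; cases y) auto

instance vext :: (linordered_ab_group_add) ordered_ab_semigroup_add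
proof
  fix a b c :: "'a vext"
  assume "a \<le> b"
  then show "c + a \<le> c + b" by (cases a; cases b; cases c) auto
qed

lemma vext_add_less_mono:
  fixes a b c :: "'g::linordered_ab_group_add vext"
  assumes "a < b" "c \<noteq> Infty"
  shows "c + a < c + b" "a + c < b + c"
  using assms by (cases a; cases b; cases c; auto)+

lemma vext_add_le_less_mono:
  fixes a b c d :: "'g::linordered_ab_group_add vext"
  assumes "a \<le> b" "c < d" "a \<noteq> Infty"
  shows "a + c < b + d" "c + a < d + b"
  using assms by (cases a; cases b; cases c; cases d; auto simp: add_le_less_mono add_less_le_mono)+

lemma vext_add_less_cancel:
  fixes a b c :: "'g::linordered_ab_group_add vext"
  shows "c + a < c + b \<Longrightarrow> a < b" "a + c < b + c \<Longrightarrow> a < b"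
  by (cases a; cases b; cases c; auto)+

lemma vext_min_add:
  fixes a b c :: "'g::linordered_ab_group_add vext"
  shows "min a b + c = min (a + c) (b + c)"
  by (cases a; cases b; cases c; auto simp: min_def)

context
  fixes \<mu> :: "'a::comm_ring_1 \<Rightarrow> 'g::linordered_ab_group_add vext"
  assumes val: "is_valuation \<mu>"
begin

lemma val_0: "\<mu> 0 = Infty"
  using val by (simp add: is_valuation_def)

lemma val_1: "\<mu> 1 = Fin 0"
  using val by (simp add: is_valuation_def zero_vext_def)

lemma val_mult: "\<mu> (f * g) = \<mu> f + \<mu> g"
  using val by (simp add: is_valuation_def)

lemma val_add: "min (\<mu> f) (\<mu> g) \<le> \<mu> (f + g)"
  using val by (simp add: is_valuation_def)

lemma val_minus: "\<mu> (- f) = \<mu> f"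
proof -
  have "\<mu> (-1) + \<mu> (-1) = Fin 0"
    using val_mult[of "-1" "-1"] val_1 by simp
  then have "\<mu> (-1) = Fin 0"
    by (cases "\<mu> (-1)") auto
  then show ?thesis
    using val_mult[of "-1" f] by (cases "\<mu> f") auto
qed

lemma val_diff: "min (\<mu> f) (\<mu> g) \<le> \<mu> (f - g)"
  using val_add[of f "- g"] val_minus[of g] by simp

lemma val_diff_commute: "\<mu> (f - g) = \<mu> (g - f)"
  using val_minus[of "f - g"] by simp

lemma val_le_add: "c \<le> \<mu> f \<Longrightarrow> c \<le> \<mu> g \<Longrightarrow> c \<le> \<mu> (f + g)"
  using val_add[of f g] by (meson min.boundedI order_trans)

lemma val_le_diff: "c \<le> \<mu> f \<Longrightarrow> c \<le> \<mu> g \<Longrightarrow> c \<le> \<mu> (f - g)"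
  using val_diff[of f g] by (meson min.boundedI order_trans)

lemma val_less_add: "c < \<mu> f \<Longrightarrow> c < \<mu> g \<Longrightarrow> c < \<mu> (f + g)"
  using val_add[of f g] by (meson min_less_iff_conj order_less_le_trans)

lemma val_less_diff: "c < \<mu> f \<Longrightarrow> c < \<mu> g \<Longrightarrow> c < \<mu> (f - g)"
  using val_diff[of f g] by (meson min_less_iff_conj order_less_le_trans)

lemma val_add_eq: "\<mu> f < \<mu> g \<Longrightarrow> \<mu> (f + g) = \<mu> f"
  using val_less_diff[of "\<mu> f" "f + g" g] val_add[of f g]
  by (metis add_diff_cancel_right' leI less_irrefl min.strict_order_iff order_antisym_conv)

lemma val_add_eq': "\<mu> g < \<mu> f \<Longrightarrow> \<mu> (f + g) = \<mu> g"
  using val_add_eq[of g f] by (simp add: add.commute)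

lemma val_add_neq: "\<mu> f \<noteq> \<mu> g \<Longrightarrow> \<mu> (f + g) = min (\<mu> f) (\<mu> g)"
  using val_add_eq val_add_eq' by (metis linorder_neqE min.strict_order_iff min.commute)

lemma val_eq_of_diff: "\<mu> f < \<mu> (f - g) \<Longrightarrow> \<mu> g = \<mu> f"
  using val_add_eq[of f "g - f"] val_diff_commute[of f g] by simp

lemma val_sum: "(\<And>i. i \<in> I \<Longrightarrow> c \<le> \<mu> (h i)) \<Longrightarrow> c \<le> \<mu> (sum h I)"
  by (induction I rule: infinite_finite_induct) (auto simp: val_0 val_le_add)

lemma val_sum_less: "c \<noteq> Infty \<Longrightarrow> (\<And>i. i \<in> I \<Longrightarrow> c < \<mu> (h i)) \<Longrightarrow> c < \<mu> (sum h I)"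
  by (induction I rule: infinite_finite_induct) (auto simp: val_0 val_less_add vext_less_Infty_iff)

end

section \<open>The graded algebra\<close>

text \<open>The graded algebra is the image of a subring of the group algebra of the value group with
  coefficients in \<open>K[x]\<close>: that of all elements whose coefficient at \<open>\<alpha>\<close> has value at least \<open>\<alpha>\<close>.
  The ring axioms are inherited through this surjection.\<close>

abbreviation (input) "lookup \<equiv> Poly_Mapping.lookup"
abbreviation (input) "keys \<equiv> Poly_Mapping.keys"
abbreviation (input) "single \<equiv> Poly_Mapping.single"

definition rees ::
  "('k::field poly \<Rightarrow> 'r::linordered_ab_group_add vext) \<Rightarrow> ('r \<Rightarrow>\<^sub>0 'k poly) set" where
  "rees \<mu> = {a. keys a \<subseteq> val_group \<mu> \<and> (\<forall>\<alpha>. lookup a \<alpha> \<in> P_ge \<mu> \<alpha>)}"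

definition gr_map ::
  "('k::field poly \<Rightarrow> 'r::linordered_ab_group_add vext) \<Rightarrow> ('r \<Rightarrow>\<^sub>0 'k poly) \<Rightarrow> 'r \<Rightarrow> 'k poly set" where
  "gr_map \<mu> a = (\<lambda>\<alpha>\<in>val_group \<mu>. {h. h - lookup a \<alpha> \<in> P_gt \<mu> \<alpha>})"

text \<open>Divisibility of initial forms, freed from the graded algebra: the inequality says that f
  and \<open>h * \<phi>\<close> have the same initial form, and infinite value means initial form
  zero, which everything divides.\<close>

definition hdiv ::
  "('k::field poly \<Rightarrow> 'r::linordered_ab_group_add vext) \<Rightarrow> 'k poly \<Rightarrow> 'k poly \<Rightarrow> bool" where
  "hdiv \<mu> \<phi> f \<longleftrightarrow> \<mu> f = Infty \<or> (\<exists>h. \<mu> f < \<mu> (f - h * \<phi>))"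

lemma sum_single_lookup:
  "(\<Sum>\<alpha>\<in>keys a. single \<alpha> (lookup a \<alpha>)) = a"
  by (rule poly_mapping_eqI) (auto simp: lookup_sum lookup_single when_def in_keys_iff)

text \<open>Exponents form a group, so the first one determines the second as
  \<open>\<gamma> - \<alpha>\<close>; this is the shape of the sum in
  \<open>gr_mult\<close>.\<close>

lemma lookup_mult_keys:
  fixes a b :: "'r::ab_group_add \<Rightarrow>\<^sub>0 'b::comm_ring_1"
  shows "lookup (a * b) \<gamma> = (\<Sum>\<alpha>\<in>keys a. lookup a \<alpha> * lookup b (\<gamma> - \<alpha>))"
proof -
  have eq: "(q = \<gamma> - l) = (\<gamma> = l + q)" for l q :: 'r
    by (auto simp: algebra_simps)
  have "(\<Sum>q. (lookup b q when \<gamma> = l + q)) = lookup b (\<gamma> - l)" for l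
  proof -
    have "(\<lambda>q. lookup b q when \<gamma> = l + q) = (\<lambda>q. lookup b q when q = \<gamma> - l)"
      using eq by (auto simp: when_def)
    then show ?thesis by (simp only: Sum_any_when_equal)
  qed
  then have "lookup (a * b) \<gamma> = (\<Sum>l. lookup a l * lookup b (\<gamma> - l))"
    by (simp add: times_poly_mapping.rep_eq prod_fun_def)
  also have "\<dots> = (\<Sum>\<alpha>\<in>keys a. lookup a \<alpha> * lookup b (\<gamma> - \<alpha>))"
    by (rule Sum_any.expand_superset) (auto simp: in_keys_iff)
  finally show ?thesis .
qed

context
  fixes \<mu> :: "'k::field poly \<Rightarrow> 'r::linordered_ab_group_add vext"
  assumes val: "is_valuation \<mu>"
begin

lemma val_group_0: "0 \<in> val_group \<mu>"
  using val_1[OF val] unfolding val_group_def by (auto intro!: exI[of _ 1])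

lemma val_group_diff:
  assumes "\<alpha> \<in> val_group \<mu>" "\<beta> \<in> val_group \<mu>"
  shows "\<alpha> - \<beta> \<in> val_group \<mu>"
proof -
  obtain f g where f: "\<mu> f \<noteq> Infty" "\<mu> g \<noteq> Infty" "\<mu> f = \<mu> g + Fin \<alpha>"
    using assms unfolding val_group_def by auto
  obtain f' g' where f': "\<mu> f' \<noteq> Infty" "\<mu> g' \<noteq> Infty" "\<mu> f' = \<mu> g' + Fin \<beta>"
    using assms unfolding val_group_def by auto
  have "\<mu> (f * g') = \<mu> (g * f') + Fin (\<alpha> - \<beta>)"
    using f f' unfolding val_mult[OF val]
    by (cases "\<mu> f"; cases "\<mu> g"; cases "\<mu> f'"; cases "\<mu> g'") (auto simp: algebra_simps)
  moreover have "\<mu> (f * g') \<noteq> Infty" "\<mu> (g * f') \<noteq> Infty"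
    using f f' by (auto simp: val_mult[OF val])
  ultimately show ?thesis
    unfolding val_group_def by blast
qed

lemma val_group_add:
  assumes "\<alpha> \<in> val_group \<mu>" "\<beta> \<in> val_group \<mu>"
  shows "\<alpha> + \<beta> \<in> val_group \<mu>"
  using val_group_diff[OF assms(1) val_group_diff[OF val_group_0 assms(2)]] by simp

lemma val_group_val: "\<mu> f = Fin \<alpha> \<Longrightarrow> \<alpha> \<in> val_group \<mu>"
  unfolding val_group_def using val_1[OF val]
  by (intro CollectI exI[of _ f] exI[of _ 1]) auto

lemma P_ge_0 [simp]: "0 \<in> P_ge \<mu> \<alpha>" and P_gt_0 [simp]: "0 \<in> P_gt \<mu> \<alpha>"
  by (auto simp: P_ge_def P_gt_def val_0[OF val])

lemma P_gt_sub_P_ge: "f \<in> P_gt \<mu> \<alpha> \<Longrightarrow> f \<in> P_ge \<mu> \<alpha>"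
  by (auto simp: P_ge_def P_gt_def)

lemma P_ge_add: "f \<in> P_ge \<mu> \<alpha> \<Longrightarrow> g \<in> P_ge \<mu> \<alpha> \<Longrightarrow> f + g \<in> P_ge \<mu> \<alpha>"
  by (simp add: P_ge_def val_le_add[OF val])

lemma P_ge_diff: "f \<in> P_ge \<mu> \<alpha> \<Longrightarrow> g \<in> P_ge \<mu> \<alpha> \<Longrightarrow> f - g \<in> P_ge \<mu> \<alpha>"
  by (simp add: P_ge_def val_le_diff[OF val])

lemma P_gt_add: "f \<in> P_gt \<mu> \<alpha> \<Longrightarrow> g \<in> P_gt \<mu> \<alpha> \<Longrightarrow> f + g \<in> P_gt \<mu> \<alpha>"
  by (simp add: P_gt_def val_less_add[OF val])

lemma P_gt_diff: "f \<in> P_gt \<mu> \<alpha> \<Longrightarrow> g \<in> P_gt \<mu> \<alpha> \<Longrightarrow> f - g \<in> P_gt \<mu> \<alpha>"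
  by (simp add: P_gt_def val_less_diff[OF val])

lemma P_gt_minus: "- f \<in> P_gt \<mu> \<alpha> \<longleftrightarrow> f \<in> P_gt \<mu> \<alpha>"
  by (simp add: P_gt_def val_minus[OF val])

lemma P_ge_minus: "- f \<in> P_ge \<mu> \<alpha> \<longleftrightarrow> f \<in> P_ge \<mu> \<alpha>"
  by (simp add: P_ge_def val_minus[OF val])

lemma P_ge_mult: "f \<in> P_ge \<mu> \<alpha> \<Longrightarrow> g \<in> P_ge \<mu> \<beta> \<Longrightarrow> f * g \<in> P_ge \<mu> (\<alpha> + \<beta>)"
  unfolding P_ge_def val_mult[OF val]
  by (cases "\<mu> f"; cases "\<mu> g") (auto simp: val_mult[OF val] add_mono)

lemma P_gt_mult: "f \<in> P_gt \<mu> \<alpha> \<Longrightarrow> g \<in> P_ge \<mu> \<beta> \<Longrightarrow> f * g \<in> P_gt \<mu> (\<alpha> + \<beta>)"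
  unfolding P_ge_def P_gt_def
  by (cases "\<mu> f"; cases "\<mu> g") (auto simp: val_mult[OF val] add_less_le_mono)

lemma P_gt_mult': "f \<in> P_ge \<mu> \<alpha> \<Longrightarrow> g \<in> P_gt \<mu> \<beta> \<Longrightarrow> f * g \<in> P_gt \<mu> (\<alpha> + \<beta>)"
  using P_gt_mult[of g \<beta> f \<alpha>] by (simp add: mult.commute add.commute)

lemma P_ge_sum: "(\<And>i. i \<in> I \<Longrightarrow> h i \<in> P_ge \<mu> \<alpha>) \<Longrightarrow> sum h I \<in> P_ge \<mu> \<alpha>"
  by (simp add: P_ge_def val_sum[OF val])

lemma P_gt_sum: "(\<And>i. i \<in> I \<Longrightarrow> h i \<in> P_gt \<mu> \<alpha>) \<Longrightarrow> sum h I \<in> P_gt \<mu> \<alpha>"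
  by (simp add: P_gt_def val_sum_less[OF val])

lemma r_coset_P_grp: "P_gt \<mu> \<alpha> #>\<^bsub>P_grp \<mu> \<alpha>\<^esub> g = {h. h - g \<in> P_gt \<mu> \<alpha>}"
  unfolding r_coset_def P_grp_def by (auto simp: algebra_simps intro!: bexI[where x="_ - g"])

lemma carrier_P_grp: "carrier (P_grp \<mu> \<alpha>) = P_ge \<mu> \<alpha>"
  by (simp add: P_grp_def)

lemma coset_eq_iff: "{h. h - f \<in> P_gt \<mu> \<alpha>} = {h. h - g \<in> P_gt \<mu> \<alpha>} \<longleftrightarrow> f - g \<in> P_gt \<mu> \<alpha>"
proof
  assume "{h. h - f \<in> P_gt \<mu> \<alpha>} = {h. h - g \<in> P_gt \<mu> \<alpha>}"
  then have "f \<in> {h. h - g \<in> P_gt \<mu> \<alpha>}" by (metis P_gt_0 cancel_comm_monoid_add_class.diff_cancel mem_Collect_eq)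
  then show "f - g \<in> P_gt \<mu> \<alpha>" by simp
next
  assume fg: "f - g \<in> P_gt \<mu> \<alpha>"
  show "{h. h - f \<in> P_gt \<mu> \<alpha>} = {h. h - g \<in> P_gt \<mu> \<alpha>}"
    using P_gt_add[OF fg] P_gt_diff[OF _ fg]
    by (auto simp: algebra_simps) (metis (no_types, lifting) add_diff_cancel_right' add_diff_eq diff_add_cancel diff_diff_eq2)+
qed

lemma comm_group_P_grp: "comm_group (P_grp \<mu> \<alpha>)"
  by (rule comm_groupI)
    (auto simp: P_grp_def P_ge_add algebra_simps intro: bexI[where x="- _"] simp: P_ge_minus)

lemma group_FactGroup: "group (P_grp \<mu> \<alpha> Mod P_gt \<mu> \<alpha>)"
proof -
  interpret comm_group "P_grp \<mu> \<alpha>" by (rule comm_group_P_grp)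
  have inv: "inv\<^bsub>P_grp \<mu> \<alpha>\<^esub> x = - x" if "x \<in> P_ge \<mu> \<alpha>" for x
    using that by (intro inv_equality) (auto simp: P_grp_def P_ge_minus)
  have "subgroup (P_gt \<mu> \<alpha>) (P_grp \<mu> \<alpha>)"
    by (rule subgroupI)
      (use inv in \<open>auto simp: P_grp_def P_gt_sub_P_ge P_gt_add P_gt_minus intro: P_gt_0\<close>)
  then show ?thesis
    by (intro normal.factorgroup_is_group normal_iff_subgroup[THEN iffD2])
qed

lemma gr_map_apply: "\<alpha> \<in> val_group \<mu> \<Longrightarrow> gr_map \<mu> a \<alpha> = {h. h - lookup a \<alpha> \<in> P_gt \<mu> \<alpha>}"
  by (simp add: gr_map_def)

lemma gr_map_eq_iff:
  "gr_map \<mu> a = gr_map \<mu> b \<longleftrightarrow> (\<forall>\<alpha>\<in>val_group \<mu>. lookup a \<alpha> - lookup b \<alpha> \<in> P_gt \<mu> \<alpha>)"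
  unfolding gr_map_def fun_eq_iff by (auto simp: coset_eq_iff restrict_def)

lemma coset_zero: "{h. h - g \<in> P_gt \<mu> \<alpha>} = P_gt \<mu> \<alpha> \<longleftrightarrow> g \<in> P_gt \<mu> \<alpha>"
  using coset_eq_iff[of g \<alpha> 0] by simp

lemma carrier_gr_alg: "carrier (gr_alg \<mu>) = gr_map \<mu> ` rees \<mu>"
proof -
  have car: "carrier (gr_alg \<mu>) = {x \<in> \<Pi>\<^sub>E i\<in>val_group \<mu>. (\<lambda>g. {h. h - g \<in> P_gt \<mu> i}) ` P_ge \<mu> i.
      finite {i \<in> val_group \<mu>. x i \<noteq> P_gt \<mu> i}}"
    unfolding gr_alg_def gr_sum_def
    by (simp add: carrier_sum_group group_FactGroup)
      (simp add: FactGroup_def RCOSETS_def r_coset_P_grp UNION_singleton_eq_range carrier_P_grp)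
  show ?thesis
  proof (intro equalityI subsetI)
    fix x assume "x \<in> carrier (gr_alg \<mu>)"
    then have x: "x \<in> extensional (val_group \<mu>)" "finite {i \<in> val_group \<mu>. x i \<noteq> P_gt \<mu> i}"
      "\<forall>i\<in>val_group \<mu>. \<exists>g\<in>P_ge \<mu> i. x i = {h. h - g \<in> P_gt \<mu> i}"
      unfolding car by (auto simp: PiE_iff image_def)
    then obtain g where g: "\<And>i. i \<in> val_group \<mu> \<Longrightarrow> g i \<in> P_ge \<mu> i"
      "\<And>i. i \<in> val_group \<mu> \<Longrightarrow> x i = {h. h - g i \<in> P_gt \<mu> i}" by metis
    \<comment> \<open>Trivial components are lifted to 0 instead of an arbitrary representative,
      which keeps the support of the lift finite.\<close>
    define g' where "g' i = (if i \<in> val_group \<mu> \<and> x i \<noteq> P_gt \<mu> i then g i else 0)" for i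
    have fin: "finite {i. g' i \<noteq> 0}"
      by (rule finite_subset[OF _ x(2)]) (auto simp: g'_def)
    have lk: "lookup (Abs_poly_mapping g') = g'"
      using fin by (rule Abs_poly_mapping_inverse[OF CollectI])
    have "Abs_poly_mapping g' \<in> rees \<mu>"
      unfolding rees_def using g(1) by (auto simp: lk in_keys_iff g'_def split: if_splits)
    moreover have "x i = gr_map \<mu> (Abs_poly_mapping g') i" for i
    proof (cases "i \<in> val_group \<mu>")
      case True
      then show ?thesis using g(2)[OF True]
        by (cases "x i = P_gt \<mu> i") (auto simp: gr_map_def lk g'_def)
    next
      case False
      then show ?thesis using x(1) by (simp add: gr_map_def extensional_def)
    qed
    ultimately show "x \<in> gr_map \<mu> ` rees \<mu>" by blast
  next
    fix x assume "x \<in> gr_map \<mu> ` rees \<mu>"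
    then obtain a where a: "a \<in> rees \<mu>" "x = gr_map \<mu> a" by blast
    have "finite {i \<in> val_group \<mu>. gr_map \<mu> a i \<noteq> P_gt \<mu> i}"
      by (rule finite_subset[OF _ finite_keys[of a]]) (auto simp: gr_map_apply coset_zero in_keys_iff)
    then show "x \<in> carrier (gr_alg \<mu>)"
      using a unfolding car by (auto simp: rees_def gr_map_def)
  qed
qed

lemma rees_0: "0 \<in> rees \<mu>" and rees_1: "1 \<in> rees \<mu>"
  using val_group_0 val_1[OF val]
  by (auto simp: rees_def lookup_one P_ge_def when_def val_0[OF val])

lemma rees_single: "\<alpha> \<in> val_group \<mu> \<Longrightarrow> f \<in> P_ge \<mu> \<alpha> \<Longrightarrow> single \<alpha> f \<in> rees \<mu>"
  by (auto simp: rees_def lookup_single when_def)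

lemma rees_add: "a \<in> rees \<mu> \<Longrightarrow> b \<in> rees \<mu> \<Longrightarrow> a + b \<in> rees \<mu>"
  using keys_add[of a b] by (auto simp: rees_def lookup_add P_ge_add)

lemma rees_minus: "a \<in> rees \<mu> \<Longrightarrow> - a \<in> rees \<mu>"
  by (auto simp: rees_def P_ge_minus in_keys_iff)

lemma rees_mult:
  assumes "a \<in> rees \<mu>" "b \<in> rees \<mu>"
  shows "a * b \<in> rees \<mu>"
proof -
  have "lookup (a * b) \<gamma> \<in> P_ge \<mu> \<gamma>" for \<gamma>
    unfolding lookup_mult_keys
    using assms P_ge_mult[of "lookup a \<alpha>" \<alpha> "lookup b (\<gamma> - \<alpha>)" "\<gamma> - \<alpha>" for \<alpha>]
    by (intro P_ge_sum) (auto simp: rees_def)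
  moreover have "keys (a * b) \<subseteq> val_group \<mu>"
    using keys_mult[of a b] assms val_group_add by (auto simp: rees_def dest!: subsetD)
  ultimately show ?thesis by (simp add: rees_def)
qed

lemma gr_map_add:
  assumes "a \<in> rees \<mu>" "b \<in> rees \<mu>"
  shows "gr_map \<mu> a \<oplus>\<^bsub>gr_alg \<mu>\<^esub> gr_map \<mu> b = gr_map \<mu> (a + b)"
proof -
  have "{h. h - f \<in> P_gt \<mu> \<alpha>} <#>\<^bsub>P_grp \<mu> \<alpha>\<^esub> {h. h - g \<in> P_gt \<mu> \<alpha>} = {h. h - (f + g) \<in> P_gt \<mu> \<alpha>}" for f g \<alpha>
  proof (intro equalityI subsetI)
    fix h assume "h \<in> {h. h - f \<in> P_gt \<mu> \<alpha>} <#>\<^bsub>P_grp \<mu> \<alpha>\<^esub> {h. h - g \<in> P_gt \<mu> \<alpha>}"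
    then obtain a b where "a - f \<in> P_gt \<mu> \<alpha>" "b - g \<in> P_gt \<mu> \<alpha>" "h = a + b"
      by (auto simp: set_mult_def P_grp_def)
    then show "h \<in> {h. h - (f + g) \<in> P_gt \<mu> \<alpha>}"
      using P_gt_add[of "a - f" \<alpha> "b - g"] by (simp add: algebra_simps)
  next
    fix h assume "h \<in> {h. h - (f + g) \<in> P_gt \<mu> \<alpha>}"
    then have "h - g - f \<in> P_gt \<mu> \<alpha>" by (simp add: algebra_simps)
    then show "h \<in> {h. h - f \<in> P_gt \<mu> \<alpha>} <#>\<^bsub>P_grp \<mu> \<alpha>\<^esub> {h. h - g \<in> P_gt \<mu> \<alpha>}"
      unfolding set_mult_def P_grp_def by (intro UN_I[of "h - g"] UN_I[of g]) auto
  qed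
  then show ?thesis
    unfolding gr_alg_def gr_sum_def
    by (auto simp: FactGroup_def gr_map_def lookup_add intro!: restrict_ext)
qed

text \<open>Replacing representatives changes each product by an element of \<open>P_gt\<close>,
  since \<open>a b - a' b' = a (b - b') + (a - a') b'\<close>. The sum in \<open>gr_mult\<close>
  runs over the nontrivial components only; the other keys of \<open>a\<close> have coefficients in
  \<open>P_gt\<close> and contribute nothing modulo \<open>P_gt \<mu> \<gamma>\<close>.\<close>

lemma gr_map_mult:
  assumes a: "a \<in> rees \<mu>" and b: "b \<in> rees \<mu>"
  shows "gr_map \<mu> a \<otimes>\<^bsub>gr_alg \<mu>\<^esub> gr_map \<mu> b = gr_map \<mu> (a * b)"
proof -
  let ?V = "val_group \<mu>"
  define S where "S = {\<alpha> \<in> ?V. gr_map \<mu> a \<alpha> \<noteq> P_gt \<mu> \<alpha>}"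
  have S: "S \<subseteq> keys a"
    by (auto simp: S_def gr_map_apply coset_zero in_keys_iff)
  have key: "lookup (a * b) \<gamma> - (\<Sum>\<alpha>\<in>S. a' \<alpha> * b' (\<gamma> - \<alpha>)) \<in> P_gt \<mu> \<gamma>"
    if \<gamma>: "\<gamma> \<in> ?V" and a': "\<forall>\<alpha>\<in>?V. a' \<alpha> \<in> gr_map \<mu> a \<alpha>" and b': "\<forall>\<alpha>\<in>?V. b' \<alpha> \<in> gr_map \<mu> b \<alpha>" for \<gamma> a' b'
  proof -
    have 1: "(\<Sum>\<alpha>\<in>S. lookup a \<alpha> * lookup b (\<gamma> - \<alpha>)) - (\<Sum>\<alpha>\<in>S. a' \<alpha> * b' (\<gamma> - \<alpha>)) \<in> P_gt \<mu> \<gamma>"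
      unfolding sum_subtractf[symmetric]
    proof (rule P_gt_sum)
      fix \<alpha> assume "\<alpha> \<in> S"
      then have \<alpha>: "\<alpha> \<in> ?V" "\<gamma> - \<alpha> \<in> ?V" using val_group_diff[OF \<gamma>] by (auto simp: S_def)
      have "a' \<alpha> - lookup a \<alpha> \<in> P_gt \<mu> \<alpha>" "b' (\<gamma> - \<alpha>) - lookup b (\<gamma> - \<alpha>) \<in> P_gt \<mu> (\<gamma> - \<alpha>)"
        using a' b' \<alpha> by (auto simp: gr_map_apply)
      moreover have la: "lookup a \<alpha> \<in> P_ge \<mu> \<alpha>" and lb: "lookup b (\<gamma> - \<alpha>) \<in> P_ge \<mu> (\<gamma> - \<alpha>)"
        using a b by (auto simp: rees_def)
      ultimately have d: "lookup a \<alpha> - a' \<alpha> \<in> P_gt \<mu> \<alpha>" "lookup b (\<gamma> - \<alpha>) - b' (\<gamma> - \<alpha>) \<in> P_gt \<mu> (\<gamma> - \<alpha>)"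
        using P_gt_minus by (metis minus_diff_eq)+
      have "b' (\<gamma> - \<alpha>) \<in> P_ge \<mu> (\<gamma> - \<alpha>)"
        using P_ge_diff[OF lb P_gt_sub_P_ge[OF d(2)]] by simp
      then have "lookup a \<alpha> * (lookup b (\<gamma> - \<alpha>) - b' (\<gamma> - \<alpha>)) + (lookup a \<alpha> - a' \<alpha>) * b' (\<gamma> - \<alpha>) \<in> P_gt \<mu> (\<alpha> + (\<gamma> - \<alpha>))"
        by (intro P_gt_add P_gt_mult P_gt_mult' la d)
      then show "lookup a \<alpha> * lookup b (\<gamma> - \<alpha>) - a' \<alpha> * b' (\<gamma> - \<alpha>) \<in> P_gt \<mu> \<gamma>"
        by (simp add: algebra_simps)
    qed
    have 2: "(\<Sum>\<alpha>\<in>keys a - S. lookup a \<alpha> * lookup b (\<gamma> - \<alpha>)) \<in> P_gt \<mu> \<gamma>"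
    proof (rule P_gt_sum)
      fix \<alpha> assume "\<alpha> \<in> keys a - S"
      then have "lookup a \<alpha> \<in> P_gt \<mu> \<alpha>" 
        using a by (auto simp: S_def rees_def gr_map_apply coset_zero)
      moreover have "lookup b (\<gamma> - \<alpha>) \<in> P_ge \<mu> (\<gamma> - \<alpha>)" using b by (auto simp: rees_def)
      ultimately show "lookup a \<alpha> * lookup b (\<gamma> - \<alpha>) \<in> P_gt \<mu> \<gamma>"
        using P_gt_mult by fastforce
    qed
    show ?thesis
      using P_gt_add[OF 2 1] unfolding lookup_mult_keys sum.subset_diff[OF S finite_keys, of "\<lambda>\<alpha>. lookup a \<alpha> * lookup b (\<gamma> - \<alpha>)"]
      by (simp add: algebra_simps)
  qed
  have self: "\<forall>\<alpha>\<in>?V. lookup c \<alpha> \<in> gr_map \<mu> c \<alpha>" for c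
    by (simp add: gr_map_apply)
  have "gr_mult \<mu> (gr_map \<mu> a) (gr_map \<mu> b) \<gamma> = gr_map \<mu> (a * b) \<gamma>" for \<gamma>
  proof (cases "\<gamma> \<in> ?V")
    case True
    show ?thesis
    proof (intro equalityI subsetI)
      fix h assume "h \<in> gr_mult \<mu> (gr_map \<mu> a) (gr_map \<mu> b) \<gamma>"
      then obtain a' b' where "\<forall>\<alpha>\<in>?V. a' \<alpha> \<in> gr_map \<mu> a \<alpha>" "\<forall>\<alpha>\<in>?V. b' \<alpha> \<in> gr_map \<mu> b \<alpha>"
        and h: "h - (\<Sum>\<alpha>\<in>S. a' \<alpha> * b' (\<gamma> - \<alpha>)) \<in> P_gt \<mu> \<gamma>"
        using True unfolding gr_mult_def S_def by auto
      then show "h \<in> gr_map \<mu> (a * b) \<gamma>"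
        using P_gt_diff[OF h key[OF True, of a' b']] True by (auto simp: gr_map_apply algebra_simps)
    next
      fix h assume "h \<in> gr_map \<mu> (a * b) \<gamma>"
      then have "h - lookup (a * b) \<gamma> \<in> P_gt \<mu> \<gamma>" using True by (simp add: gr_map_apply)
      from P_gt_add[OF this key[OF True self self]]
      have "h - (\<Sum>\<alpha>\<in>S. lookup a \<alpha> * lookup b (\<gamma> - \<alpha>)) \<in> P_gt \<mu> \<gamma>" by (simp add: algebra_simps)
      then show "h \<in> gr_mult \<mu> (gr_map \<mu> a) (gr_map \<mu> b) \<gamma>"
        using self True unfolding gr_mult_def S_def by auto
    qed
  qed (simp add: gr_mult_def gr_map_def)
  then show ?thesis by (simp add: gr_alg_def fun_eq_iff)
qed

lemma gr_map_0: "\<zero>\<^bsub>gr_alg \<mu>\<^esub> = gr_map \<mu> 0"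
  unfolding gr_alg_def gr_sum_def by (auto simp: FactGroup_def gr_map_def)

lemma in_form_eq_gr_map: "\<mu> f = Fin \<alpha> \<Longrightarrow> in_form \<mu> f = gr_map \<mu> (single \<alpha> f)"
  unfolding in_form_def gr_map_def r_coset_P_grp by (auto simp: lookup_single when_def intro!: restrict_ext)

lemma in_form_Infty: "\<mu> f = Infty \<Longrightarrow> in_form \<mu> f = gr_map \<mu> 0"
  unfolding in_form_def gr_map_def by auto

lemma gr_map_1: "\<one>\<^bsub>gr_alg \<mu>\<^esub> = gr_map \<mu> 1"
  using in_form_eq_gr_map[OF val_1[OF val]] by (simp add: gr_alg_def)

lemma in_form_carrier: "in_form \<mu> f \<in> carrier (gr_alg \<mu>)"
  unfolding carrier_gr_alg
  by (cases "\<mu> f")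
    (auto simp: in_form_eq_gr_map in_form_Infty rees_0 P_ge_def val_group_val intro!: imageI rees_single)

lemma cring_gr_alg: "cring (gr_alg \<mu>)"
proof (rule cringI)
  show "abelian_group (gr_alg \<mu>)"
  proof (rule abelian_groupI; clarsimp simp only: carrier_gr_alg gr_map_0)
    show "\<exists>y\<in>gr_map \<mu> ` rees \<mu>. y \<oplus>\<^bsub>gr_alg \<mu>\<^esub> gr_map \<mu> a = gr_map \<mu> 0" if "a \<in> rees \<mu>" for a
      using that by (intro bexI[of _ "gr_map \<mu> (- a)"]) (auto simp: gr_map_add rees_minus)
  qed (auto simp: gr_map_add rees_add rees_0 algebra_simps)
  show "comm_monoid (gr_alg \<mu>)"
    by (rule comm_monoidI; clarsimp simp only: carrier_gr_alg gr_map_1)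
      (auto simp: gr_map_mult rees_mult rees_1 algebra_simps)
qed (auto simp: carrier_gr_alg gr_map_add gr_map_mult rees_mult rees_add algebra_simps)

section \<open>Key polynomials through divisibility of initial forms\<close>

lemma in_form_mult: "in_form \<mu> f \<otimes>\<^bsub>gr_alg \<mu>\<^esub> in_form \<mu> g = in_form \<mu> (f * g)"
proof (cases "\<mu> f = Infty \<or> \<mu> g = Infty")
  case True
  then have "in_form \<mu> (f * g) = \<zero>\<^bsub>gr_alg \<mu>\<^esub>"
    by (simp add: in_form_Infty gr_map_0 val_mult[OF val])
  moreover have "in_form \<mu> f = \<zero>\<^bsub>gr_alg \<mu>\<^esub> \<or> in_form \<mu> g = \<zero>\<^bsub>gr_alg \<mu>\<^esub>"
    using True by (auto simp: in_form_Infty gr_map_0)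
  ultimately show ?thesis
    using in_form_carrier cring.cring_simprules(26,27)[OF cring_gr_alg] by metis
next
  case False
  then obtain \<alpha> \<beta> where ab: "\<mu> f = Fin \<alpha>" "\<mu> g = Fin \<beta>"
    by (metis vext.exhaust)
  then have "\<mu> (f * g) = Fin (\<alpha> + \<beta>)" by (simp add: val_mult[OF val])
  with ab show ?thesis
    by (simp add: in_form_eq_gr_map gr_map_mult rees_single val_group_val P_ge_def mult_single)
qed

lemma in_form_eq_iff:
  "in_form \<mu> f = in_form \<mu> g \<longleftrightarrow> (\<mu> f = Infty \<and> \<mu> g = Infty) \<or> \<mu> f < \<mu> (f - g)"
proof (cases "\<mu> f")
  case (Fin \<alpha>)
  note f = Fin
  have V: "\<alpha> \<in> val_group \<mu>" by (rule val_group_val[OF f])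
  show ?thesis
  proof (cases "\<mu> g")
    case (Fin \<beta>)
    show ?thesis
    proof (cases "\<alpha> = \<beta>")
      case True
      then show ?thesis using f Fin V
        by (auto simp: in_form_eq_gr_map gr_map_eq_iff lookup_single when_def P_gt_def val_0[OF val])
    next
      case False
      then have "\<not> \<mu> f < \<mu> (f - g)" using val_eq_of_diff[OF val, of f g] f Fin by auto
      moreover have "in_form \<mu> f \<noteq> in_form \<mu> g" using f Fin V False
        by (auto simp: in_form_eq_gr_map gr_map_eq_iff lookup_single when_def P_gt_def intro!: bexI[of _ \<alpha>])
      ultimately show ?thesis using f Fin by auto
    qed
  next
    case Infty
    then have "\<not> \<mu> f < \<mu> (f - g)" using val_eq_of_diff[OF val, of f g] f by auto
    moreover have "in_form \<mu> f \<noteq> in_form \<mu> g" using f Infty V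
      by (auto simp: in_form_eq_gr_map in_form_Infty gr_map_eq_iff lookup_single when_def P_gt_def intro!: bexI[of _ \<alpha>])
    ultimately show ?thesis using f Infty by auto
  qed
next
  case Infty
  note f = Infty
  show ?thesis
  proof (cases "\<mu> g")
    case (Fin \<beta>)
    then have "in_form \<mu> f \<noteq> in_form \<mu> g" using f val_group_val[OF Fin]
      by (auto simp: in_form_eq_gr_map in_form_Infty gr_map_eq_iff lookup_single when_def P_gt_def val_minus[OF val]
          intro!: bexI[of _ \<beta>])
    then show ?thesis using f Fin by auto
  qed (use f in \<open>auto simp: in_form_Infty\<close>)
qed

lemma mu_equiv_iff: "mu_equiv \<mu> f g \<longleftrightarrow> (\<mu> f = Infty \<and> \<mu> g = Infty) \<or> \<mu> f < \<mu> (f - g)"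
  by (simp add: mu_equiv_def in_form_eq_iff)

lemma lookup_single_mult:
  "lookup (single \<beta> f * c) \<alpha> = f * lookup c (\<alpha> - \<beta>)"
  for f :: "'k poly" and c :: "'r \<Rightarrow>\<^sub>0 'k poly"
  by (cases "f = 0") (auto simp: lookup_mult_keys)

text \<open>Since the initial form of \<phi> is homogeneous, multiplying by it only shifts degrees,
  so every single component of the product is a multiple of \<phi>.\<close>

lemma gr_map_multiple_of_in_form:
  assumes "gr_map \<mu> a = in_form \<mu> \<phi> \<otimes>\<^bsub>gr_alg \<mu>\<^esub> c" "c \<in> carrier (gr_alg \<mu>)" "\<alpha> \<in> val_group \<mu>"
  shows "\<exists>h. lookup a \<alpha> - h * \<phi> \<in> P_gt \<mu> \<alpha>"
proof -
  obtain c' where c': "c' \<in> rees \<mu>" "c = gr_map \<mu> c'" using assms by (auto simp: carrier_gr_alg)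
  show ?thesis
  proof (cases "\<mu> \<phi>")
    case (Fin \<beta>)
    then have "gr_map \<mu> a = gr_map \<mu> (single \<beta> \<phi> * c')"
      using assms c' by (simp add: in_form_eq_gr_map gr_map_mult rees_single val_group_val P_ge_def)
    then show ?thesis
      using assms(3)
      by (intro exI[of _ "lookup c' (\<alpha> - \<beta>)"])
        (simp add: gr_map_eq_iff lookup_single_mult mult.commute[of _ \<phi>])
  next
    case Infty
    then have "gr_map \<mu> a = gr_map \<mu> (0 * c')"
      using assms c' by (simp only: in_form_Infty gr_map_mult rees_0)
    then show ?thesis
      using assms(3) by (intro exI[of _ 0]) (auto simp: gr_map_eq_iff)
  qed
qed

lemma in_form_multiple_iff:
  "(\<exists>c\<in>carrier (gr_alg \<mu>). in_form \<mu> f = in_form \<mu> \<phi> \<otimes>\<^bsub>gr_alg \<mu>\<^esub> c) \<longleftrightarrow> hdiv \<mu> \<phi> f"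
proof
  assume "\<exists>c\<in>carrier (gr_alg \<mu>). in_form \<mu> f = in_form \<mu> \<phi> \<otimes>\<^bsub>gr_alg \<mu>\<^esub> c"
  then obtain c where c: "c \<in> carrier (gr_alg \<mu>)" "in_form \<mu> f = in_form \<mu> \<phi> \<otimes>\<^bsub>gr_alg \<mu>\<^esub> c" by blast
  show "hdiv \<mu> \<phi> f"
  proof (cases "\<mu> f")
    case (Fin \<alpha>)
    then have "gr_map \<mu> (single \<alpha> f) = in_form \<mu> \<phi> \<otimes>\<^bsub>gr_alg \<mu>\<^esub> c"
      using c by (simp add: in_form_eq_gr_map)
    from gr_map_multiple_of_in_form[OF this c(1) val_group_val[OF Fin]]
    show ?thesis using Fin by (auto simp: hdiv_def P_gt_def)
  qed (simp add: hdiv_def)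
next
  assume "hdiv \<mu> \<phi> f"
  then consider "\<mu> f = Infty" | h where "\<mu> f < \<mu> (f - h * \<phi>)" unfolding hdiv_def by blast
  then show "\<exists>c\<in>carrier (gr_alg \<mu>). in_form \<mu> f = in_form \<mu> \<phi> \<otimes>\<^bsub>gr_alg \<mu>\<^esub> c"
  proof cases
    case 1
    then show ?thesis
      by (intro bexI[of _ "in_form \<mu> 0"])
        (simp_all add: in_form_mult in_form_carrier in_form_eq_iff val_0[OF val])
  next
    case 2
    then show ?thesis
      by (intro bexI[of _ "in_form \<mu> h"])
        (simp_all add: in_form_mult in_form_carrier in_form_eq_iff mult.commute)
  qed
qed

lemma mu_divides_iff: "mu_divides \<mu> \<phi> f \<longleftrightarrow> hdiv \<mu> \<phi> f"
  unfolding mu_divides_def factor_def using in_form_multiple_iff by blast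

lemma PIdl_in_form:
  "PIdl\<^bsub>gr_alg \<mu>\<^esub> (in_form \<mu> \<phi>) = {x. \<exists>c\<in>carrier (gr_alg \<mu>). x = in_form \<mu> \<phi> \<otimes>\<^bsub>gr_alg \<mu>\<^esub> c}"
  unfolding cgenideal_def
  using cring.cring_simprules(14)[OF cring_gr_alg _ in_form_carrier] by (auto; metis)

lemma in_form_PIdl: "in_form \<mu> f \<in> PIdl\<^bsub>gr_alg \<mu>\<^esub> (in_form \<mu> \<phi>) \<longleftrightarrow> hdiv \<mu> \<phi> f"
  using in_form_multiple_iff by (auto simp: PIdl_in_form)

lemma one_in_form: "\<one>\<^bsub>gr_alg \<mu>\<^esub> = in_form \<mu> 1"
  by (simp add: gr_alg_def)

lemma zero_in_form: "\<zero>\<^bsub>gr_alg \<mu>\<^esub> = in_form \<mu> 0"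
  by (simp add: in_form_Infty gr_map_0 val_0[OF val])

text \<open>A principal ideal with homogeneous generator is homogeneous: an element belongs to it as
  soon as its components do, because it is their finite sum.\<close>

lemma gr_map_PIdl:
  assumes a: "a \<in> rees \<mu>"
  shows "gr_map \<mu> a \<in> PIdl\<^bsub>gr_alg \<mu>\<^esub> (in_form \<mu> \<phi>) \<longleftrightarrow>
    (\<forall>\<alpha>\<in>val_group \<mu>. \<exists>h. lookup a \<alpha> - h * \<phi> \<in> P_gt \<mu> \<alpha>)" (is "_ \<in> ?I \<longleftrightarrow> ?R")
proof
  assume "gr_map \<mu> a \<in> ?I"
  then show ?R using gr_map_multiple_of_in_form unfolding PIdl_in_form by blast
next
  assume R: ?R
  interpret ideal ?I "gr_alg \<mu>"
    by (rule cring.cgenideal_ideal[OF cring_gr_alg in_form_carrier])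
  have hom: "gr_map \<mu> (single \<alpha> f) \<in> ?I"
    if \<alpha>: "\<alpha> \<in> val_group \<mu>" and f: "f \<in> P_ge \<mu> \<alpha>" and D: "\<exists>h. f - h * \<phi> \<in> P_gt \<mu> \<alpha>" for \<alpha> f
  proof (cases "f \<in> P_gt \<mu> \<alpha>")
    case True
    then have "gr_map \<mu> (single \<alpha> f) = \<zero>\<^bsub>gr_alg \<mu>\<^esub>"
      by (auto simp: gr_map_0 gr_map_eq_iff lookup_single when_def P_gt_0)
    then show ?thesis using additive_subgroup.zero_closed[OF additive_subgroup_axioms] by simp
  next
    case False
    then have v: "\<mu> f = Fin \<alpha>" using f by (auto simp: P_ge_def P_gt_def)
    then have "hdiv \<mu> \<phi> f" using D by (auto simp: hdiv_def P_gt_def)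
    then show ?thesis using in_form_PIdl[of f \<phi>] v by (simp add: in_form_eq_gr_map)
  qed
  have "gr_map \<mu> (\<Sum>\<alpha>\<in>F. single \<alpha> (lookup a \<alpha>)) \<in> ?I \<and>
      (\<Sum>\<alpha>\<in>F. single \<alpha> (lookup a \<alpha>)) \<in> rees \<mu>"
    if "finite F" "F \<subseteq> keys a" for F
    using that
  proof (induction F rule: finite_induct)
    case empty
    then show ?case
      using additive_subgroup.zero_closed[OF additive_subgroup_axioms] by (simp add: gr_map_0[symmetric] rees_0)
  next
    case (insert \<alpha> F)
    let ?s = "single \<alpha> (lookup a \<alpha>)"
    have "\<alpha> \<in> val_group \<mu>" "lookup a \<alpha> \<in> P_ge \<mu> \<alpha>"
      using a insert.prems by (auto simp: rees_def)
    then have "?s \<in> rees \<mu>" "gr_map \<mu> ?s \<in> ?I"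
      using R by (auto intro: rees_single hom)
    with insert show ?case
      using additive_subgroup.a_closed[OF additive_subgroup_axioms]
      by (simp add: gr_map_add[symmetric] rees_add)
  qed
  from this[of "keys a"] show "gr_map \<mu> a \<in> ?I"
    by (simp add: sum_single_lookup)
qed

lemma KP_D:
  assumes "\<phi> \<in> KP \<mu>"
  shows "lead_coeff \<phi> = 1" "\<mu> \<phi> \<noteq> Infty" "\<not> hdiv \<mu> \<phi> 1"
    "\<And>f. f \<noteq> 0 \<Longrightarrow> degree f < degree \<phi> \<Longrightarrow> \<not> hdiv \<mu> \<phi> f"
    "\<And>f g. hdiv \<mu> \<phi> (f * g) \<Longrightarrow> hdiv \<mu> \<phi> f \<or> hdiv \<mu> \<phi> g"
proof -
  let ?I = "PIdl\<^bsub>gr_alg \<mu>\<^esub> (in_form \<mu> \<phi>)"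
  have *: "primeideal ?I (gr_alg \<mu>)" "?I \<noteq> {\<zero>\<^bsub>gr_alg \<mu>\<^esub>}"
    using assms by (auto simp: KP_def mu_irreducible_def)
  interpret primeideal ?I "gr_alg \<mu>" by (rule *)
  show "lead_coeff \<phi> = 1" using assms by (simp add: KP_def)
  show "\<not> hdiv \<mu> \<phi> f" if "f \<noteq> 0" "degree f < degree \<phi>" for f
    using assms that by (auto simp: KP_def mu_minimal_def mu_divides_iff)
  show "hdiv \<mu> \<phi> f \<or> hdiv \<mu> \<phi> g" if "hdiv \<mu> \<phi> (f * g)" for f g
    using that I_prime[OF in_form_carrier in_form_carrier, of f g]
    by (simp add: in_form_mult in_form_PIdl)
  show "\<not> hdiv \<mu> \<phi> 1"
    using I_notcarr one_imp_carrier by (auto simp: one_in_form in_form_PIdl)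
  show "\<mu> \<phi> \<noteq> Infty"
  proof
    assume "\<mu> \<phi> = Infty"
    then have "in_form \<mu> \<phi> = \<zero>\<^bsub>gr_alg \<mu>\<^esub>" by (simp add: in_form_Infty gr_map_0)
    then have "?I = {\<zero>\<^bsub>gr_alg \<mu>\<^esub>}" unfolding PIdl_in_form by (auto intro: bexI[of _ "\<zero>\<^bsub>gr_alg \<mu>\<^esub>"])
    with *(2) show False by simp
  qed
qed

text \<open>Primality is given for homogeneous elements and must be extended to sums. Among the
  components of x and of y outside the ideal take those of highest degrees \<alpha> and \<beta>. In
  degree \<open>\<alpha> + \<beta>\<close> every other term of the product has a factor of higher
  degree than the chosen one, hence lies in the ideal; so the product of the two chosen components
  would lie in it as well.\<close>

lemma KP_I:
  assumes "lead_coeff \<phi> = 1" "\<mu> \<phi> \<noteq> Infty" and n1: "\<not> hdiv \<mu> \<phi> 1"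
    and min: "\<And>f. f \<noteq> 0 \<Longrightarrow> degree f < degree \<phi> \<Longrightarrow> \<not> hdiv \<mu> \<phi> f"
    and prime: "\<And>f g. hdiv \<mu> \<phi> (f * g) \<Longrightarrow> hdiv \<mu> \<phi> f \<or> hdiv \<mu> \<phi> g"
  shows "\<phi> \<in> KP \<mu>"
proof -
  let ?I = "PIdl\<^bsub>gr_alg \<mu>\<^esub> (in_form \<mu> \<phi>)"
  let ?V = "val_group \<mu>"
  \<comment> \<open>Divisibility in a prescribed degree \<alpha>. It includes every f of value
    greater than \<alpha>, whose class in degree \<alpha> is zero, and is therefore additive, unlike
    \<open>hdiv\<close>.\<close>
  define D where "D \<alpha> f \<longleftrightarrow> (\<exists>h. f - h * \<phi> \<in> P_gt \<mu> \<alpha>)" for \<alpha> f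
  have D_mult: "D (\<alpha> + \<beta>) (f * g)" if fg: "D \<alpha> f" "g \<in> P_ge \<mu> \<beta>" for \<alpha> \<beta> f g
  proof -
    obtain h where "f - h * \<phi> \<in> P_gt \<mu> \<alpha>" using fg by (auto simp: D_def)
    then have "(f - h * \<phi>) * g \<in> P_gt \<mu> (\<alpha> + \<beta>)" using fg by (intro P_gt_mult)
    moreover have "(f - h * \<phi>) * g = f * g - (h * g) * \<phi>" by (simp add: algebra_simps)
    ultimately show ?thesis by (auto simp: D_def)
  qed
  have D_diff: "D \<alpha> (f - g)" if fg: "D \<alpha> f" "D \<alpha> g" for \<alpha> f g
  proof -
    obtain h k where "f - h * \<phi> \<in> P_gt \<mu> \<alpha>" "g - k * \<phi> \<in> P_gt \<mu> \<alpha>" using fg by (auto simp: D_def)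
    from P_gt_diff[OF this] show ?thesis
      by (auto simp: D_def algebra_simps intro!: exI[of _ "h - k"])
  qed
  have D_0: "D \<alpha> f" if "f \<in> P_gt \<mu> \<alpha>" for \<alpha> f
    unfolding D_def using that by (intro exI[of _ 0]) simp
  have D_sum: "D \<alpha> (sum h F)" if "\<And>i. i \<in> F \<Longrightarrow> D \<alpha> (h i)" for \<alpha> h and F :: "'r set"
    using that
  proof (induction F rule: infinite_finite_induct)
    case (insert x F)
    then show ?case
      using D_diff[of \<alpha> "h x" "0 - sum h F"] D_diff[OF D_0, of 0 \<alpha> "sum h F"] P_gt_0
      by simp
  qed (auto intro: D_0 P_gt_0)
  have mem: "gr_map \<mu> a \<in> ?I \<longleftrightarrow> (\<forall>\<alpha>\<in>?V. D \<alpha> (lookup a \<alpha>))" if "a \<in> rees \<mu>" for a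
    using gr_map_PIdl[OF that] by (simp add: D_def)
  have exact: "\<mu> f = Fin \<alpha>" if "f \<in> P_ge \<mu> \<alpha>" "\<not> D \<alpha> f" for f \<alpha>
    using that D_0[of f \<alpha>] by (cases "Fin \<alpha> < \<mu> f") (auto simp: P_ge_def P_gt_def not_less)
  have D_hdiv: "hdiv \<mu> \<phi> f \<longleftrightarrow> D \<alpha> f" if "\<mu> f = Fin \<alpha>" for f \<alpha>
    using that by (auto simp: hdiv_def D_def P_gt_def)
  have "primeideal ?I (gr_alg \<mu>)"
  proof (rule primeidealI)
    show id: "ideal ?I (gr_alg \<mu>)"
      by (rule cring.cgenideal_ideal[OF cring_gr_alg in_form_carrier])
    show "cring (gr_alg \<mu>)" by (rule cring_gr_alg)
    show "carrier (gr_alg \<mu>) \<noteq> ?I"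
      using in_form_PIdl[of 1 \<phi>] n1 in_form_carrier by blast
    fix x y assume x: "x \<in> carrier (gr_alg \<mu>)" and y: "y \<in> carrier (gr_alg \<mu>)"
      and xy: "x \<otimes>\<^bsub>gr_alg \<mu>\<^esub> y \<in> ?I"
    obtain a b where a: "a \<in> rees \<mu>" "x = gr_map \<mu> a" and b: "b \<in> rees \<mu>" "y = gr_map \<mu> b"
      using x y by (auto simp: carrier_gr_alg)
    let ?a = "lookup a" and ?b = "lookup b"
    have ab: "D \<gamma> (lookup (a * b) \<gamma>)" if "\<gamma> \<in> ?V" for \<gamma>
      using xy that a b by (simp add: gr_map_mult mem rees_mult)
    show "x \<in> ?I \<or> y \<in> ?I"
    proof (rule ccontr)
      assume "\<not> (x \<in> ?I \<or> y \<in> ?I)"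
      define A where "A = {\<alpha> \<in> ?V. \<not> D \<alpha> (?a \<alpha>)}"
      define B where "B = {\<alpha> \<in> ?V. \<not> D \<alpha> (?b \<alpha>)}"
      have "A \<subseteq> keys a" "B \<subseteq> keys b"
        unfolding A_def B_def using D_0[OF P_gt_0] by (auto simp: in_keys_iff)
      then have fin: "finite A" "finite B" using finite_subset finite_keys by blast+
      have ne: "A \<noteq> {}" "B \<noteq> {}"
        using \<open>\<not> (x \<in> ?I \<or> y \<in> ?I)\<close> a b by (auto simp: mem A_def B_def)
      define \<alpha> where "\<alpha> = Max A"
      define \<beta> where "\<beta> = Max B"
      have \<alpha>: "\<alpha> \<in> A" and \<beta>: "\<beta> \<in> B" using fin ne by (auto simp: \<alpha>_def \<beta>_def)
      have V: "\<alpha> + \<beta> \<in> ?V" using \<alpha> \<beta> by (auto simp: A_def B_def intro: val_group_add)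
      have key: "D (\<alpha> + \<beta>) (?a \<delta> * ?b (\<alpha> + \<beta> - \<delta>))" if \<delta>: "\<delta> \<in> keys a - {\<alpha>}" for \<delta>
      proof -
        have dV: "\<delta> \<in> ?V" using a \<delta> by (auto simp: rees_def)
        then have dV': "\<alpha> + \<beta> - \<delta> \<in> ?V" using V by (intro val_group_diff)
        have ge: "?a \<delta> \<in> P_ge \<mu> \<delta>" "?b (\<alpha> + \<beta> - \<delta>) \<in> P_ge \<mu> (\<alpha> + \<beta> - \<delta>)"
          using a b by (auto simp: rees_def)
        show ?thesis
        proof (cases "\<alpha> < \<delta>")
          case True
          then have "\<delta> \<notin> A" using Max_ge[OF fin(1), of \<delta>] unfolding \<alpha>_def[symmetric] by (meson leD)
          then have "D \<delta> (?a \<delta>)" using dV by (simp add: A_def)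
          then show ?thesis using D_mult[of \<delta> "?a \<delta>" "?b (\<alpha> + \<beta> - \<delta>)" "\<alpha> + \<beta> - \<delta>"] ge by simp
        next
          case False
          then have "\<delta> < \<alpha>" using \<delta> by auto
          then have "\<beta> < \<alpha> + \<beta> - \<delta>" by (simp add: algebra_simps)
          then have "\<alpha> + \<beta> - \<delta> \<notin> B" using Max_ge[OF fin(2), of "\<alpha> + \<beta> - \<delta>"] unfolding \<beta>_def[symmetric] by (meson leD)
          then have "D (\<alpha> + \<beta> - \<delta>) (?b (\<alpha> + \<beta> - \<delta>))" using dV' by (simp add: B_def)
          then show ?thesis using D_mult[of "\<alpha> + \<beta> - \<delta>" "?b (\<alpha> + \<beta> - \<delta>)" "?a \<delta>" "\<delta>"] ge
            by (simp add: mult.commute)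
        qed
      qed
      have "\<alpha> \<in> keys a" using \<alpha> \<open>A \<subseteq> keys a\<close> by auto
      then have "lookup (a * b) (\<alpha> + \<beta>) =
          ?a \<alpha> * ?b \<beta> + (\<Sum>\<delta>\<in>keys a - {\<alpha>}. ?a \<delta> * ?b (\<alpha> + \<beta> - \<delta>))"
        unfolding lookup_mult_keys by (subst sum.remove[of _ \<alpha>]) auto
      then have "?a \<alpha> * ?b \<beta> = lookup (a * b) (\<alpha> + \<beta>) -
          (\<Sum>\<delta>\<in>keys a - {\<alpha>}. ?a \<delta> * ?b (\<alpha> + \<beta> - \<delta>))" by simp
      then have "D (\<alpha> + \<beta>) (?a \<alpha> * ?b \<beta>)"
        using D_diff[OF ab[OF V] D_sum[of "keys a - {\<alpha>}", OF key]] by simp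
      moreover have "\<mu> (?a \<alpha>) = Fin \<alpha>" "\<mu> (?b \<beta>) = Fin \<beta>"
        using \<alpha> \<beta> a b by (auto simp: A_def B_def rees_def intro: exact)
      ultimately have "hdiv \<mu> \<phi> (?a \<alpha>) \<or> hdiv \<mu> \<phi> (?b \<beta>)"
        using prime D_hdiv[of "?a \<alpha> * ?b \<beta>" "\<alpha> + \<beta>"] by (simp add: val_mult[OF val])
      then show False
        using \<alpha> \<beta> D_hdiv[OF \<open>\<mu> (?a \<alpha>) = Fin \<alpha>\<close>] D_hdiv[OF \<open>\<mu> (?b \<beta>) = Fin \<beta>\<close>]
        by (auto simp: A_def B_def)
    qed
  qed
  moreover have "?I \<noteq> {\<zero>\<^bsub>gr_alg \<mu>\<^esub>}"
  proof
    assume "?I = {\<zero>\<^bsub>gr_alg \<mu>\<^esub>}"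
    moreover have "in_form \<mu> \<phi> \<in> ?I"
      using assms(2) by (auto simp: in_form_PIdl hdiv_def val_0[OF val] vext_less_Infty_iff intro!: exI[of _ 1])
    ultimately have "in_form \<mu> \<phi> = in_form \<mu> 0" by (simp add: zero_in_form)
    then show False using assms(2) by (auto simp: in_form_eq_iff val_0[OF val])
  qed
  ultimately show ?thesis
    using assms by (auto simp: KP_def mu_irreducible_def mu_minimal_def mu_divides_iff)
qed

end

section \<open>Comparing valuations on polynomials\<close>

lemma degree_mod_lt:
  fixes \<phi> :: "'k::field poly"
  assumes "0 < degree \<phi>"
  shows "degree (f mod \<phi>) < degree \<phi>"
  using degree_exp_coeff[OF assms, of f 0] by (simp add: exp_coeff_def)

text \<open>Induction on the number of digits in base \<phi>: r is the lowest digit and q carries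
  the others.\<close>

lemma poly_expansion_induct [consumes 1, case_names zero step]:
  fixes \<phi> :: "'k::field poly"
  assumes "0 < degree \<phi>" "P 0" "\<And>q r. degree r < degree \<phi> \<Longrightarrow> P q \<Longrightarrow> P (q * \<phi> + r)"
  shows "P f"
proof (induction "degree f" arbitrary: f rule: less_induct)
  case less
  have dm: "degree (f mod \<phi>) < degree \<phi>" by (rule degree_mod_lt[OF assms(1)])
  have "P (f div \<phi>)"
  proof (cases "degree f = 0")
    case True
    then have "f div \<phi> = 0" using assms(1) by (simp add: div_poly_less)
    then show ?thesis using assms(2) by simp
  next
    case False
    then show ?thesis using less degree_div_less[of f \<phi>] assms(1) by simp
  qed
  from assms(3)[OF dm this] show ?case by simp
qed

lemma insert_Infty_range: "insert Infty (range Fin) = UNIV"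
proof -
  have "x \<in> insert Infty (range Fin)" for x :: "'a vext" by (cases x) auto
  then show ?thesis by blast
qed

lemma KP_degree_pos:
  assumes "is_valuation \<mu>" "\<phi> \<in> KP \<mu>"
  shows "0 < degree \<phi>"
proof (rule ccontr)
  assume "\<not> 0 < degree \<phi>"
  then have "\<phi> = 1"
    using KP_D(1)[OF assms] by (metis gr0I degree_0_id one_pCons)
  moreover have "hdiv \<mu> 1 1"
    using val_0[OF assms(1)] val_1[OF assms(1)] by (auto simp: hdiv_def intro!: exI[of _ 1])
  ultimately show False using KP_D(3)[OF assms] by simp
qed

lemma KP_nonzero: "is_valuation \<mu> \<Longrightarrow> \<phi> \<in> KP \<mu> \<Longrightarrow> \<phi> \<noteq> 0"
  using KP_degree_pos by fastforce

lemma KP_low_finite: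
  assumes "is_valuation \<mu>" "\<phi> \<in> KP \<mu>" "degree r < degree \<phi>" "r \<noteq> 0"
  shows "\<mu> r \<noteq> Infty"
  using KP_D(4)[OF assms(1,2,4,3)] by (auto simp: hdiv_def)

text \<open>Cancellation could only occur if r and \<open>q * \<phi>\<close> had equal values; the
  initial form of r would then be divisible by that of \<phi>, against minimality.\<close>

lemma KP_expansion:
  assumes val: "is_valuation \<mu>" and \<phi>: "\<phi> \<in> KP \<mu>" and r: "degree r < degree \<phi>"
  shows "\<mu> (q * \<phi> + r) = min (\<mu> r) (\<mu> q + \<mu> \<phi>)"
proof (cases "r = 0")
  case True
  then show ?thesis by (simp add: val_0[OF val] val_mult[OF val] min_def)
next
  case False
  show ?thesis
  proof (cases "\<mu> r = \<mu> (q * \<phi>)")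
    case True
    have "\<not> \<mu> r < \<mu> (r - (- q) * \<phi>)"
      using KP_D(4)[OF val \<phi> False r] unfolding hdiv_def by blast
    then have "\<mu> (q * \<phi> + r) \<le> \<mu> r" by (simp add: add.commute)
    moreover have "\<mu> r \<le> \<mu> (q * \<phi> + r)" using val_add[OF val, of "q * \<phi>" r] True by simp
    ultimately show ?thesis using True by (simp add: val_mult[OF val])
  next
    case False
    then show ?thesis
      using val_add_neq[OF val, of r "q * \<phi>"] by (simp add: val_mult[OF val] add.commute)
  qed
qed

lemma val_mod_supp:
  fixes \<mu> :: "'k::field poly \<Rightarrow> 'r::linordered_ab_group_add vext"
  assumes val: "is_valuation \<mu>" and p: "\<mu> p = Infty"
  shows "\<mu> (f mod p) = \<mu> f"
proof -
  have q: "\<mu> (f div p * p) = Infty" by (simp add: val_mult[OF val] p)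
  have "\<mu> (f mod p) = \<mu> (f - f div p * p)" by (simp only: minus_div_mult_eq_mod)
  then show ?thesis
    using val_add_eq'[OF val, of "- (f div p * p)" f] val_add_eq[OF val, of f "- (f div p * p)"]
      val_diff[OF val, of f "f div p * p"] val_minus[OF val, of "f div p * p"] q
    by (cases "\<mu> f") auto
qed

locale base_valuation =
  fixes v :: "'k::field \<Rightarrow> 'r::{linordered_ab_group_add,ordered_real_vector} vext"
  assumes v: "is_valuation v"
begin

abbreviation "T \<equiv> tree v UNIV"

lemma v_eq_Infty [simp]: "v a = Infty \<longleftrightarrow> a = 0"
proof
  assume "v a = Infty"
  show "a = 0"
  proof (rule ccontr)
    assume "a \<noteq> 0"
    then have "v (a * inverse a) = Fin 0" using val_1[OF v] by simp
    then show False using \<open>v a = Infty\<close> by (simp only: val_mult[OF v] vext_plus_Infty vext.distinct)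
  qed
qed (simp add: val_0[OF v])

lemma tree_T: "\<mu> \<in> tree v \<Lambda> \<Longrightarrow> \<mu> \<in> T"
  by (simp add: tree_def insert_Infty_range)

lemma T_I: "is_valuation \<mu> \<Longrightarrow> (\<And>a. \<mu> [:a:] = v a) \<Longrightarrow> \<mu> \<in> T"
  by (simp add: tree_def insert_Infty_range)

lemma T_val: "\<mu> \<in> T \<Longrightarrow> is_valuation \<mu>"
  by (simp add: tree_def)

lemma T_const: "\<mu> \<in> T \<Longrightarrow> \<mu> [:a:] = v a"
  by (simp add: tree_def)

lemma T_smult: "\<mu> \<in> T \<Longrightarrow> \<mu> (smult c f) = v c + \<mu> f"
  using val_mult[OF T_val, of \<mu> "[:c:]" f] T_const by simp

lemma monic_multiple:
  fixes f :: "'k poly"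
  assumes "f \<noteq> 0"
  obtains g where "lead_coeff g = 1" "degree g = degree f" "f = smult (lead_coeff f) g"
  using assms by (intro that[of "smult (inverse (lead_coeff f)) f"]) auto

lemma T_monic_multiple:
  assumes "f \<noteq> 0"
  obtains g where "lead_coeff g = 1" "degree g = degree f"
    "\<And>\<mu>. \<mu> \<in> T \<Longrightarrow> \<mu> f = v (lead_coeff f) + \<mu> g"
  using monic_multiple[OF assms] T_smult by metis

lemma T_less_monic:
  assumes "\<mu> \<in> T" "\<nu> \<in> T" "\<mu> f < \<nu> f"
  obtains g where "lead_coeff g = 1" "degree g = degree f" "\<mu> g < \<nu> g"
proof -
  have "f \<noteq> 0" using assms val_0[OF T_val] by (metis less_irrefl)
  then obtain g where g: "lead_coeff g = 1" "degree g = degree f"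
    "\<And>\<mu>. \<mu> \<in> T \<Longrightarrow> \<mu> f = v (lead_coeff f) + \<mu> g" by (rule T_monic_multiple) blast
  have "\<mu> g < \<nu> g"
    using assms(3) unfolding g(3)[OF assms(1)] g(3)[OF assms(2)] by (rule vext_add_less_cancel)
  with g show thesis by (intro that)
qed

text \<open>Let \<open>p\<close> span the support. Dividing \<open>p\<close>
  by \<open>f\<close> gives \<open>p = q f + r\<close>, so \<open>q f\<close> and \<open>r\<close> have the same value under both valuations;
  hence Euclid's algorithm propagates the equality of the two valuations up in the degree.\<close>

lemma nonzero_support_maximal:
  assumes \<mu>: "\<mu> \<in> T" and \<nu>: "\<nu> \<in> T" and le: "\<mu> \<le> \<nu>" and f: "f \<noteq> 0" "\<mu> f = Infty"
  shows "\<mu> = \<nu>"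
proof -
  note val = T_val[OF \<mu>] and val' = T_val[OF \<nu>]
  define p where "p = arg_min degree (\<lambda>p. p \<noteq> 0 \<and> \<mu> p = Infty)"
  have p: "p \<noteq> 0" "\<mu> p = Infty" and min: "\<And>g. g \<noteq> 0 \<Longrightarrow> \<mu> g = Infty \<Longrightarrow> degree p \<le> degree g"
    using arg_min_natI[of "\<lambda>p. p \<noteq> 0 \<and> \<mu> p = Infty" f degree] f
      arg_min_nat_le[of "\<lambda>p. p \<noteq> 0 \<and> \<mu> p = Infty" _ degree] unfolding p_def by auto
  have p': "\<nu> p = Infty" using le p(2) by (metis le_funD vext_le_simps(1))
  have eq: "\<mu> g = \<nu> g" if "degree g < degree p" for g
    using that
  proof (induction "degree g" arbitrary: g rule: less_induct)
    case less
    show ?case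
    proof (cases "degree g = 0")
      case True
      then obtain c where "g = [:c:]" by (meson degree_eq_zeroE)
      then show ?thesis by (simp add: T_const \<mu> \<nu>)
    next
      case False
      define q r where "q = p div g" and "r = p mod g"
      have pqr: "p = q * g + r" by (simp add: q_def r_def)
      have dr: "degree r < degree g" unfolding r_def using False by (simp add: degree_mod_lt)
      have r: "\<mu> r = \<nu> r" using less.hyps[OF dr] dr less.prems by simp
      have v_r: "\<mu> r = \<mu> (q * g)" "\<nu> r = \<nu> (q * g)"
      proof -
        have "r = p - q * g" using pqr by simp
        moreover have "\<mu> (p + - (q * g)) = \<mu> (q * g)" "\<nu> (p + - (q * g)) = \<nu> (q * g)"
          using val_add_eq'[OF val, of "- (q * g)" p] val_add_eq'[OF val', of "- (q * g)" p] p(2) p'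
            val_add[OF val, of p "- (q * g)"] val_add[OF val', of p "- (q * g)"]
            val_minus[OF val, of "q * g"] val_minus[OF val', of "q * g"]
          by (cases "\<mu> (q * g)"; cases "\<nu> (q * g)"; simp)+
        ultimately show "\<mu> r = \<mu> (q * g)" "\<nu> r = \<nu> (q * g)" by simp_all
      qed
      have "q \<noteq> 0" using pqr dr less.prems by auto
      have "degree q < degree p"
        using False less.prems degree_div_less[of p g] unfolding q_def by linarith
      then have "\<mu> q \<noteq> Infty" using min[OF \<open>q \<noteq> 0\<close>] by auto
      moreover have "\<mu> g \<noteq> Infty" using min[of g] less.prems False by (metis degree_0 not_le)
      moreover have "\<mu> q + \<mu> g = \<nu> q + \<nu> g"
        using v_r r by (simp add: val_mult[OF val] val_mult[OF val'])
      ultimately show ?thesis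
        using le_funD[OF le, of q] le_funD[OF le, of g] vext_add_le_less_mono(1)[of "\<mu> q" "\<nu> q" "\<mu> g" "\<nu> g"]
        by (metis less_irrefl order_le_less)
    qed
  qed
  have dp: "0 < degree p"
  proof (rule ccontr)
    assume "\<not> 0 < degree p"
    then obtain c where "p = [:c:]" by (metis degree_eq_zeroE gr0I)
    then show False using p T_const[OF \<mu>] by simp
  qed
  show ?thesis
  proof
    fix g
    have "degree (g mod p) < degree p" by (rule degree_mod_lt[OF dp])
    then show "\<mu> g = \<nu> g"
      using eq val_mod_supp[OF val p(2), of g] val_mod_supp[OF val' p', of g] by simp
  qed
qed

lemma less_finite:
  assumes "\<mu> \<in> T" "\<nu> \<in> T" "\<mu> < \<nu>" "f \<noteq> 0"
  shows "\<mu> f \<noteq> Infty"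
  using nonzero_support_maximal[OF assms(1,2) _ assms(4)] assms(3)
  by (metis order_less_imp_le order_less_irrefl)

section \<open>Tangent directions between comparable nodes\<close>

lemma tangent_exists:
  assumes "\<mu> \<in> T" "\<nu> \<in> T" "\<mu> < \<nu>"
  obtains \<theta> where "\<theta> \<in> tangent \<mu> \<nu>"
proof -
  obtain f where "\<mu> f < \<nu> f" using assms(3) by (metis leD le_funI not_le_imp_less)
  then obtain g where g: "lead_coeff g = 1 \<and> \<mu> g < \<nu> g"
    using T_less_monic assms(1,2) by metis
  then have "arg_min degree (\<lambda>g. lead_coeff g = 1 \<and> \<mu> g < \<nu> g) \<in> tangent \<mu> \<nu>"
    using arg_min_natI[of "\<lambda>g. lead_coeff g = 1 \<and> \<mu> g < \<nu> g" g degree]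
      arg_min_nat_le[of "\<lambda>g. lead_coeff g = 1 \<and> \<mu> g < \<nu> g" _ degree]
    unfolding tangent_def by auto
  then show thesis by (rule that)
qed

lemma tangentD:
  assumes "\<theta> \<in> tangent \<mu> \<nu>"
  shows "lead_coeff \<theta> = 1" "\<mu> \<theta> < \<nu> \<theta>" "\<mu> \<theta> \<noteq> Infty"
    "\<And>\<psi>. lead_coeff \<psi> = 1 \<Longrightarrow> \<mu> \<psi> < \<nu> \<psi> \<Longrightarrow> degree \<theta> \<le> degree \<psi>"
  using assms by (auto simp: tangent_def)

lemma tangentI:
  assumes "\<mu> \<in> T" "\<nu> \<in> T" "lead_coeff \<theta> = 1" "\<mu> \<theta> < \<nu> \<theta>"
    "\<And>f. degree f < degree \<theta> \<Longrightarrow> \<mu> f = \<nu> f"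
  shows "\<theta> \<in> tangent \<mu> \<nu>"
proof -
  have "degree \<theta> \<le> degree \<psi>" if "\<mu> \<psi> < \<nu> \<psi>" for \<psi>
    using assms(5)[of \<psi>] that by (cases "degree \<psi> < degree \<theta>") auto
  then show ?thesis using assms by (simp add: tangent_def)
qed

lemma tangent_low:
  assumes "\<mu> \<in> T" "\<nu> \<in> T" "\<mu> \<le> \<nu>" "\<theta> \<in> tangent \<mu> \<nu>" "degree f < degree \<theta>"
  shows "\<mu> f = \<nu> f"
proof (rule ccontr)
  assume "\<mu> f \<noteq> \<nu> f"
  then have "\<mu> f < \<nu> f" using le_funD[OF assms(3), of f] by simp
  then obtain g where "lead_coeff g = 1" "degree g = degree f" "\<mu> g < \<nu> g"
    using T_less_monic assms(1,2) by metis
  then show False using tangentD(4)[OF assms(4), of g] assms(5) by simp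
qed

lemma tangent_degree_pos:
  assumes "\<mu> \<in> T" "\<nu> \<in> T" "\<theta> \<in> tangent \<mu> \<nu>"
  shows "0 < degree \<theta>"
proof (rule ccontr)
  assume "\<not> 0 < degree \<theta>"
  then obtain c where "\<theta> = [:c:]" by (metis degree_eq_zeroE gr0I)
  then show False
    using tangentD(2)[OF assms(3)] T_const[OF assms(1), of c] T_const[OF assms(2), of c] by simp
qed

text \<open>Otherwise the remainder r satisfies \<open>\<mu> r \<le> \<mu> f\<close>, and
  \<open>\<mu> r \<le> \<mu> (q * \<theta>)\<close> follows. Under \<nu> both f and
  \<open>q * \<theta>\<close> have value greater than \<open>\<mu> r\<close>, hence so has r,
  although \<mu> and \<nu> agree below the degree of \<theta>.\<close>

lemma tangent_mod:
  assumes \<mu>: "\<mu> \<in> T" and \<nu>: "\<nu> \<in> T" and le: "\<mu> \<le> \<nu>" and \<theta>: "\<theta> \<in> tangent \<mu> \<nu>" and f: "\<mu> f < \<nu> f"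
  shows "\<mu> f < \<mu> (f mod \<theta>)"
proof (rule ccontr)
  note val = T_val[OF \<mu>] and val' = T_val[OF \<nu>]
  define q r where "q = f div \<theta>" and "r = f mod \<theta>"
  have fqr: "f = q * \<theta> + r" by (simp add: q_def r_def)
  assume "\<not> \<mu> f < \<mu> (f mod \<theta>)"
  then have le_f: "\<mu> r \<le> \<mu> f" by (simp add: r_def)
  have "degree r < degree \<theta>" unfolding r_def by (intro degree_mod_lt tangent_degree_pos[OF \<mu> \<nu> \<theta>])
  then have r: "\<mu> r = \<nu> r" by (rule tangent_low[OF \<mu> \<nu> le \<theta>])
  have "\<mu> f \<noteq> Infty" using f by auto
  have "\<mu> r \<le> \<mu> (q * \<theta>)"
    using val_le_diff[OF val, of "\<mu> r" f r] le_f fqr by simp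
  moreover have "\<mu> (q * \<theta>) < \<nu> (q * \<theta>) \<or> \<mu> (q * \<theta>) = Infty"
    using vext_add_le_less_mono(1)[OF le_funD[OF le, of q] tangentD(2)[OF \<theta>]]
    by (auto simp: val_mult[OF val] val_mult[OF val'])
  ultimately have "\<mu> r < \<nu> (q * \<theta>)"
    using le_f \<open>\<mu> f \<noteq> Infty\<close> le_funD[OF le, of "q * \<theta>"]
    by (metis order_le_less_trans vext_le_simps(1) vext_less_Infty_iff)
  moreover have "\<mu> r < \<nu> f" using le_f f by simp
  ultimately have "\<mu> r < \<nu> r" using val_less_diff[OF val', of "\<mu> r" f "q * \<theta>"] fqr by simp
  then show False using r by simp
qed

lemma less_if_hdiv:
  assumes \<mu>: "\<mu> \<in> T" and \<nu>: "\<nu> \<in> T" and le: "\<mu> \<le> \<nu>" and \<theta>: "\<mu> \<theta> < \<nu> \<theta>"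
    and f: "\<mu> f < \<mu> (f - h * \<theta>)"
  shows "\<mu> f < \<nu> f"
proof -
  note val = T_val[OF \<mu>] and val' = T_val[OF \<nu>]
  have eq: "\<mu> (h * \<theta>) = \<mu> f" by (rule val_eq_of_diff[OF val f])
  moreover have "\<mu> f \<noteq> Infty" using f by auto
  ultimately have "\<mu> h + \<mu> \<theta> < \<nu> h + \<nu> \<theta>"
    using vext_add_le_less_mono(1)[OF le_funD[OF le, of h] \<theta>]
    by (metis val_mult[OF val] vext_plus_eq_Infty)
  then have "\<mu> f < \<nu> (h * \<theta>)" using eq by (simp add: val_mult[OF val] val_mult[OF val'])
  moreover have "\<mu> f < \<nu> (f - h * \<theta>)" using f le_funD[OF le] by (metis order_less_le_trans)
  ultimately show ?thesis using val_less_add[OF val', of "\<mu> f" "f - h * \<theta>" "h * \<theta>"] by simp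
qed

text \<open>The initial forms killed on the way from \<mu> to \<nu> are the multiples of that of
  \<theta>: \<open>tangent_mod\<close> gives one inclusion, \<open>less_if_hdiv\<close> the other.
  The zero polynomial satisfies \<open>hdiv\<close> without gaining value.\<close>

lemma less_iff_hdiv:
  assumes \<mu>: "\<mu> \<in> T" and \<nu>: "\<nu> \<in> T" and le: "\<mu> \<le> \<nu>" and \<theta>: "\<theta> \<in> tangent \<mu> \<nu>"
  shows "\<mu> f < \<nu> f \<longleftrightarrow> f \<noteq> 0 \<and> hdiv \<mu> \<theta> f"
proof
  assume f: "\<mu> f < \<nu> f"
  then have "\<mu> f < \<mu> (f - f div \<theta> * \<theta>)"
    using tangent_mod[OF assms] by (simp add: minus_div_mult_eq_mod)
  moreover have "f \<noteq> 0" using f val_0[OF T_val] \<mu> \<nu> by (metis less_irrefl)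
  ultimately show "f \<noteq> 0 \<and> hdiv \<mu> \<theta> f" unfolding hdiv_def by blast
next
  assume f: "f \<noteq> 0 \<and> hdiv \<mu> \<theta> f"
  have "\<mu> < \<nu>" using le tangentD(2)[OF \<theta>] by (auto simp: order_le_less)
  then have "\<mu> f \<noteq> Infty" using less_finite \<mu> \<nu> f by blast
  then show "\<mu> f < \<nu> f"
    using f less_if_hdiv[OF \<mu> \<nu> le tangentD(2)[OF \<theta>]] unfolding hdiv_def by blast
qed

text \<open>If the value of \<open>f * g\<close> grows from \<mu> to \<nu>, that of a factor does,
  since both valuations are additive on products; by \<open>less_iff_hdiv\<close> this is primality.
  Minimality is the agreement of \<mu> and \<nu> below the degree of \<theta>.\<close>

lemma tangent_KP:
  assumes \<mu>: "\<mu> \<in> T" and \<nu>: "\<nu> \<in> T" and le: "\<mu> \<le> \<nu>" and \<theta>: "\<theta> \<in> tangent \<mu> \<nu>"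
  shows "\<theta> \<in> KP \<mu>"
proof (rule KP_I)
  note iff = less_iff_hdiv[OF assms]
  show "is_valuation \<mu>" by (rule T_val[OF \<mu>])
  show "lead_coeff \<theta> = 1" "\<mu> \<theta> \<noteq> Infty" using tangentD[OF \<theta>] by auto
  show "\<not> hdiv \<mu> \<theta> 1"
    using iff[of 1] val_1[OF T_val[OF \<mu>]] val_1[OF T_val[OF \<nu>]] by simp
  show "\<not> hdiv \<mu> \<theta> f" if "f \<noteq> 0" "degree f < degree \<theta>" for f
    using iff[of f] tangent_low[OF assms that(2)] that by simp
  show "hdiv \<mu> \<theta> f \<or> hdiv \<mu> \<theta> g" if fg: "hdiv \<mu> \<theta> (f * g)" for f g
  proof (cases "f * g = 0")
    case True
    then show ?thesis by (auto simp: hdiv_def val_0[OF T_val[OF \<mu>]])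
  next
    case False
    then have "\<mu> (f * g) < \<nu> (f * g)" using iff fg by simp
    then have "\<mu> f \<noteq> \<nu> f \<or> \<mu> g \<noteq> \<nu> g" by (auto simp: val_mult[OF T_val] \<mu> \<nu>)
    then have "\<mu> f < \<nu> f \<or> \<mu> g < \<nu> g" using le_funD[OF le, of f] le_funD[OF le, of g] by auto
    then show ?thesis using iff by auto
  qed
qed

lemma monic_diff_degree_less:
  fixes f g :: "'k poly"
  assumes "lead_coeff f = 1" "lead_coeff g = 1" "degree f = degree g" "0 < degree f"
  shows "degree (f - g) < degree f"
  using assms by (intro degree_lessI) (auto simp: coeff_eq_0 le_less)

text \<open>Two directions have a difference of lower degree, whose value does not grow; but under
  \<nu> it exceeds the smaller of their \<mu>-values, so they are equivalent. Conversely a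
  polynomial equivalent to \<theta> grows with it, and being minimal it cannot have larger
  degree.\<close>

lemma tangent_eq_tdir:
  assumes \<mu>: "\<mu> \<in> T" and \<nu>: "\<nu> \<in> T" and le: "\<mu> \<le> \<nu>" and \<theta>: "\<theta> \<in> tangent \<mu> \<nu>"
  shows "tangent \<mu> \<nu> = tdir \<mu> \<theta>"
proof (intro equalityI subsetI)
  note val = T_val[OF \<mu>] and val' = T_val[OF \<nu>]
  fix \<psi>
  {
    assume \<psi>: "\<psi> \<in> tangent \<mu> \<nu>"
    have deg: "degree \<psi> = degree \<theta>"
      using tangentD(4)[OF \<theta> tangentD(1,2)[OF \<psi>]] tangentD(4)[OF \<psi> tangentD(1,2)[OF \<theta>]] by simp
    have "degree (\<theta> - \<psi>) < degree \<theta>"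
      using monic_diff_degree_less tangentD(1)[OF \<psi>] tangentD(1)[OF \<theta>] deg tangent_degree_pos[OF \<mu> \<nu> \<theta>] by metis
    then have eq: "\<mu> (\<theta> - \<psi>) = \<nu> (\<theta> - \<psi>)" by (rule tangent_low[OF assms])
    have "\<mu> \<theta> < \<mu> (\<theta> - \<psi>) \<or> \<mu> \<psi> < \<mu> (\<psi> - \<theta>)"
      using val_less_diff[OF val', of _ \<theta> \<psi>] tangentD(2)[OF \<theta>] tangentD(2)[OF \<psi>] eq
        val_diff_commute[OF val, of \<theta> \<psi>]
      by (metis linorder_le_cases order_le_less_trans)
    then have "\<mu> \<theta> < \<mu> (\<theta> - \<psi>)"
      using val_eq_of_diff[OF val, of \<psi> \<theta>] val_diff_commute[OF val, of \<theta> \<psi>] by auto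
    then show "\<psi> \<in> tdir \<mu> \<theta>"
      using tangent_KP[OF \<mu> \<nu> le \<psi>] by (simp add: tdir_def mu_equiv_iff[OF val])
  next
    assume "\<psi> \<in> tdir \<mu> \<theta>"
    then have \<psi>: "\<psi> \<in> KP \<mu>" and "mu_equiv \<mu> \<theta> \<psi>" by (auto simp: tdir_def)
    then have d: "\<mu> \<theta> < \<mu> (\<theta> - \<psi>)" using tangentD(3)[OF \<theta>] by (simp add: mu_equiv_iff[OF val])
    then have d': "\<mu> \<psi> < \<mu> (\<psi> - \<theta>)"
      using val_eq_of_diff[OF val d] val_diff_commute[OF val, of \<theta> \<psi>] by simp
    have less: "\<mu> \<psi> < \<nu> \<psi>"
      using less_if_hdiv[OF \<mu> \<nu> le tangentD(2)[OF \<theta>], of \<psi> 1] d' by simp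
    have "hdiv \<mu> \<psi> \<theta>" unfolding hdiv_def using d by (auto intro!: exI[of _ 1])
    moreover have "\<theta> \<noteq> 0" using tangent_degree_pos[OF \<mu> \<nu> \<theta>] by auto
    ultimately have "degree \<psi> \<le> degree \<theta>" using KP_D(4)[OF val \<psi>, of \<theta>] by (meson not_less)
    then show "\<psi> \<in> tangent \<mu> \<nu>"
      using less tangentD(4)[OF \<theta>] KP_D(1)[OF val \<psi>] unfolding tangent_def by (auto intro: order_trans)
  }
qed

text \<open>Otherwise divide \<theta> by \<psi>: quotient, divisor and remainder have degree below
  that of \<theta>, so \<mu> and \<nu> agree on them. As \<psi> is a key polynomial of \<nu>,
  \<open>\<nu> \<theta>\<close> is the minimum of the values of the two terms, which is at most
  \<open>\<mu> \<theta>\<close>.\<close>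

lemma KP_degree_ge_tangent:
  assumes \<mu>: "\<mu> \<in> T" and \<nu>: "\<nu> \<in> T" and le: "\<mu> \<le> \<nu>" and \<theta>: "\<theta> \<in> tangent \<mu> \<nu>" and \<psi>: "\<psi> \<in> KP \<nu>"
  shows "degree \<theta> \<le> degree \<psi>"
proof (rule ccontr)
  note val = T_val[OF \<mu>] and val' = T_val[OF \<nu>]
  assume less: "\<not> degree \<theta> \<le> degree \<psi>"
  define q r where "q = \<theta> div \<psi>" and "r = \<theta> mod \<psi>"
  have eq: "\<theta> = q * \<psi> + r" by (simp add: q_def r_def)
  have pos: "0 < degree \<psi>" by (rule KP_degree_pos[OF val' \<psi>])
  then have r: "degree r < degree \<psi>" by (simp add: r_def degree_mod_lt)
  have q: "degree q < degree \<theta>"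
    unfolding q_def using degree_div_less[of \<theta> \<psi>] pos less by linarith
  have low: "\<mu> f = \<nu> f" if "degree f < degree \<theta>" for f by (rule tangent_low[OF \<mu> \<nu> le \<theta> that])
  have "\<nu> \<theta> = min (\<nu> r) (\<nu> q + \<nu> \<psi>)" unfolding eq by (rule KP_expansion[OF val' \<psi> r])
  also have "\<dots> = min (\<mu> r) (\<mu> (q * \<psi>))"
    using low[OF q] low[of \<psi>] low[of r] less r by (simp add: val_mult[OF val])
  also have "\<dots> \<le> \<mu> \<theta>" using val_add[OF val, of r "q * \<psi>"] eq by (simp add: add.commute)
  finally show False using tangentD(2)[OF \<theta>] by simp
qed

text \<open>The direction \<phi> to F already grows at \<nu>. If it did not, write \<theta>, a
  direction to \<nu>, as \<open>h * \<phi>\<close> plus remainder: h has lower degree than \<theta>,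
  so \<open>h * \<phi>\<close> keeps the value \<open>\<mu> \<theta>\<close>, while the remainder
  has greater value; hence \<theta> could not grow. So \<phi> is a direction to \<nu> as well, and
  both sides mean divisibility by \<phi>.\<close>

lemma less_between_iff:
  assumes \<mu>: "\<mu> \<in> T" and \<nu>: "\<nu> \<in> T" and F: "F \<in> T" and less: "\<mu> < \<nu>" and le: "\<nu> \<le> F"
  shows "\<mu> f < \<nu> f \<longleftrightarrow> \<mu> f < F f"
proof -
  have leF: "\<mu> \<le> F" "\<mu> \<le> \<nu>" using less le by auto
  obtain \<theta> where \<theta>: "\<theta> \<in> tangent \<mu> \<nu>" using tangent_exists[OF \<mu> \<nu> less] .
  have "\<mu> < F" using less le by simp
  then obtain \<phi> where \<phi>: "\<phi> \<in> tangent \<mu> F" using tangent_exists[OF \<mu> F] by blast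
  have val: "is_valuation \<mu>" and val': "is_valuation \<nu>" using T_val \<mu> \<nu> by auto
  have \<phi>\<nu>: "\<mu> \<phi> < \<nu> \<phi>"
  proof (rule ccontr)
    assume "\<not> \<mu> \<phi> < \<nu> \<phi>"
    then have eq: "\<mu> \<phi> = \<nu> \<phi>" using le_funD[OF leF(2), of \<phi>] by simp
    have "\<mu> \<theta> < F \<theta>" using tangentD(2)[OF \<theta>] le_funD[OF le, of \<theta>] by simp
    then have m: "\<mu> \<theta> < \<mu> (\<theta> mod \<phi>)" by (rule tangent_mod[OF \<mu> F leF(1) \<phi>])
    define h where "h = \<theta> div \<phi>"
    have d: "\<theta> - h * \<phi> = \<theta> mod \<phi>" by (simp add: h_def minus_div_mult_eq_mod)
    have hv: "\<mu> (h * \<phi>) = \<mu> \<theta>" using val_eq_of_diff[OF val, of \<theta> "h * \<phi>"] m d by simp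
    have "degree h < degree \<theta>"
      unfolding h_def using tangent_degree_pos[OF \<mu> F \<phi>] tangent_degree_pos[OF \<mu> \<nu> \<theta>] degree_div_less
      by (metis degree_0 less_irrefl)
    then have "\<mu> h = \<nu> h" by (rule tangent_low[OF \<mu> \<nu> leF(2) \<theta>])
    then have "\<nu> (h * \<phi>) = \<mu> \<theta>" using eq hv by (simp add: val_mult[OF val] val_mult[OF val'])
    moreover have "\<mu> \<theta> < \<nu> (\<theta> - h * \<phi>)" using m d le_funD[OF leF(2), of "\<theta> mod \<phi>"] by simp
    ultimately show False
      using val_less_diff[OF val', of "\<mu> \<theta>" \<theta> "\<theta> - h * \<phi>"] tangentD(2)[OF \<theta>] by simp
  qed
  have "\<phi> \<in> tangent \<mu> \<nu>"
    using \<phi>\<nu> tangentD(1,4)[OF \<phi>] le_funD[OF le] unfolding tangent_def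
    by (auto intro: order_less_le_trans)
  then show ?thesis using less_iff_hdiv[OF \<mu> \<nu> leF(2)] less_iff_hdiv[OF \<mu> F leF(1) \<phi>] by simp
qed

lemma tangent_between:
  assumes "\<mu> \<in> T" "\<nu> \<in> T" "F \<in> T" "\<mu> < \<nu>" "\<nu> \<le> F"
  shows "tangent \<mu> \<nu> = tangent \<mu> F"
  using less_between_iff[OF assms] by (simp add: tangent_def)

section \<open>The nodes below a given node are totally ordered\<close>

lemma le_if_expansion_le:
  fixes E \<nu> :: "'k poly \<Rightarrow> 'r vext"
  assumes pos: "0 < degree \<phi>" and val: "is_valuation \<nu>"
    and E: "\<And>q r. degree r < degree \<phi> \<Longrightarrow> E (q * \<phi> + r) = min (E r) (E q + \<gamma>)"
    and low: "\<And>r. degree r < degree \<phi> \<Longrightarrow> E r \<le> \<nu> r" and \<gamma>: "\<gamma> \<le> \<nu> \<phi>"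
  shows "E \<le> \<nu>"
proof (rule le_funI)
  fix f :: "'k poly"
  show "E f \<le> \<nu> f" using pos
  proof (induction f rule: poly_expansion_induct)
    case zero
    then show ?case by (simp add: val_0[OF val])
  next
    case (step q r)
    have "E (q * \<phi> + r) \<le> min (\<nu> r) (\<nu> (q * \<phi>))"
      unfolding E[OF step(1)] val_mult[OF val] using low[OF step(1)] add_mono[OF step(2) \<gamma>]
      by (meson min.mono)
    also have "\<dots> \<le> \<nu> (q * \<phi> + r)" using val_add[OF val, of r "q * \<phi>"] by (simp add: add.commute)
    finally show ?case .
  qed
qed

text \<open>Let the direction \<phi> from \<mu> have the smaller degree. Below that degree both
  nodes agree with F, so only their values at \<phi> matter. If \<nu> has the smaller value there,
  then \<phi> still grows from \<nu> to F and is a direction from \<nu> too, which makes the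
  situation symmetric.\<close>

lemma below_comparable:
  assumes \<mu>: "\<mu> \<in> T" and \<nu>: "\<nu> \<in> T" and F: "F \<in> T" and less: "\<mu> < F" "\<nu> < F"
  shows "\<mu> \<le> \<nu> \<or> \<nu> \<le> \<mu>"
proof -
  have main: "\<mu> \<le> \<nu>"
    if \<mu>: "\<mu> \<in> T" and \<nu>: "\<nu> \<in> T" and \<mu>F: "\<mu> < F" and \<nu>F: "\<nu> < F"
      and \<phi>: "\<phi> \<in> tangent \<mu> F" and \<psi>: "\<psi> \<in> tangent \<nu> F" and deg: "degree \<phi> \<le> degree \<psi>"
      and \<phi>\<nu>: "\<mu> \<phi> \<le> \<nu> \<phi>" for \<mu> \<nu> \<phi> \<psi>
  proof (rule le_if_expansion_le)
    have le: "\<mu> \<le> F" "\<nu> \<le> F" using \<mu>F \<nu>F by auto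
    show "0 < degree \<phi>" by (rule tangent_degree_pos[OF \<mu> F \<phi>])
    show "is_valuation \<nu>" by (rule T_val[OF \<nu>])
    show "\<mu> (q * \<phi> + r) = min (\<mu> r) (\<mu> q + \<mu> \<phi>)" if "degree r < degree \<phi>" for q r
      by (rule KP_expansion[OF T_val[OF \<mu>] tangent_KP[OF \<mu> F le(1) \<phi>] that])
    show "\<mu> r \<le> \<nu> r" if "degree r < degree \<phi>" for r
      using tangent_low[OF \<mu> F le(1) \<phi> that] tangent_low[OF \<nu> F le(2) \<psi>, of r] that deg by simp
    show "\<mu> \<phi> \<le> \<nu> \<phi>" by (rule \<phi>\<nu>)
  qed
  have wlog: "\<mu> \<le> \<nu> \<or> \<nu> \<le> \<mu>"
    if \<mu>: "\<mu> \<in> T" and \<nu>: "\<nu> \<in> T" and \<mu>F: "\<mu> < F" and \<nu>F: "\<nu> < F"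
      and \<phi>: "\<phi> \<in> tangent \<mu> F" and \<psi>: "\<psi> \<in> tangent \<nu> F" and deg: "degree \<phi> \<le> degree \<psi>" for \<mu> \<nu> \<phi> \<psi>
  proof (cases "\<mu> \<phi> \<le> \<nu> \<phi>")
    case True
    then show ?thesis using main[OF that] by simp
  next
    case False
    then have "\<nu> \<phi> < F \<phi>" using tangentD(2)[OF \<phi>] by simp
    then have "\<phi> \<in> tangent \<nu> F"
      using deg tangentD(1)[OF \<phi>] tangentD(4)[OF \<psi>] unfolding tangent_def
      by (auto intro: order_trans)
    then show ?thesis using main[OF \<nu> \<mu> \<nu>F \<mu>F _ \<phi>] False by simp
  qed
  obtain \<phi> \<psi> where "\<phi> \<in> tangent \<mu> F" "\<psi> \<in> tangent \<nu> F"
    using tangent_exists[OF \<mu> F] tangent_exists[OF \<nu> F] less by metis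
  then show ?thesis using wlog[OF \<mu> \<nu> less] wlog[OF \<nu> \<mu> less(2,1)] by (meson nle_le)
qed

end

section \<open>Valuations defined by expansions\<close>

text \<open>A product of two remainders has degree below \<open>2 * degree \<phi>\<close>, so the
  carry is a single digit.\<close>

lemma degree_mult_div_less:
  fixes a b \<phi> :: "'k::field poly"
  assumes a: "degree a < degree \<phi>" and b: "degree b < degree \<phi>"
  shows "degree (a * b div \<phi>) < degree \<phi>"
proof (cases "a * b div \<phi> = 0")
  case True
  then show ?thesis using a by simp
next
  case False
  have "\<phi> \<noteq> 0" using a by auto
  then have "degree (a * b div \<phi>) + degree \<phi> = degree (a * b div \<phi> * \<phi>)"
    using False by (simp add: degree_mult_eq)
  also have "a * b div \<phi> * \<phi> = a * b - a * b mod \<phi>" by (simp add: minus_mod_eq_div_mult)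
  also have "degree (a * b - a * b mod \<phi>) \<le> max (degree a + degree b) (degree \<phi>)"
    using degree_diff_le_max[of "a * b" "a * b mod \<phi>"] degree_mult_le[of a b] degree_mod_lt[of \<phi> "a * b"] a
    by linarith
  finally show ?thesis using a b by (auto simp: le_max_iff_disj)
qed

lemma exp_coeff_0:
  "degree r < degree \<phi> \<Longrightarrow> exp_coeff \<phi> (q * \<phi> + r) 0 = r"
  by (simp add: exp_coeff_def mod_poly_less)

lemma exp_coeff_Suc:
  assumes "degree r < degree \<phi>"
  shows "exp_coeff \<phi> (q * \<phi> + r) (Suc s) = exp_coeff \<phi> q s"
proof -
  have "\<phi> \<noteq> 0" using assms by auto
  then have "(q * \<phi> + r) div \<phi> = q"
    using assms by (simp add: div_poly_less)
  then show ?thesis by (simp add: exp_coeff_def poly_div_mult_right)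
qed

lemma exp_coeff_eq_0:
  fixes \<phi> :: "'k::field poly"
  assumes "0 < degree \<phi>" "degree f < s"
  shows "exp_coeff \<phi> f s = 0"
proof -
  have "\<phi> \<noteq> 0" using assms by auto
  then have "degree (\<phi> ^ s) = s * degree \<phi>" by (rule degree_power_eq)
  moreover have "s \<le> s * degree \<phi>" using assms by simp
  ultimately have "degree f < degree (\<phi> ^ s)" using assms by linarith
  then show ?thesis by (simp add: exp_coeff_def div_poly_less)
qed

context
  fixes w :: "'k::field poly \<Rightarrow> 'r::linordered_ab_group_add vext" and \<phi> :: "'k poly" and \<gamma> :: "'r vext"
  assumes w0: "w 0 = Infty" and pos: "0 < degree \<phi>"
begin

text \<open>Digits beyond \<open>degree f\<close> vanish and have value Infty, so the index may
  range over all s. This removes the dependence on the degree before the recursion is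
  derived.\<close>

lemma le_expansion_min_iff:
  "x \<le> expansion_min w \<phi> \<gamma> f \<longleftrightarrow> (\<forall>s. x \<le> w (exp_coeff \<phi> f s) + (\<Sum>_<s. \<gamma>))"
proof -
  have "x \<le> expansion_min w \<phi> \<gamma> f \<longleftrightarrow> (\<forall>s\<le>degree f. x \<le> w (exp_coeff \<phi> f s) + (\<Sum>_<s. \<gamma>))"
    unfolding expansion_min_def by (subst Min_ge_iff) auto
  moreover have "x \<le> w (exp_coeff \<phi> f s) + (\<Sum>_<s. \<gamma>)" if "\<not> s \<le> degree f" for s
    using that exp_coeff_eq_0[OF pos, of f s] by (simp add: w0)
  ultimately show ?thesis by blast
qed

lemma expansion_min_attained:
  "\<exists>s. expansion_min w \<phi> \<gamma> f = w (exp_coeff \<phi> f s) + (\<Sum>_<s. \<gamma>)"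
proof -
  have "expansion_min w \<phi> \<gamma> f \<in> (\<lambda>s. w (exp_coeff \<phi> f s) + (\<Sum>_<s. \<gamma>)) ` {..degree f}"
    unfolding expansion_min_def by (rule Min_in) auto
  then show ?thesis by auto
qed

lemma le_expansion_min_add_iff:
  "x \<le> expansion_min w \<phi> \<gamma> f + \<gamma> \<longleftrightarrow> (\<forall>s. x \<le> w (exp_coeff \<phi> f s) + (\<Sum>_<Suc s. \<gamma>))"
proof
  assume x: "x \<le> expansion_min w \<phi> \<gamma> f + \<gamma>"
  have "expansion_min w \<phi> \<gamma> f \<le> w (exp_coeff \<phi> f s) + (\<Sum>_<s. \<gamma>)" for s
    using le_expansion_min_iff by blast
  then show "\<forall>s. x \<le> w (exp_coeff \<phi> f s) + (\<Sum>_<Suc s. \<gamma>)"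
    using x by (auto simp: add.assoc[symmetric] intro: order_trans add_right_mono)
next
  assume "\<forall>s. x \<le> w (exp_coeff \<phi> f s) + (\<Sum>_<Suc s. \<gamma>)"
  then show "x \<le> expansion_min w \<phi> \<gamma> f + \<gamma>"
    using expansion_min_attained[of f] by (auto simp: add.assoc)
qed

lemma expansion_min_rec:
  assumes r: "degree r < degree \<phi>"
  shows "expansion_min w \<phi> \<gamma> (q * \<phi> + r) = min (w r) (expansion_min w \<phi> \<gamma> q + \<gamma>)"
proof -
  have "x \<le> expansion_min w \<phi> \<gamma> (q * \<phi> + r) \<longleftrightarrow> x \<le> min (w r) (expansion_min w \<phi> \<gamma> q + \<gamma>)" for x
  proof -
    have "x \<le> expansion_min w \<phi> \<gamma> (q * \<phi> + r) \<longleftrightarrow>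
        x \<le> w r \<and> (\<forall>s. x \<le> w (exp_coeff \<phi> q s) + (\<Sum>_<Suc s. \<gamma>))"
      unfolding le_expansion_min_iff
      using exp_coeff_0[OF r, of q] exp_coeff_Suc[OF r, of q] add_0_right[of "w r"]
      by (metis lessThan_0 not0_implies_Suc sum.empty)
    then show ?thesis by (simp add: le_expansion_min_add_iff)
  qed
  then show ?thesis by (metis order_antisym order_refl)
qed

lemma expansion_min_0: "expansion_min w \<phi> \<gamma> 0 = Infty"
proof -
  have "\<forall>s. Infty \<le> w (exp_coeff \<phi> 0 s) + (\<Sum>_<s. \<gamma>)"
    by (simp add: exp_coeff_def w0)
  then have "Infty \<le> expansion_min w \<phi> \<gamma> 0" by (simp only: le_expansion_min_iff) simp
  then show ?thesis by simp
qed

lemma expansion_min_low: "degree r < degree \<phi> \<Longrightarrow> expansion_min w \<phi> \<gamma> r = w r"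
  using expansion_min_rec[of r 0] by (simp add: expansion_min_0 min_def)

end

text \<open>Conditions on digits alone under which a minimum over \<phi>-expansions is a valuation:
  reduction modulo \<phi> preserves the value of a product of digits, and the carry, weighted with
  \<gamma>, is not below that value. The case \<gamma> = Infty is included and yields valuations
  with \<phi> in the support.\<close>

locale expansion_valuation =
  fixes \<phi> :: "'k::field poly" and E :: "'k poly \<Rightarrow> 'r::linordered_ab_group_add vext" and \<gamma> :: "'r vext"
  assumes pos: "0 < degree \<phi>" and E_0: "E 0 = Infty" and E_1: "E 1 = Fin 0"
    and rec: "\<And>q r. degree r < degree \<phi> \<Longrightarrow> E (q * \<phi> + r) = min (E r) (E q + \<gamma>)"
    and low_add: "\<And>a b. degree a < degree \<phi> \<Longrightarrow> degree b < degree \<phi> \<Longrightarrow> min (E a) (E b) \<le> E (a + b)"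
    and low_mult: "\<And>a b. degree a < degree \<phi> \<Longrightarrow> degree b < degree \<phi> \<Longrightarrow>
      E (a * b mod \<phi>) = E a + E b"
    and low_carry: "\<And>a b. degree a < degree \<phi> \<Longrightarrow> degree b < degree \<phi> \<Longrightarrow>
      E a + E b \<le> E (a * b div \<phi>) + \<gamma>"
begin

lemmas expansion_induct = poly_expansion_induct[OF pos, case_names zero step]

lemma E_phi_mult: "E (q * \<phi>) = E q + \<gamma>"
  using rec[of 0 q] pos E_0 by (simp add: min_def)

lemma E_power_mult: "E (\<phi> ^ k * u) = E u + (\<Sum>_<k. \<gamma>)"
proof (induction k)
  case (Suc k)
  have "E (\<phi> ^ Suc k * u) = E ((\<phi> ^ k * u) * \<phi>)" by (simp add: mult_ac)
  then show ?case by (simp only: E_phi_mult Suc sum.lessThan_Suc add.assoc)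
qed simp

lemma E_add: "min (E f) (E g) \<le> E (f + g)"
proof (induction f arbitrary: g rule: expansion_induct)
  case zero
  then show ?case by (simp add: E_0)
next
  case (step q r)
  define q' r' where "q' = g div \<phi>" and "r' = g mod \<phi>"
  have g: "g = q' * \<phi> + r'" by (simp add: q'_def r'_def)
  have r': "degree r' < degree \<phi>" unfolding r'_def by (rule degree_mod_lt[OF pos])
  have sum: "q * \<phi> + r + g = (q + q') * \<phi> + (r + r')" unfolding g by (simp add: algebra_simps)
  have "E (q * \<phi> + r + g) = min (E (r + r')) (E (q + q') + \<gamma>)"
    unfolding sum by (rule rec[OF degree_add_less[OF step(1) r']])
  moreover have "E (q * \<phi> + r) = min (E r) (E q + \<gamma>)" "E g = min (E r') (E q' + \<gamma>)"
    unfolding g by (rule rec[OF step(1)] rec[OF r'])+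
  moreover have "min (E r) (E r') \<le> E (r + r')" by (rule low_add[OF step(1) r'])
  moreover have "min (E q + \<gamma>) (E q' + \<gamma>) \<le> E (q + q') + \<gamma>"
    unfolding vext_min_add[symmetric] by (rule add_right_mono[OF step(2)])
  ultimately show ?case by (auto simp: min_le_iff_disj)
qed

lemma E_le_add: "c \<le> E f \<Longrightarrow> c \<le> E g \<Longrightarrow> c \<le> E (f + g)"
  using E_add[of f g] by (meson min.boundedI order_trans)

lemma E_less_add: "c < E f \<Longrightarrow> c < E g \<Longrightarrow> c < E (f + g)"
  using E_add[of f g] by (meson min_less_iff_conj order_less_le_trans)

lemma E_low_mult_ge:
  assumes a: "degree a < degree \<phi>"
  shows "E a + E f \<le> E (a * f)"
proof (induction f rule: expansion_induct)
  case zero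
  then show ?case by (simp add: E_0)
next
  case (step q r)
  have eq: "a * (q * \<phi> + r) = (a * q) * \<phi> + a * r" by (simp add: algebra_simps)
  have 1: "E a + (E q + \<gamma>) \<le> E ((a * q) * \<phi>)"
    unfolding E_phi_mult add.assoc[symmetric] by (rule add_right_mono[OF step(2)])
  have "E (a * r) = min (E (a * r mod \<phi>)) (E (a * r div \<phi>) + \<gamma>)"
    using rec[OF degree_mod_lt[OF pos], of "a * r div \<phi>" "a * r"] by simp
  then have 2: "E a + E r \<le> E (a * r)"
    using low_mult[OF a step(1)] low_carry[OF a step(1)] by simp
  have 3: "E a + E (q * \<phi> + r) \<le> E a + E r" "E a + E (q * \<phi> + r) \<le> E a + (E q + \<gamma>)"
    unfolding rec[OF step(1)] by (intro add_left_mono; simp)+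
  show ?case unfolding eq by (intro E_le_add order_trans[OF 3(1) 2] order_trans[OF 3(2) 1])
qed

lemma E_mult_ge: "E f + E g \<le> E (f * g)"
proof (induction f rule: expansion_induct)
  case zero
  then show ?case by (simp add: E_0)
next
  case (step q r)
  have eq: "(q * \<phi> + r) * g = (q * g) * \<phi> + r * g" by (simp add: algebra_simps)
  have 1: "(E q + \<gamma>) + E g \<le> E ((q * g) * \<phi>)"
    unfolding E_phi_mult using add_right_mono[OF step(2), of \<gamma>] by (simp add: ac_simps)
  have 2: "E r + E g \<le> E (r * g)" by (rule E_low_mult_ge[OF step(1)])
  have 3: "E (q * \<phi> + r) + E g \<le> E r + E g" "E (q * \<phi> + r) + E g \<le> (E q + \<gamma>) + E g"
    unfolding rec[OF step(1)] by (intro add_right_mono; simp)+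
  show ?case unfolding eq by (intro E_le_add order_trans[OF 3(1) 2] order_trans[OF 3(2) 1])
qed

lemma E_minus: "E (- f) = E f"
proof -
  have "E (-1) + E (-1) = E ((-1) * (-1) mod \<phi>)" using pos by (intro low_mult[symmetric]) auto
  also have "\<dots> = Fin 0" using pos E_1 by (simp add: mod_poly_less)
  finally have "E (-1) = Fin 0" by (cases "E (-1)") auto
  then have "E f \<le> E (- f)" for f using E_mult_ge[of "-1" f] by (cases "E f") auto
  from this[of f] this[of "- f"] show ?thesis by simp
qed

text \<open>The witness \<open>s\<close> is the smallest index at which the minimum defining \<open>E f\<close> is attained.\<close>

lemma E_initial_term:
  assumes "E f \<noteq> Infty"
  shows "\<exists>s a f' f1. degree a < degree \<phi> \<and> E f = E a + (\<Sum>_<s. \<gamma>) \<and>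
    f = \<phi> ^ s * (a + \<phi> * f') + f1 \<and> E f < E f1"
  using assms
proof (induction f rule: expansion_induct)
  case zero
  then show ?case by (simp add: E_0)
next
  case (step q r)
  show ?case
  proof (cases "E r \<le> E q + \<gamma>")
    case True
    then have "E (q * \<phi> + r) = E r" using rec[OF step(1)] by simp
    then show ?thesis using step(1,3) E_0
      by (intro exI[of _ 0] exI[of _ r] exI[of _ q]) (auto simp: vext_less_Infty_iff mult.commute)
  next
    case False
    then have eq: "E (q * \<phi> + r) = E q + \<gamma>" using rec[OF step(1)] by simp
    then have fin: "E q \<noteq> Infty" "\<gamma> \<noteq> Infty" using step(3) by auto
    then obtain s a f' f1 where *: "degree a < degree \<phi>" "E q = E a + (\<Sum>_<s. \<gamma>)"
      "q = \<phi> ^ s * (a + \<phi> * f') + f1" "E q < E f1" using step(2) by blast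
    have "q * \<phi> + r = \<phi> ^ Suc s * (a + \<phi> * f') + (f1 * \<phi> + r)"
      by (subst *(3)) (simp add: algebra_simps)
    moreover have "E (q * \<phi> + r) < E (f1 * \<phi> + r)"
      unfolding eq rec[OF step(1), of f1] using False fin vext_add_less_mono(2)[OF *(4)] by simp
    moreover have "E (q * \<phi> + r) = E a + (\<Sum>_<Suc s. \<gamma>)" using eq *(2) by (simp add: add.assoc)
    ultimately show ?thesis using *(1) by blast
  qed
qed

text \<open>Only \<open>E (f * g) \<le> E f + E g\<close> is left. Up to summands of greater value,
  f and g are their initial parts F and G, and the lowest digit of \<open>F * G\<close> is the
  reduced product of the lowest digits of F and G, whose value is known exactly.\<close>

lemma valuation: "is_valuation E"
  unfolding is_valuation_def
proof (intro conjI allI)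
  fix f g
  show "E (f * g) = E f + E g"
  proof (rule antisym[OF _ E_mult_ge], rule ccontr)
    assume "\<not> E (f * g) \<le> E f + E g"
    then have less: "E f + E g < E (f * g)" by simp
    then have fin: "E f \<noteq> Infty" "E g \<noteq> Infty" by auto
    obtain s a f' f1 where f: "degree a < degree \<phi>" "E f = E a + (\<Sum>_<s. \<gamma>)"
      "f = \<phi> ^ s * (a + \<phi> * f') + f1" "E f < E f1" using E_initial_term[OF fin(1)] by blast
    obtain t b g' g1 where g: "degree b < degree \<phi>" "E g = E b + (\<Sum>_<t. \<gamma>)"
      "g = \<phi> ^ t * (b + \<phi> * g') + g1" "E g < E g1" using E_initial_term[OF fin(2)] by blast
    define F where "F = \<phi> ^ s * (a + \<phi> * f')"
    define G where "G = \<phi> ^ t * (b + \<phi> * g')"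
    have EF: "E f \<le> E F"
      using E_le_add[of "E f" f "- f1"] f(3,4) E_minus[of f1] by (simp add: F_def)
    have FG: "F * G = f * g + - (f1 * g) + - (F * g1)"
      using f(3) g(3) unfolding F_def[symmetric] G_def[symmetric] by (simp add: algebra_simps)
    have "E f + E g < E (f1 * g)"
      using vext_add_less_mono(2)[OF f(4) fin(2)] E_mult_ge[of f1 g] by simp
    moreover have "E f + E g < E (F * g1)"
      using vext_add_le_less_mono(1)[OF EF g(4) fin(1)] E_mult_ge[of F g1] by simp
    ultimately have big: "E f + E g < E (F * G)"
      unfolding FG using less by (intro E_less_add) (simp_all add: E_minus)
    \<comment> \<open>The product \<open>(a + \<phi> * f') * (b + \<phi> * g')\<close> with
      \<open>a * b\<close> already reduced: the carry is moved to the next digit, so that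
      \<open>rec\<close> exposes the lowest one.\<close>
    define u where "u = (a * g' + f' * b + \<phi> * f' * g' + a * b div \<phi>) * \<phi> + a * b mod \<phi>"
    have sum: "(\<Sum>_<s + t. \<gamma>) = (\<Sum>_<s. \<gamma>) + (\<Sum>_<t. \<gamma>)"
      by (induction t) (simp_all add: add.assoc[symmetric])
    have "u = (a + \<phi> * f') * (b + \<phi> * g')"
      using div_mult_mod_eq[of "a * b" \<phi>] unfolding u_def
      by (simp add: algebra_simps)
    then have "F * G = \<phi> ^ (s + t) * u" by (simp add: F_def G_def power_add mult_ac)
    then have "E (F * G) = E u + (\<Sum>_<s + t. \<gamma>)" by (simp only: E_power_mult)
    also have "\<dots> \<le> (E a + E b) + (\<Sum>_<s + t. \<gamma>)"
      unfolding u_def rec[OF degree_mod_lt[OF pos]] low_mult[OF f(1) g(1)]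
      by (intro add_right_mono) simp
    also have "\<dots> = E f + E g" unfolding f(2) g(2) sum by (simp add: ac_simps)
    finally show False using big by simp
  qed
qed (simp_all add: E_0 E_1 E_add zero_vext_def)

lemma E_phi: "E \<phi> = \<gamma>"
  using E_phi_mult[of 1] E_1 by (cases \<gamma>) simp_all

lemma range_E:
  assumes low: "\<And>r. degree r < degree \<phi> \<Longrightarrow> E r \<in> insert Infty (Fin ` \<Lambda>)"
    and \<gamma>: "\<gamma> \<in> insert Infty (Fin ` \<Lambda>)" and closed: "\<And>a b. a \<in> \<Lambda> \<Longrightarrow> b \<in> \<Lambda> \<Longrightarrow> a + b \<in> \<Lambda>"
  shows "range E \<subseteq> insert Infty (Fin ` \<Lambda>)"
proof -
  have "E f \<in> insert Infty (Fin ` \<Lambda>)" for f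
  proof (induction f rule: expansion_induct)
    case zero
    then show ?case by (simp add: E_0)
  next
    case (step q r)
    have "E q + \<gamma> \<in> insert Infty (Fin ` \<Lambda>)" using step(2) \<gamma> closed by auto
    then show ?case using low[OF step(1)] rec[OF step(1)] by (simp add: min_def)
  qed
  then show ?thesis by blast
qed

lemma expansion_valuation_mod: "expansion_valuation \<phi> (\<lambda>f. E (f mod \<phi>)) Infty"
proof
  have low: "r mod \<phi> = r" if "degree r < degree \<phi>" for r using that by (rule mod_poly_less)
  fix a b q r :: "'k poly"
  show "E ((q * \<phi> + r) mod \<phi>) = min (E (r mod \<phi>)) (E (q mod \<phi>) + Infty)"
    if "degree r < degree \<phi>" using low[OF that] by (simp add: min_def)
  assume a: "degree a < degree \<phi>" and b: "degree b < degree \<phi>"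
  show "min (E (a mod \<phi>)) (E (b mod \<phi>)) \<le> E ((a + b) mod \<phi>)"
    using low_add[OF a b] low[OF a] low[OF b] low[OF degree_add_less[OF a b]] by simp
  show "E (a * b mod \<phi> mod \<phi>) = E (a mod \<phi>) + E (b mod \<phi>)"
    using low_mult[OF a b] low[OF a] low[OF b] by simp
qed (use pos E_0 E_1 in \<open>auto simp: mod_poly_less\<close>)

end

lemma expansion_min_valuation:
  fixes w :: "'k::field poly \<Rightarrow> 'r::linordered_ab_group_add vext"
  assumes pos: "0 < degree \<phi>" and w_0: "w 0 = Infty" and w_1: "w 1 = Fin 0"
    and add: "\<And>a b. degree a < degree \<phi> \<Longrightarrow> degree b < degree \<phi> \<Longrightarrow> min (w a) (w b) \<le> w (a + b)"
    and mult: "\<And>a b. degree a < degree \<phi> \<Longrightarrow> degree b < degree \<phi> \<Longrightarrow> w (a * b mod \<phi>) = w a + w b"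
    and carry: "\<And>a b. degree a < degree \<phi> \<Longrightarrow> degree b < degree \<phi> \<Longrightarrow>
      w a + w b \<le> w (a * b div \<phi>) + \<gamma>"
  shows "expansion_valuation \<phi> (expansion_min w \<phi> \<gamma>) \<gamma>"
proof
  let ?E = "expansion_min w \<phi> \<gamma>"
  note low = expansion_min_low[where w=w and \<gamma>=\<gamma>, OF w_0 pos]
  show "0 < degree \<phi>" by (rule pos)
  show "?E 0 = Infty" "?E 1 = Fin 0" using pos by (simp_all add: low w_0 w_1)
  fix a b q r :: "'k poly"
  show "?E (q * \<phi> + r) = min (?E r) (?E q + \<gamma>)" if "degree r < degree \<phi>"
    unfolding low[OF that] by (rule expansion_min_rec[where w=w, OF w_0 pos that])
  assume a: "degree a < degree \<phi>" and b: "degree b < degree \<phi>"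
  show "min (?E a) (?E b) \<le> ?E (a + b)"
    using add[OF a b] by (simp add: low a b degree_add_less)
  show "?E (a * b mod \<phi>) = ?E a + ?E b"
    using mult[OF a b] by (simp add: low a b degree_mod_lt[OF pos])
  show "?E a + ?E b \<le> ?E (a * b div \<phi>) + \<gamma>"
    using carry[OF a b] by (simp add: low a b degree_mult_div_less)
qed

context base_valuation
begin

lemma expansion_in_T:
  assumes "expansion_valuation \<phi> E \<gamma>" "\<And>a. E [:a:] = v a"
  shows "E \<in> T"
  using T_I expansion_valuation.valuation assms by blast

text \<open>The valuation taking f to \<open>E (f mod \<phi>)\<close> lies above E, agrees with it
  below the degree of \<phi> and sends \<phi> to Infty. So \<phi> is a direction from E, hence a key
  polynomial.\<close>

lemma expansion_KP:
  assumes E: "expansion_valuation \<phi> E \<gamma>" and const: "\<And>a. E [:a:] = v a"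
    and monic: "lead_coeff \<phi> = 1" and fin: "\<gamma> \<noteq> Infty"
  shows "\<phi> \<in> KP E"
proof -
  interpret expansion_valuation \<phi> E \<gamma> by (rule E)
  let ?F = "\<lambda>f. E (f mod \<phi>)"
  have ET: "E \<in> T" by (rule expansion_in_T[OF E const])
  have FT: "?F \<in> T" using pos const by (intro expansion_in_T[OF expansion_valuation_mod]) (simp add: mod_poly_less)
  have "E \<le> ?F"
  proof (rule le_funI)
    fix f show "E f \<le> E (f mod \<phi>)"
      using rec[OF degree_mod_lt[OF pos], of "f div \<phi>" f] by simp
  qed
  moreover have "\<phi> \<in> tangent E ?F"
    using fin by (intro tangentI[OF ET FT monic]) (auto simp: E_phi E_0 vext_less_Infty_iff mod_poly_less)
  ultimately show ?thesis using tangent_KP ET FT by blast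
qed

subsection \<open>Ordinary augmentations\<close>

text \<open>By primality and minimality \<phi> divides no initial form of a product of two nonzero
  digits, so passing to the remainder cannot raise the value.\<close>

lemma KP_low_mult:
  assumes val: "is_valuation \<mu>" and \<phi>: "\<phi> \<in> KP \<mu>" and a: "degree a < degree \<phi>" and b: "degree b < degree \<phi>"
  shows "\<mu> (a * b mod \<phi>) = \<mu> a + \<mu> b" "\<mu> a + \<mu> b \<le> \<mu> (a * b div \<phi>) + \<mu> \<phi>"
proof -
  have pos: "0 < degree \<phi>" by (rule KP_degree_pos[OF val \<phi>])
  have eq: "\<mu> (a * b) = min (\<mu> (a * b mod \<phi>)) (\<mu> (a * b div \<phi>) + \<mu> \<phi>)"
    using KP_expansion[OF val \<phi> degree_mod_lt[OF pos], of "a * b div \<phi>" "a * b"] by simp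
  then show "\<mu> a + \<mu> b \<le> \<mu> (a * b div \<phi>) + \<mu> \<phi>" by (simp add: val_mult[OF val])
  have "\<not> \<mu> (a * b) < \<mu> (a * b mod \<phi>)"
  proof
    assume less: "\<mu> (a * b) < \<mu> (a * b mod \<phi>)"
    then have "hdiv \<mu> \<phi> (a * b)"
      unfolding hdiv_def by (metis minus_div_mult_eq_mod)
    then have "hdiv \<mu> \<phi> a \<or> hdiv \<mu> \<phi> b" by (rule KP_D(5)[OF val \<phi>])
    then have "a = 0 \<or> b = 0" using KP_D(4)[OF val \<phi>] a b by blast
    then show False using less by (auto simp: val_0[OF val])
  qed
  then show "\<mu> (a * b mod \<phi>) = \<mu> a + \<mu> b" using eq by (simp add: val_mult[OF val] min_def split: if_splits)
qed

lemma ord_aug_expansion: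
  assumes \<mu>: "\<mu> \<in> T" and \<phi>: "\<phi> \<in> KP \<mu>" and \<gamma>: "\<mu> \<phi> \<le> \<gamma>"
  shows "expansion_valuation \<phi> (ord_aug \<mu> \<phi> \<gamma>) \<gamma>"
    and "degree r < degree \<phi> \<Longrightarrow> ord_aug \<mu> \<phi> \<gamma> r = \<mu> r"
proof -
  note val = T_val[OF \<mu>]
  note pos = KP_degree_pos[OF val \<phi>]
  show "degree r < degree \<phi> \<Longrightarrow> ord_aug \<mu> \<phi> \<gamma> r = \<mu> r"
    unfolding ord_aug_def by (rule expansion_min_low[where w=\<mu>, OF val_0[OF val] pos])
  show "expansion_valuation \<phi> (ord_aug \<mu> \<phi> \<gamma>) \<gamma>"
    unfolding ord_aug_def
  proof (rule expansion_min_valuation[OF pos val_0[OF val] val_1[OF val] val_add[OF val] KP_low_mult(1)[OF val \<phi>]])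
    show "\<mu> a + \<mu> b \<le> \<mu> (a * b div \<phi>) + \<gamma>" if "degree a < degree \<phi>" "degree b < degree \<phi>" for a b
      using KP_low_mult(2)[OF val \<phi> that] add_left_mono[OF \<gamma>] by (rule order_trans)
  qed
qed

lemma ord_aug_T:
  assumes \<mu>: "\<mu> \<in> T" and \<phi>: "\<phi> \<in> KP \<mu>" and \<gamma>: "\<mu> \<phi> \<le> \<gamma>"
  shows "ord_aug \<mu> \<phi> \<gamma> \<in> T" "\<mu> \<le> ord_aug \<mu> \<phi> \<gamma>" "ord_aug \<mu> \<phi> \<gamma> \<phi> = \<gamma>"
    "\<gamma> \<noteq> Infty \<Longrightarrow> \<phi> \<in> KP (ord_aug \<mu> \<phi> \<gamma>)"
    "\<mu> \<phi> < \<gamma> \<Longrightarrow> \<phi> \<in> tangent \<mu> (ord_aug \<mu> \<phi> \<gamma>)"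
proof -
  interpret expansion_valuation \<phi> "ord_aug \<mu> \<phi> \<gamma>" \<gamma> by (rule ord_aug_expansion[OF assms])
  note low = ord_aug_expansion(2)[OF assms]
  have const: "ord_aug \<mu> \<phi> \<gamma> [:a:] = v a" for a
    using low[of "[:a:]"] pos T_const[OF \<mu>] by simp
  show ET: "ord_aug \<mu> \<phi> \<gamma> \<in> T"
    by (rule expansion_in_T[OF expansion_valuation_axioms const])
  show "\<mu> \<le> ord_aug \<mu> \<phi> \<gamma>"
    by (rule le_if_expansion_le[OF pos valuation, where \<gamma>="\<mu> \<phi>"])
      (simp_all add: KP_expansion[OF T_val[OF \<mu>] \<phi>] low E_phi \<gamma>)
  show "ord_aug \<mu> \<phi> \<gamma> \<phi> = \<gamma>" by (rule E_phi)
  have monic: "lead_coeff \<phi> = 1" by (rule KP_D(1)[OF T_val[OF \<mu>] \<phi>])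
  show "\<gamma> \<noteq> Infty \<Longrightarrow> \<phi> \<in> KP (ord_aug \<mu> \<phi> \<gamma>)"
    by (rule expansion_KP[OF expansion_valuation_axioms const monic])
  show "\<mu> \<phi> < \<gamma> \<Longrightarrow> \<phi> \<in> tangent \<mu> (ord_aug \<mu> \<phi> \<gamma>)"
    by (rule tangentI[OF \<mu> ET monic]) (simp_all add: E_phi low)
qed

lemma ord_aug_Infty:
  assumes \<mu>: "\<mu> \<in> T" and \<phi>: "\<phi> \<in> KP \<mu>"
  shows "ord_aug \<mu> \<phi> Infty f = \<mu> (f mod \<phi>)"
proof -
  have *: "\<mu> \<phi> \<le> Infty" by simp
  interpret expansion_valuation \<phi> "ord_aug \<mu> \<phi> Infty" Infty by (rule ord_aug_expansion[OF assms *])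
  show ?thesis
    using rec[OF degree_mod_lt[OF pos], of "f div \<phi>" f] ord_aug_expansion(2)[OF assms *, OF degree_mod_lt[OF pos], of f]
    by (simp add: min_def)
qed

subsection \<open>Valuations of degree one\<close>

text \<open>Digits in base \<open>[:0, 1:]\<close>, the polynomial x, are constants;
  \<open>v (coeff f 0)\<close> merely turns v into a function on polynomials with the right values
  on them.\<close>

definition gauss :: "'r vext \<Rightarrow> 'k poly \<Rightarrow> 'r vext" where
  "gauss \<gamma> = expansion_min (\<lambda>f. v (coeff f 0)) [:0, 1:] \<gamma>"

lemma degree_less_x: "degree r < degree [:0, 1 :: 'k:] \<Longrightarrow> \<exists>a. r = [:a:]"
  by (metis One_nat_def degree_eq_zeroE degree_pCons_eq_if less_one one_neq_zero pCons_eq_0_iff)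

lemma gauss_const: "gauss \<gamma> [:a:] = v a"
  unfolding gauss_def
  using expansion_min_low[where w="\<lambda>f. v (coeff f 0)", of "[:0, 1:]" "[:a:]"] by (simp add: val_0[OF v])

lemma gauss_expansion: "expansion_valuation [:0, 1:] (gauss \<gamma>) \<gamma>"
  unfolding gauss_def
proof (rule expansion_min_valuation)
  fix a b :: "'k poly" assume "degree a < degree [:0, 1 :: 'k:]" "degree b < degree [:0, 1 :: 'k:]"
  then obtain c d where ab: "a = [:c:]" "b = [:d:]" using degree_less_x by blast
  have prod: "a * b = [:c * d:]" by (simp add: ab)
  show "min (v (coeff a 0)) (v (coeff b 0)) \<le> v (coeff (a + b) 0)"
    using val_add[OF v] by simp
  show "v (coeff (a * b mod [:0, 1:]) 0) = v (coeff a 0) + v (coeff b 0)"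
    unfolding prod using val_mult[OF v] by (simp add: mod_poly_less ab)
  have "a * b div [:0, 1:] = 0" unfolding prod by (simp add: div_poly_less)
  then show "v (coeff a 0) + v (coeff b 0) \<le> v (coeff (a * b div [:0, 1:]) 0) + \<gamma>"
    by (simp add: val_0[OF v])
qed (simp_all add: val_0[OF v] val_1[OF v])

lemma gauss_T: "gauss \<gamma> \<in> T"
  by (rule expansion_in_T[OF gauss_expansion gauss_const])

lemma gauss_KP: "\<gamma> \<noteq> Infty \<Longrightarrow> [:0, 1:] \<in> KP (gauss \<gamma>)"
  by (rule expansion_KP[OF gauss_expansion gauss_const]) auto

lemma coeff_exp_coeff_x: "coeff (exp_coeff [:0, 1:] f s) 0 = coeff f s"
proof (induction s arbitrary: f)
  case 0
  obtain c g where f: "f = pCons c g" by (cases f)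
  have "pCons c g = g * [:0, 1:] + [:c:]" by simp
  then show ?case unfolding f using exp_coeff_0[of "[:c:]" "[:0, 1:]" g] by simp
next
  case (Suc s)
  obtain c g where f: "f = pCons c g" by (cases f)
  have "pCons c g = g * [:0, 1:] + [:c:]" by simp
  then show ?case unfolding f using exp_coeff_Suc[of "[:c:]" "[:0, 1:]" g s] Suc by simp
qed

lemma root_node_eq_gauss: "root_node v S = gauss (Fin (LEAST x. x \<in> S))"
  by (rule ext) (simp add: root_node_def gauss_def expansion_min_def coeff_exp_coeff_x)

end

section \<open>Cuts realized in the set of representatives\<close>

context base_valuation
begin

section \<open>The value group and its divisible hull\<close>

abbreviation "\<Gamma> \<equiv> value_group v"
abbreviation "\<Lambda> \<equiv> div_hull (value_group v)"

lemma \<Gamma>_0: "0 \<in> \<Gamma>"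
  using val_1[OF v] by (auto simp: value_group_def intro!: exI[of _ 1])

lemma \<Gamma>_minus:
  assumes "x \<in> \<Gamma>"
  shows "- x \<in> \<Gamma>"
proof -
  obtain a where a: "a \<noteq> 0" "v a = Fin x" using assms by (auto simp: value_group_def)
  then have "v a + v (inverse a) = Fin 0" using val_mult[OF v, of a "inverse a"] val_1[OF v] by simp
  then have "v (inverse a) = Fin (- x)"
    using a by (cases "v (inverse a)") (auto simp: eq_neg_iff_add_eq_0 add.commute)
  then show ?thesis using a by (auto simp: value_group_def intro!: exI[of _ "inverse a"])
qed

lemma \<Gamma>_add:
  assumes "x \<in> \<Gamma>" "y \<in> \<Gamma>"
  shows "x + y \<in> \<Gamma>"
proof -
  obtain a b where "a \<noteq> 0" "v a = Fin x" "b \<noteq> 0" "v b = Fin y"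
    using assms by (auto simp: value_group_def)
  then show ?thesis using val_mult[OF v, of a b] by (auto simp: value_group_def intro!: exI[of _ "a * b"])
qed

lemma \<Gamma>_scale_nat: "x \<in> \<Gamma> \<Longrightarrow> real n *\<^sub>R x \<in> \<Gamma>"
  by (induction n) (auto simp: \<Gamma>_0 \<Gamma>_add scaleR_add_left)

lemma \<Gamma>_\<Lambda>: "x \<in> \<Gamma> \<Longrightarrow> x \<in> \<Lambda>"
  unfolding div_hull_def by (auto intro!: exI[of _ "1::nat"])

lemma \<Lambda>_minus: "x \<in> \<Lambda> \<Longrightarrow> - x \<in> \<Lambda>"
  unfolding div_hull_def using \<Gamma>_minus by force

lemma \<Lambda>_add:
  assumes "x \<in> \<Lambda>" "y \<in> \<Lambda>"
  shows "x + y \<in> \<Lambda>"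
proof -
  obtain n m where nm: "n > 0" "m > 0" "real n *\<^sub>R x \<in> \<Gamma>" "real m *\<^sub>R y \<in> \<Gamma>"
    using assms by (auto simp: div_hull_def)
  then have "real m *\<^sub>R (real n *\<^sub>R x) + real n *\<^sub>R (real m *\<^sub>R y) \<in> \<Gamma>"
    using \<Gamma>_add[OF \<Gamma>_scale_nat \<Gamma>_scale_nat] by blast
  then have "real (n * m) *\<^sub>R (x + y) \<in> \<Gamma>" by (simp add: scaleR_add_right mult.commute)
  then show ?thesis using nm unfolding div_hull_def by (intro CollectI exI[of _ "n * m"]) simp
qed

lemma \<Lambda>_diff: "x \<in> \<Lambda> \<Longrightarrow> y \<in> \<Lambda> \<Longrightarrow> x - y \<in> \<Lambda>"
  using \<Lambda>_add[of x "- y"] \<Lambda>_minus by simp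

lemma \<Lambda>_divide:
  assumes "real n *\<^sub>R x \<in> \<Lambda>" "n > 0"
  shows "x \<in> \<Lambda>"
proof -
  obtain m where m: "m > 0" "real m *\<^sub>R (real n *\<^sub>R x) \<in> \<Gamma>" using assms(1) by (auto simp: div_hull_def)
  then show ?thesis using assms(2) unfolding div_hull_def by (intro CollectI exI[of _ "m * n"]) simp
qed

section \<open>Extensions of the value group by one generator\<close>

lemma cyclic_Mod_integers:
  fixes G :: "('r \<times> int) monoid"
  assumes G: "G = \<lparr>carrier = \<Gamma> \<times> (UNIV :: int set), mult = (\<lambda>p q. (fst p + fst q, snd p + snd q)), one = (0, 0)\<rparr>"
  shows "comm_group G" "cyclic_group (G Mod (\<Gamma> \<times> {0}))"
proof -
  show cg: "comm_group G"
  proof (rule comm_groupI)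
    fix p assume "p \<in> carrier G"
    then show "\<exists>q\<in>carrier G. q \<otimes>\<^bsub>G\<^esub> p = \<one>\<^bsub>G\<^esub>"
      by (intro bexI[of _ "(- fst p, - snd p)"]) (auto simp: G \<Gamma>_minus)
  qed (auto simp: G \<Gamma>_0 \<Gamma>_add algebra_simps)
  interpret comm_group G by (rule cg)
  have inv: "inv\<^bsub>G\<^esub> (a, 0) = (- a, 0)" if "a \<in> \<Gamma>" for a
    using that by (intro inv_equality) (auto simp: G \<Gamma>_minus)
  have sub: "subgroup (\<Gamma> \<times> {0}) G"
  proof (rule subgroupI)
    show "\<Gamma> \<times> {0} \<subseteq> carrier G" by (auto simp: G)
    show "\<Gamma> \<times> {0::int} \<noteq> {}" using \<Gamma>_0 by blast
    show "inv\<^bsub>G\<^esub> p \<in> \<Gamma> \<times> {0}" if "p \<in> \<Gamma> \<times> {0}" for p using that by (auto simp: inv \<Gamma>_minus)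
    show "p \<otimes>\<^bsub>G\<^esub> q \<in> \<Gamma> \<times> {0}" if "p \<in> \<Gamma> \<times> {0}" "q \<in> \<Gamma> \<times> {0}" for p q
      using that by (auto simp: G \<Gamma>_add)
  qed
  interpret normal "\<Gamma> \<times> {0}" G by (rule normal_iff_subgroup[THEN iffD2, OF sub])
  \<comment> \<open>Every coset of \<Gamma> contains exactly one pair with first entry 0, so \<int>
    maps onto the quotient.\<close>
  let ?h = "\<lambda>n::int. (\<Gamma> \<times> {0}) #>\<^bsub>G\<^esub> (0, n)"
  have coset: "(\<Gamma> \<times> {0}) #>\<^bsub>G\<^esub> (a, n) = \<Gamma> \<times> {n}" if "a \<in> \<Gamma>" for a n
  proof -
    have "(\<lambda>b. b + a) ` \<Gamma> = \<Gamma>"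
    proof (intro equalityI subsetI)
      fix b assume "b \<in> \<Gamma>"
      then have "b - a \<in> \<Gamma>" using \<Gamma>_add[OF _ \<Gamma>_minus[OF that], of b] by simp
      then show "b \<in> (\<lambda>b. b + a) ` \<Gamma>" by (rule image_eqI[rotated]) simp
    qed (use that in \<open>auto simp: \<Gamma>_add\<close>)
    moreover have "(\<Gamma> \<times> {0}) #>\<^bsub>G\<^esub> (a, n) = (\<lambda>b. b + a) ` \<Gamma> \<times> {n}"
      by (force simp: r_coset_def G)
    ultimately show ?thesis by simp
  qed
  have "?h \<in> hom integer_group (G Mod (\<Gamma> \<times> {0}))"
  proof (rule homI)
    fix n m :: int
    show "?h n \<in> carrier (G Mod (\<Gamma> \<times> {0}))"
      unfolding FactGroup_def RCOSETS_def using \<Gamma>_0 by (auto simp: G)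
    have "?h n <#>\<^bsub>G\<^esub> ?h m = (\<Gamma> \<times> {0}) #>\<^bsub>G\<^esub> ((0, n) \<otimes>\<^bsub>G\<^esub> (0, m))"
      by (rule rcos_sum) (auto simp: G \<Gamma>_0)
    then show "?h (n \<otimes>\<^bsub>integer_group\<^esub> m) = ?h n \<otimes>\<^bsub>G Mod (\<Gamma> \<times> {0})\<^esub> ?h m"
      by (simp add: FactGroup_def G)
  qed
  moreover have "?h ` carrier integer_group = carrier (G Mod (\<Gamma> \<times> {0}))"
  proof (intro equalityI subsetI)
    fix X assume "X \<in> carrier (G Mod (\<Gamma> \<times> {0}))"
    then obtain a n where "a \<in> \<Gamma>" "X = (\<Gamma> \<times> {0}) #>\<^bsub>G\<^esub> (a, n)"
      by (auto simp: FactGroup_def RCOSETS_def G)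
    then show "X \<in> ?h ` carrier integer_group" by (auto simp: coset \<Gamma>_0)
  next
    fix X assume "X \<in> ?h ` carrier integer_group"
    then show "X \<in> carrier (G Mod (\<Gamma> \<times> {0}))"
      unfolding FactGroup_def RCOSETS_def using \<Gamma>_0 by (auto simp: G)
  qed
  ultimately have "?h \<in> epi integer_group (G Mod (\<Gamma> \<times> {0}))" by (simp add: epi_def)
  then show "cyclic_group (G Mod (\<Gamma> \<times> {0}))"
    by (rule group.cyclic_group_epimorphic_image[OF group_integer_group _ cyclic_integer_group factorgroup_is_group])
qed

text \<open>\<open>pos a n\<close> prescribes when \<open>a + n x \<ge> 0\<close> for the element \<open>x\<close> to be realized.\<close>

lemma realize_order:
  fixes pos :: "'r \<Rightarrow> int \<Rightarrow> bool"
  assumes emb: "embeds_small_extensions \<Gamma>"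
    and pos_add: "\<And>a b n m. a \<in> \<Gamma> \<Longrightarrow> b \<in> \<Gamma> \<Longrightarrow> pos a n \<Longrightarrow> pos b m \<Longrightarrow> pos (a + b) (n + m)"
    and pos_0: "\<And>a. a \<in> \<Gamma> \<Longrightarrow> pos a 0 \<longleftrightarrow> 0 \<le> a"
    and pos_total: "\<And>a n. a \<in> \<Gamma> \<Longrightarrow> pos a n \<or> pos (- a) (- n)"
    and pos_antisym: "\<And>a n. a \<in> \<Gamma> \<Longrightarrow> pos a n \<Longrightarrow> pos (- a) (- n) \<Longrightarrow> a = 0 \<and> n = 0"
  shows "\<exists>x. \<forall>a\<in>\<Gamma>. \<forall>n. 0 \<le> a + of_int n *\<^sub>R x \<longleftrightarrow> pos a n"
proof -
  define G :: "('r \<times> int) monoid" where "G = \<lparr>carrier = \<Gamma> \<times> (UNIV :: int set), mult = (\<lambda>p q. (fst p + fst q, snd p + snd q)), one = (0, 0)\<rparr>"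
  define r where "r = {(p, q). p \<in> carrier G \<and> q \<in> carrier G \<and> pos (fst q - fst p) (snd q - snd p)}"
  define \<iota> where "\<iota> a = (a, 0 :: int)" for a :: 'r
  have diff: "a - b \<in> \<Gamma>" if "a \<in> \<Gamma>" "b \<in> \<Gamma>" for a b
    using \<Gamma>_add[OF that(1) \<Gamma>_minus[OF that(2)]] by simp
  have "linear_order_on (carrier G) r"
    unfolding linear_order_on_def partial_order_on_def preorder_on_def
  proof (intro conjI)
    show "r \<subseteq> carrier G \<times> carrier G" by (auto simp: r_def)
    show "refl_on (carrier G) r" by (auto simp: r_def refl_on_def pos_0 \<Gamma>_0)
    show "trans r"
    proof (rule transI)
      fix p q s assume "(p, q) \<in> r" "(q, s) \<in> r"
      then show "(p, s) \<in> r"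
        using pos_add[of "fst q - fst p" "fst s - fst q" "snd q - snd p" "snd s - snd q"] diff
        by (auto simp: r_def G_def)
    qed
    show "antisym r"
    proof (rule antisymI)
      fix p q assume "(p, q) \<in> r" "(q, p) \<in> r"
      then show "p = q"
        using pos_antisym[of "fst q - fst p" "snd q - snd p"] diff
        by (auto simp: r_def G_def)
    qed
    show "total_on (carrier G) r"
      using pos_total diff by (fastforce simp: total_on_def r_def G_def)
  qed
  then have "ordered_group G r"
    unfolding ordered_group_def using cyclic_Mod_integers(1)[OF G_def]
    by (auto simp: r_def G_def \<Gamma>_add)
  then have ext: "ordered_extension \<Gamma> G r \<iota>"
    unfolding ordered_extension_def \<iota>_def
    by (auto simp: G_def r_def pos_0 diff)
  have pow: "snd (p [^]\<^bsub>G\<^esub> n) = int n * snd p" for p and n :: nat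
    by (induction n) (auto simp: nat_pow_def G_def algebra_simps)
  \<comment> \<open>A positive multiple of a pair has second entry 0 only if the pair has, whatever
    the order r; so the quotient by the hull is cyclic.\<close>
  have "rel_div_hull G (\<iota> ` \<Gamma>) = \<Gamma> \<times> {0}"
  proof (intro equalityI subsetI)
    fix p assume "p \<in> rel_div_hull G (\<iota> ` \<Gamma>)"
    then obtain n :: nat where "n > 0" "p [^]\<^bsub>G\<^esub> n \<in> \<iota> ` \<Gamma>" "p \<in> carrier G" by (auto simp: rel_div_hull_def)
    then show "p \<in> \<Gamma> \<times> {0}" using pow[of p n] by (cases p) (auto simp: \<iota>_def G_def)
  next
    fix p assume p: "p \<in> \<Gamma> \<times> {0::int}"
    interpret comm_group G by (rule cyclic_Mod_integers(1)[OF G_def])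
    have "p [^]\<^bsub>G\<^esub> (1::nat) = p" using p l_one by (auto simp: nat_pow_def G_def)
    then show "p \<in> rel_div_hull G (\<iota> ` \<Gamma>)"
      using p by (auto simp: rel_div_hull_def \<iota>_def G_def intro!: exI[of _ "1::nat"])
  qed
  then have "small_extension \<Gamma> G r \<iota>"
    unfolding small_extension_def using ext cyclic_Mod_integers(2)[OF G_def] by simp
  then obtain j :: "'r \<times> int \<Rightarrow> 'r" where
    j: "\<forall>p\<in>carrier G. \<forall>q\<in>carrier G. j (p \<otimes>\<^bsub>G\<^esub> q) = j p + j q \<and> (j p \<le> j q \<longleftrightarrow> (p, q) \<in> r)"
      "\<forall>a\<in>\<Gamma>. j (\<iota> a) = a"
    using emb[unfolded embeds_small_extensions_def, rule_format, of G r \<iota>] by blast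
  have jadd: "\<And>p q. p \<in> carrier G \<Longrightarrow> q \<in> carrier G \<Longrightarrow> j (p \<otimes>\<^bsub>G\<^esub> q) = j p + j q" and
    jle: "\<And>p q. p \<in> carrier G \<Longrightarrow> q \<in> carrier G \<Longrightarrow> j p \<le> j q \<longleftrightarrow> (p, q) \<in> r" and
    j\<iota>: "\<And>a. a \<in> \<Gamma> \<Longrightarrow> j (a, 0) = a"
    using j by (auto simp: \<iota>_def)
  define x where "x = j (0, 1)"
  have jplus: "j (a + b, n + m) = j (a, n) + j (b, m)" if "a \<in> \<Gamma>" "b \<in> \<Gamma>" for a b n m
    using jadd[of "(a, n)" "(b, m)"] that by (auto simp: G_def)
  have jnat: "j (0, int n) = real n *\<^sub>R x" for n
  proof (induction n)
    case 0
    then show ?case using j\<iota>[OF \<Gamma>_0] by simp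
  next
    case (Suc n)
    then show ?case using jplus[OF \<Gamma>_0 \<Gamma>_0, of "int n" 1]
      by (simp add: x_def scaleR_add_left add.commute)
  qed
  have jint: "j (0, n) = of_int n *\<^sub>R x" for n
  proof (cases "0 \<le> n")
    case True
    then show ?thesis using jnat[of "nat n"] by simp
  next
    case False
    then have "j (0, - n) = of_int (- n) *\<^sub>R x" using jnat[of "nat (- n)"] by simp
    moreover have "j (0, n) + j (0, - n) = 0" using jplus[OF \<Gamma>_0 \<Gamma>_0, of n "- n"] j\<iota>[OF \<Gamma>_0] by simp
    ultimately show ?thesis by (simp add: eq_neg_iff_add_eq_0[symmetric])
  qed
  have "0 \<le> a + of_int n *\<^sub>R x \<longleftrightarrow> pos a n" if a: "a \<in> \<Gamma>" for a n
  proof -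
    have "j (a, n) = a + of_int n *\<^sub>R x"
      using jplus[OF a \<Gamma>_0, of 0 n] j\<iota>[OF a] jint by simp
    then show ?thesis using jle[of "(0, 0)" "(a, n)"] a \<Gamma>_0 j\<iota>[OF \<Gamma>_0] by (simp add: r_def G_def)
  qed
  then show ?thesis by blast
qed

text \<open>An isomorphism over \<Gamma> taking x to y must send \<open>a + n x\<close> to
  \<open>a + n y\<close>, so it exists exactly if this assignment respects the order. Differences
  reduce the order to signs, and comparing in both directions gives well-definedness and
  injectivity.\<close>

lemma sme_equiv_iff:
  "sme_equiv \<Gamma> x y \<longleftrightarrow> (\<forall>a\<in>\<Gamma>. \<forall>n::int. 0 \<le> a + of_int n *\<^sub>R x \<longleftrightarrow> 0 \<le> a + of_int n *\<^sub>R y)"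
proof
  assume "sme_equiv \<Gamma> x y"
  then obtain \<sigma> where
    add: "\<And>a b. a \<in> adjoin \<Gamma> x \<Longrightarrow> b \<in> adjoin \<Gamma> x \<Longrightarrow> \<sigma> (a + b) = \<sigma> a + \<sigma> b"
    and le: "\<And>a b. a \<in> adjoin \<Gamma> x \<Longrightarrow> b \<in> adjoin \<Gamma> x \<Longrightarrow> \<sigma> a \<le> \<sigma> b \<longleftrightarrow> a \<le> b"
    and xy: "\<sigma> x = y" and fixed: "\<And>a. a \<in> \<Gamma> \<Longrightarrow> \<sigma> a = a"
    unfolding sme_equiv_def by blast
  have mem: "a + of_int n *\<^sub>R x \<in> adjoin \<Gamma> x" if "a \<in> \<Gamma>" for a and n :: int
    using that by (auto simp: adjoin_def)
  have mem': "of_int n *\<^sub>R x \<in> adjoin \<Gamma> x" for n :: int using mem[OF \<Gamma>_0, of n] by simp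
  have memx: "x \<in> adjoin \<Gamma> x" using mem'[of 1] by simp
  have nat: "\<sigma> (real n *\<^sub>R x) = real n *\<^sub>R y" for n
  proof (induction n)
    case 0
    then show ?case using fixed[OF \<Gamma>_0] by simp
  next
    case (Suc n)
    then show ?case using add[OF memx mem'[of "int n"]] xy by (simp add: scaleR_add_left)
  qed
  have int: "\<sigma> (of_int n *\<^sub>R x) = of_int n *\<^sub>R y" for n
  proof (cases "0 \<le> n")
    case True
    then show ?thesis using nat[of "nat n"] by simp
  next
    case False
    then have "\<sigma> (of_int (- n) *\<^sub>R x) = of_int (- n) *\<^sub>R y" using nat[of "nat (- n)"] by simp
    moreover have "\<sigma> (of_int n *\<^sub>R x) + \<sigma> (of_int (- n) *\<^sub>R x) = 0"
      using add[OF mem'[of n] mem'[of "- n"]] fixed[OF \<Gamma>_0] by simp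
    ultimately show ?thesis by (simp add: eq_neg_iff_add_eq_0[symmetric])
  qed
  show "\<forall>a\<in>\<Gamma>. \<forall>n::int. 0 \<le> a + of_int n *\<^sub>R x \<longleftrightarrow> 0 \<le> a + of_int n *\<^sub>R y"
  proof (intro ballI allI)
    fix a and n :: int assume a: "a \<in> \<Gamma>"
    have "a \<in> adjoin \<Gamma> x" "0 \<in> adjoin \<Gamma> x" using mem[of _ 0] a \<Gamma>_0 by auto
    then show "0 \<le> a + of_int n *\<^sub>R x \<longleftrightarrow> 0 \<le> a + of_int n *\<^sub>R y"
      using le[of 0 "a + of_int n *\<^sub>R x"] mem[OF a, of n] add[OF _ mem'[of n], of a] fixed[OF \<Gamma>_0] fixed[OF a] int[of n] by simp
  qed
next
  assume H: "\<forall>a\<in>\<Gamma>. \<forall>n::int. 0 \<le> a + of_int n *\<^sub>R x \<longleftrightarrow> 0 \<le> a + of_int n *\<^sub>R y"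
  have le: "a + of_int n *\<^sub>R x \<le> b + of_int m *\<^sub>R x \<longleftrightarrow> a + of_int n *\<^sub>R y \<le> b + of_int m *\<^sub>R y"
    if "a \<in> \<Gamma>" "b \<in> \<Gamma>" for a b and n m :: int
  proof -
    have *: "a + of_int n *\<^sub>R z \<le> b + of_int m *\<^sub>R z \<longleftrightarrow> 0 \<le> (b - a) + of_int (m - n) *\<^sub>R z" for z :: 'r
      by (simp add: scaleR_diff_left algebra_simps)
    have "b - a \<in> \<Gamma>" using \<Gamma>_add[OF that(2) \<Gamma>_minus[OF that(1)]] by simp
    then show ?thesis unfolding * using H by blast
  qed
  then have eq: "a + of_int n *\<^sub>R x = b + of_int m *\<^sub>R x \<longleftrightarrow> a + of_int n *\<^sub>R y = b + of_int m *\<^sub>R y"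
    if "a \<in> \<Gamma>" "b \<in> \<Gamma>" for a b and n m :: int
    using le[OF that, of n m] le[OF that(2,1), of m n] 
    unfolding order_eq_iff[where 'a='r] by blast
  \<comment> \<open>If x is commensurable with \<Gamma>, the representation \<open>a + n x\<close>
    is not unique; one is chosen, and \<open>eq\<close> shows that the choice is immaterial.\<close>
  define \<sigma> where "\<sigma> z = (let p = SOME p. fst p \<in> \<Gamma> \<and> z = fst p + of_int (snd p) *\<^sub>R x
    in fst p + of_int (snd p) *\<^sub>R y)" for z
  have \<sigma>: "\<sigma> (a + of_int n *\<^sub>R x) = a + of_int n *\<^sub>R y" if a: "a \<in> \<Gamma>" for a and n :: int
  proof -
    define p where "p = (SOME p. fst p \<in> \<Gamma> \<and> a + of_int n *\<^sub>R x = fst p + of_int (snd p) *\<^sub>R x)"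
    have "fst p \<in> \<Gamma> \<and> a + of_int n *\<^sub>R x = fst p + of_int (snd p) *\<^sub>R x"
      unfolding p_def by (rule someI[of _ "(a, n)"]) (simp add: a)
    then show ?thesis using eq[OF a, of "fst p" n "snd p"] unfolding \<sigma>_def p_def[symmetric] Let_def by simp
  qed
  have plus: "(a + of_int n *\<^sub>R z) + (b + of_int m *\<^sub>R z) = (a + b) + of_int (n + m) *\<^sub>R z" for a b z :: 'r and n m :: int
    by (simp add: scaleR_add_left algebra_simps)
  show "sme_equiv \<Gamma> x y"
    unfolding sme_equiv_def
  proof (intro exI[of _ \<sigma>] conjI ballI)
    show "bij_betw \<sigma> (adjoin \<Gamma> x) (adjoin \<Gamma> y)"
      unfolding bij_betw_def
    proof
      show "inj_on \<sigma> (adjoin \<Gamma> x)"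
        unfolding inj_on_def adjoin_def using eq \<sigma> by fastforce
      show "\<sigma> ` adjoin \<Gamma> x = adjoin \<Gamma> y"
        unfolding adjoin_def using \<sigma> by (auto simp: image_iff) (metis \<sigma>)
    qed
    show "\<sigma> x = y" using \<sigma>[OF \<Gamma>_0, of 1] by simp
    show "\<sigma> a = a" if "a \<in> \<Gamma>" for a using \<sigma>[OF that, of 0] by simp
  next
    fix z z' assume "z \<in> adjoin \<Gamma> x" "z' \<in> adjoin \<Gamma> x"
    then obtain a b n m where z: "a \<in> \<Gamma>" "z = a + of_int n *\<^sub>R x" "b \<in> \<Gamma>" "z' = b + of_int m *\<^sub>R x"
      by (auto simp: adjoin_def)
    show "\<sigma> (z + z') = \<sigma> z + \<sigma> z'"
      unfolding z(2,4) \<sigma>[OF z(1)] \<sigma>[OF z(3)] plus by (rule \<sigma>[OF \<Gamma>_add[OF z(1,3)]])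
    show "\<sigma> z \<le> \<sigma> z' \<longleftrightarrow> z \<le> z'"
      unfolding z(2,4) \<sigma>[OF z(1)] \<sigma>[OF z(3)] using le[OF z(1,3)] by simp
  qed
qed

section \<open>Cuts of the divisible hull and their suprema\<close>

lemma cut_pos_iff:
  fixes x a :: 'r
  assumes a: "a \<in> \<Gamma>" and n: "n \<noteq> (0::int)"
  defines "l \<equiv> - ((1 / of_int n) *\<^sub>R a)"
  shows "l \<in> \<Lambda>" "n > 0 \<Longrightarrow> 0 \<le> a + of_int n *\<^sub>R x \<longleftrightarrow> l \<le> x"
    "n < 0 \<Longrightarrow> 0 \<le> a + of_int n *\<^sub>R x \<longleftrightarrow> x \<le> l"
proof -
  \<comment> \<open>The sign of \<open>a + n x\<close> is decided by comparing x with
    \<open>l = - a / n\<close>, which lies in \<Lambda>; hence the type of x over \<Gamma> depends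
    only on its cut in \<Lambda>.\<close>
  have l: "of_int n *\<^sub>R l = - a" using n by (simp add: l_def)
  have "real (nat \<bar>n\<bar>) *\<^sub>R l \<in> \<Gamma>"
  proof (cases "0 \<le> n")
    case True
    then have "real (nat \<bar>n\<bar>) *\<^sub>R l = - a" using l by simp
    then show ?thesis using \<Gamma>_minus[OF a] by simp
  next
    case False
    then have "real (nat \<bar>n\<bar>) *\<^sub>R l = - (of_int n *\<^sub>R l)" by simp
    then show ?thesis using a unfolding l by simp
  qed
  then show "l \<in> \<Lambda>" unfolding div_hull_def using n by (auto intro!: exI[of _ "nat \<bar>n\<bar>"])
  have "0 \<le> a + of_int n *\<^sub>R x \<longleftrightarrow> of_int n *\<^sub>R l \<le> of_int n *\<^sub>R x"
    unfolding l using neg_le_iff_le[of "of_int n *\<^sub>R x" "- a"] le_diff_eq[of 0 "of_int n *\<^sub>R x" "- a"]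
    by (simp add: add.commute)
  then show "n > 0 \<Longrightarrow> 0 \<le> a + of_int n *\<^sub>R x \<longleftrightarrow> l \<le> x" "n < 0 \<Longrightarrow> 0 \<le> a + of_int n *\<^sub>R x \<longleftrightarrow> x \<le> l"
    by (simp_all add: scaleR_le_cancel_left)
qed

lemma div_hull_scaled:
  assumes "l \<in> \<Lambda>"
  obtains N :: nat where "N > 0" "real N *\<^sub>R l \<in> \<Gamma>"
    "\<And>d. l \<le> d \<longleftrightarrow> 0 \<le> - (real N *\<^sub>R l) + of_int (int N) *\<^sub>R d"
    "\<And>d. d \<le> l \<longleftrightarrow> 0 \<le> real N *\<^sub>R l + of_int (- int N) *\<^sub>R d"
proof -
  obtain N where N: "N > 0" "real N *\<^sub>R l \<in> \<Gamma>" using assms by (auto simp: div_hull_def)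
  show thesis
  proof (rule that[OF N])
    fix d
    show "l \<le> d \<longleftrightarrow> 0 \<le> - (real N *\<^sub>R l) + of_int (int N) *\<^sub>R d"
      using N scaleR_le_cancel_left_pos[of "real N" l d] by (simp add: algebra_simps)
    show "d \<le> l \<longleftrightarrow> 0 \<le> real N *\<^sub>R l + of_int (- int N) *\<^sub>R d"
      using N scaleR_le_cancel_left_pos[of "real N" d l] by (simp add: algebra_simps)
  qed
qed

text \<open>The generator x is placed as the limit of D: \<open>a + n x\<close> counts as
  nonnegative if \<open>a + n d\<close> is so for all late d in D. Since D has no maximum, two
  different late values exist, so \<open>a + n d = 0\<close> for all late d forces
  \<open>n = 0\<close>; this is antisymmetry. For empty D the generator lies below everything, and
  the sign is opposite to that of n.\<close>

lemma realize_cut: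
  fixes D :: "'r set"
  assumes emb: "embeds_small_extensions \<Gamma>" and nomax: "\<And>d. d \<in> D \<Longrightarrow> \<exists>d'\<in>D. d < d'"
  shows "\<exists>x. \<forall>l\<in>\<Lambda>. (l \<le> x \<longleftrightarrow> (\<exists>d\<in>D. l \<le> d)) \<and> (x \<le> l \<longleftrightarrow> (\<forall>d\<in>D. d \<le> l))"
proof -
  define pos where "pos a n \<longleftrightarrow> (if D = {} then n < 0 \<or> (n = 0 \<and> 0 \<le> a)
    else \<exists>d0\<in>D. \<forall>d\<in>D. d0 \<le> d \<longrightarrow> 0 \<le> a + of_int n *\<^sub>R d)" for a :: 'r and n :: int
  have "\<exists>x. \<forall>a\<in>\<Gamma>. \<forall>n. 0 \<le> a + of_int n *\<^sub>R x \<longleftrightarrow> pos a n"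
  proof (rule realize_order[OF emb])
    fix a b :: 'r and n m :: int
    assume p: "pos a n" "pos b m"
    show "pos (a + b) (n + m)"
    proof (cases "D = {}")
      case True
      then show ?thesis using p by (auto simp: pos_def)
    next
      case False
      obtain d0 d1 where d: "d0 \<in> D" "\<forall>d\<in>D. d0 \<le> d \<longrightarrow> 0 \<le> a + of_int n *\<^sub>R d"
        "d1 \<in> D" "\<forall>d\<in>D. d1 \<le> d \<longrightarrow> 0 \<le> b + of_int m *\<^sub>R d" using p False by (auto simp: pos_def)
      have "max d0 d1 \<in> D" using d by (simp add: max_def)
      moreover have "0 \<le> (a + b) + of_int (n + m) *\<^sub>R d" if "d \<in> D" "max d0 d1 \<le> d" for d
      proof -
        have "0 \<le> (a + of_int n *\<^sub>R d) + (b + of_int m *\<^sub>R d)" 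
            using d(2,4) that by (metis add_nonneg_nonneg max.bounded_iff)
        then show ?thesis by (simp add: scaleR_add_left algebra_simps)
      qed
      ultimately have "\<exists>d0\<in>D. \<forall>d\<in>D. d0 \<le> d \<longrightarrow> 0 \<le> (a + b) + of_int (n + m) *\<^sub>R d"
        by blast
      then show ?thesis using False by (simp add: pos_def)
    qed
  next
    fix a show "pos a 0 \<longleftrightarrow> 0 \<le> a" by (auto simp: pos_def)
  next
    fix a :: 'r and n :: int
    show "pos a n \<or> pos (- a) (- n)"
    proof (cases "D = {}")
      case True
      then show ?thesis by (auto simp: pos_def)
    next
      case False
      have mono: "0 \<le> b + of_int m *\<^sub>R d'" if "0 \<le> b + of_int m *\<^sub>R d" "d \<le> d'" "0 \<le> m" for b d d' :: 'r and m :: int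
        using that scaleR_left_mono[of d d' "of_int m"] by (meson add_left_mono of_int_0_le_iff order_trans)
      have main: "pos b m \<or> pos (- b) (- m)" if "0 \<le> m" for b :: 'r and m :: int
      proof (cases "\<exists>d0\<in>D. 0 \<le> b + of_int m *\<^sub>R d0")
        case True
        then have "\<exists>d0\<in>D. \<forall>d\<in>D. d0 \<le> d \<longrightarrow> 0 \<le> b + of_int m *\<^sub>R d"
          using mono that by blast
        then show ?thesis using False by (simp add: pos_def)
      next
        case neg: False
        have "0 \<le> - b + of_int (- m) *\<^sub>R d" if "d \<in> D" for d
        proof -
          have "b + of_int m *\<^sub>R d \<le> 0" using neg that by auto
          then have "0 \<le> - (b + of_int m *\<^sub>R d)" by (simp only: neg_0_le_iff_le)
          then show ?thesis by simp
        qed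
        then show ?thesis using False unfolding pos_def by auto
      qed
      show ?thesis using main[of n a] main[of "- n" "- a"] by (cases "0 \<le> n") auto
    qed
    show "a = 0 \<and> n = 0" if p: "pos a n" "pos (- a) (- n)"
    proof (cases "D = {}")
      case True
      then show ?thesis using p by (auto simp: pos_def)
    next
      case False
      obtain d0 d1 where d: "d0 \<in> D" "\<forall>d\<in>D. d0 \<le> d \<longrightarrow> 0 \<le> a + of_int n *\<^sub>R d"
        "d1 \<in> D" "\<forall>d\<in>D. d1 \<le> d \<longrightarrow> 0 \<le> - a + of_int (- n) *\<^sub>R d" using p False by (auto simp: pos_def)
      have z: "a + of_int n *\<^sub>R d = 0" if "d \<in> D" "max d0 d1 \<le> d" for d
      proof (rule antisym)
        show "0 \<le> a + of_int n *\<^sub>R d" using d that by auto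
        have "0 \<le> - a + of_int (- n) *\<^sub>R d" using d that by auto
        then have "0 \<le> - (a + of_int n *\<^sub>R d)" by simp
        then show "a + of_int n *\<^sub>R d \<le> 0" by (simp only: neg_0_le_iff_le)
      qed
      have m: "max d0 d1 \<in> D" using d by (simp add: max_def)
      then obtain d' where d': "d' \<in> D" "max d0 d1 < d'" using nomax by blast
      have "of_int n *\<^sub>R (d' - max d0 d1) = (a + of_int n *\<^sub>R d') - (a + of_int n *\<^sub>R max d0 d1)"
        by (simp add: scaleR_diff_right)
      also have "\<dots> = 0" using z[OF m] z[OF d'(1) less_imp_le[OF d'(2)]] by simp
      finally have "n = 0" using less_imp_neq[OF d'(2)] by auto
      then show ?thesis using z[OF m] by simp
    qed
  qed
  then obtain x where x: "\<And>a n. a \<in> \<Gamma> \<Longrightarrow> 0 \<le> a + of_int n *\<^sub>R x \<longleftrightarrow> pos a n" by blast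
  have "(l \<le> x \<longleftrightarrow> (\<exists>d\<in>D. l \<le> d)) \<and> (x \<le> l \<longleftrightarrow> (\<forall>d\<in>D. d \<le> l))" if l: "l \<in> \<Lambda>" for l
  proof -
    obtain N where N: "N > 0" "real N *\<^sub>R l \<in> \<Gamma>"
      and le: "\<And>d. l \<le> d \<longleftrightarrow> 0 \<le> - (real N *\<^sub>R l) + of_int (int N) *\<^sub>R d"
      and ge: "\<And>d. d \<le> l \<longleftrightarrow> 0 \<le> real N *\<^sub>R l + of_int (- int N) *\<^sub>R d"
      by (rule div_hull_scaled[OF l]) blast
    have "l \<le> x \<longleftrightarrow> pos (- (real N *\<^sub>R l)) (int N)" unfolding le by (rule x[OF \<Gamma>_minus[OF N(2)]])
    also have "\<dots> \<longleftrightarrow> (\<exists>d\<in>D. l \<le> d)"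
      using N(1) unfolding pos_def le[symmetric] by (auto intro: order_trans)
    finally have 1: "l \<le> x \<longleftrightarrow> (\<exists>d\<in>D. l \<le> d)" .
    have "x \<le> l \<longleftrightarrow> pos (real N *\<^sub>R l) (- int N)" unfolding ge by (rule x[OF N(2)])
    also have "\<dots> \<longleftrightarrow> (\<forall>d\<in>D. d \<le> l)"
    proof (cases "D = {}")
      case True
      then show ?thesis using N(1) by (simp add: pos_def)
    next
      case False
      then have "pos (real N *\<^sub>R l) (- int N) \<longleftrightarrow> (\<exists>d0\<in>D. \<forall>d\<in>D. d0 \<le> d \<longrightarrow> d \<le> l)"
        unfolding pos_def ge[symmetric] by simp
      also have "\<dots> \<longleftrightarrow> (\<forall>d\<in>D. d \<le> l)" using False by (meson ex_in_conv linear order_trans)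
      finally show ?thesis .
    qed
    finally show ?thesis using 1 by simp
  qed
  then show ?thesis by blast
qed

text \<open>The supremum is the representative y of the element realizing the cut of D. In \<Lambda>
  it would be bounded by a member of D, which has no maximum. An upper bound z in \<open>S\<close>
  smaller than y would define the same cut in \<Lambda>, hence be equivalent to y, but
  \<open>S\<close> has one representative per class.\<close>

lemma sup_exists:
  fixes D S :: "'r set"
  assumes emb: "embeds_small_extensions \<Gamma>" and rep: "sme_representatives \<Gamma> S"
    and D: "D \<subseteq> \<Lambda>" and nomax: "\<And>d. d \<in> D \<Longrightarrow> \<exists>d'\<in>D. d < d'"
  shows "\<exists>y. y \<in> S \<and> y \<notin> \<Lambda> \<and> (\<forall>d\<in>D. d \<le> y) \<and> (\<forall>z\<in>S. (\<forall>d\<in>D. d \<le> z) \<longrightarrow> y \<le> z)"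
proof -
  obtain x where x: "\<And>l. l \<in> \<Lambda> \<Longrightarrow> l \<le> x \<longleftrightarrow> (\<exists>d\<in>D. l \<le> d)" "\<And>l. l \<in> \<Lambda> \<Longrightarrow> x \<le> l \<longleftrightarrow> (\<forall>d\<in>D. d \<le> l)"
    using realize_cut[OF emb nomax] by blast
  have equivI: "sme_equiv \<Gamma> x z"
    if z: "\<And>l. l \<in> \<Lambda> \<Longrightarrow> l \<le> z \<longleftrightarrow> l \<le> x" "\<And>l. l \<in> \<Lambda> \<Longrightarrow> z \<le> l \<longleftrightarrow> x \<le> l" for z
    unfolding sme_equiv_iff
  proof (intro ballI allI)
    fix a and n :: int assume a: "a \<in> \<Gamma>"
    consider "n = 0" | "n > 0" | "n < 0" by linarith
    then show "0 \<le> a + of_int n *\<^sub>R x \<longleftrightarrow> 0 \<le> a + of_int n *\<^sub>R z"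
      by cases (use cut_pos_iff[OF a, of n] z in simp_all)
  qed
  obtain y where y: "y \<in> S" "sme_equiv \<Gamma> x y" and uniq: "\<And>z. z \<in> S \<Longrightarrow> sme_equiv \<Gamma> x z \<Longrightarrow> z = y"
    using rep unfolding sme_representatives_def by metis
  have yx: "(l \<le> y \<longleftrightarrow> l \<le> x) \<and> (y \<le> l \<longleftrightarrow> x \<le> l)" if l: "l \<in> \<Lambda>" for l
  proof -
    obtain N where N: "N > 0" "real N *\<^sub>R l \<in> \<Gamma>"
      and le: "\<And>d. l \<le> d \<longleftrightarrow> 0 \<le> - (real N *\<^sub>R l) + of_int (int N) *\<^sub>R d"
      and ge: "\<And>d. d \<le> l \<longleftrightarrow> 0 \<le> real N *\<^sub>R l + of_int (- int N) *\<^sub>R d"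
      by (rule div_hull_scaled[OF l]) blast
    show ?thesis unfolding le ge using y(2) N(2) \<Gamma>_minus[OF N(2)] unfolding sme_equiv_iff by blast
  qed
  have "y \<notin> \<Lambda>"
  proof
    assume y\<Lambda>: "y \<in> \<Lambda>"
    then obtain d where d: "d \<in> D" "y \<le> d" using yx x(1) by blast
    obtain d' where "d' \<in> D" "d < d'" using nomax d by blast
    moreover have "\<forall>d\<in>D. d \<le> y" using yx[OF y\<Lambda>] x(2)[OF y\<Lambda>] by blast
    ultimately show False using d by fastforce
  qed
  moreover have "\<forall>d\<in>D. d \<le> y" using D yx x(1) by blast
  moreover have "y \<le> z" if z: "z \<in> S" "\<forall>d\<in>D. d \<le> z" for z
  proof (rule ccontr)
    assume "\<not> y \<le> z"
    then have zy: "z < y" by simp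
    have "sme_equiv \<Gamma> x z"
    proof (rule equivI)
      fix l assume l: "l \<in> \<Lambda>"
      show "l \<le> z \<longleftrightarrow> l \<le> x"
        using x(1)[OF l] yx[OF l] zy z(2) by (meson order_less_imp_le order_trans)
      show "z \<le> l \<longleftrightarrow> x \<le> l"
        using x(2)[OF l] yx[OF l] zy z(2) by (meson order_less_imp_le order_trans)
    qed
    then show False using uniq[OF z(1)] zy by simp
  qed
  ultimately show ?thesis using y(1) by blast
qed

lemma sup_in_cut:
  fixes D S :: "'r set"
  assumes emb: "embeds_small_extensions \<Gamma>" and rep: "sme_representatives \<Gamma> S"
    and D: "D \<subseteq> \<Lambda>" and nomax: "\<forall>d\<in>D. \<exists>d'\<in>D. d < d'"
  shows "sup_in S (Fin ` D) \<in> S" "sup_in S (Fin ` D) \<notin> \<Lambda>" "\<And>d. d \<in> D \<Longrightarrow> d \<le> sup_in S (Fin ` D)"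
    "\<And>z. z \<in> S \<Longrightarrow> (\<And>d. d \<in> D \<Longrightarrow> d \<le> z) \<Longrightarrow> sup_in S (Fin ` D) \<le> z"
proof -
  obtain y where y: "y \<in> S" "y \<notin> \<Lambda>" "\<forall>d\<in>D. d \<le> y" "\<forall>z\<in>S. (\<forall>d\<in>D. d \<le> z) \<longrightarrow> y \<le> z"
    using sup_exists[OF emb rep D] nomax by blast
  have "sup_in S (Fin ` D) = y"
    unfolding sup_in_def by (rule the_equality) (use y in \<open>auto intro: order_antisym\<close>)
  then show "sup_in S (Fin ` D) \<in> S" "sup_in S (Fin ` D) \<notin> \<Lambda>" "\<And>d. d \<in> D \<Longrightarrow> d \<le> sup_in S (Fin ` D)"
    "\<And>z. z \<in> S \<Longrightarrow> (\<And>d. d \<in> D \<Longrightarrow> d \<le> z) \<Longrightarrow> sup_in S (Fin ` D) \<le> z"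
    using y by auto
qed

text \<open>The least element of \<open>S\<close> is the supremum of the empty set, which has no
  maximum for trivial reasons; so it too avoids \<Lambda>.\<close>

lemma Least_cut:
  fixes S :: "'r set"
  assumes emb: "embeds_small_extensions \<Gamma>" and rep: "sme_representatives \<Gamma> S"
  shows "(LEAST x. x \<in> S) \<in> S" "(LEAST x. x \<in> S) \<notin> \<Lambda>" "\<And>z. z \<in> S \<Longrightarrow> (LEAST x. x \<in> S) \<le> z"
proof -
  obtain y where y: "y \<in> S" "y \<notin> \<Lambda>" "\<forall>z\<in>S. y \<le> z"
    using sup_exists[OF assms, of "{}"] by auto
  have "(LEAST x. x \<in> S) = y" by (rule Least_equality) (use y in auto)
  then show "(LEAST x. x \<in> S) \<in> S" "(LEAST x. x \<in> S) \<notin> \<Lambda>" "\<And>z. z \<in> S \<Longrightarrow> (LEAST x. x \<in> S) \<le> z"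
    using y by auto
qed

end

section \<open>Limit augmentations\<close>

locale valuation_chain = base_valuation v
  for v :: "'k::field \<Rightarrow> 'r::{linordered_ab_group_add,ordered_real_vector} vext" +
  fixes \<A> :: "('k poly \<Rightarrow> 'r vext) set"
  assumes in_T: "\<A> \<subseteq> T" and ne: "\<A> \<noteq> {}"
    and total: "\<And>\<rho> \<sigma>. \<rho> \<in> \<A> \<Longrightarrow> \<sigma> \<in> \<A> \<Longrightarrow> \<rho> \<le> \<sigma> \<or> \<sigma> \<le> \<rho>"
    and no_max: "\<And>\<rho>. \<rho> \<in> \<A> \<Longrightarrow> \<exists>\<sigma>\<in>\<A>. \<rho> < \<sigma>"
begin

definition ev :: "(('k poly \<Rightarrow> 'r vext) \<Rightarrow> bool) \<Rightarrow> bool" where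
  "ev P \<longleftrightarrow> (\<exists>\<rho>\<in>\<A>. \<forall>\<sigma>\<in>\<A>. \<rho> \<le> \<sigma> \<longrightarrow> P \<sigma>)"

lemma ev_conj:
  assumes "ev P" "ev Q"
  shows "ev (\<lambda>\<sigma>. P \<sigma> \<and> Q \<sigma>)"
proof -
  obtain \<rho> \<rho>' where *: "\<rho> \<in> \<A>" "\<forall>\<sigma>\<in>\<A>. \<rho> \<le> \<sigma> \<longrightarrow> P \<sigma>" "\<rho>' \<in> \<A>" "\<forall>\<sigma>\<in>\<A>. \<rho>' \<le> \<sigma> \<longrightarrow> Q \<sigma>"
    using assms by (auto simp: ev_def)
  then show ?thesis using total[OF *(1,3)] unfolding ev_def by (meson order_trans)
qed

lemma ev_ge: "\<rho> \<in> \<A> \<Longrightarrow> ev (\<lambda>\<sigma>. \<rho> \<le> \<sigma>)"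
  by (auto simp: ev_def)

lemma ev_mono: "ev P \<Longrightarrow> (\<And>\<sigma>. \<sigma> \<in> \<A> \<Longrightarrow> P \<sigma> \<Longrightarrow> Q \<sigma>) \<Longrightarrow> ev Q"
  unfolding ev_def by blast

lemma ev_ex: "ev P \<Longrightarrow> \<exists>\<sigma>\<in>\<A>. P \<sigma> \<and> (\<forall>\<tau>\<in>\<A>. \<sigma> \<le> \<tau> \<longrightarrow> P \<tau>)"
  unfolding ev_def by blast

lemma ev_value_unique: "ev (\<lambda>\<sigma>. \<sigma> f = c) \<Longrightarrow> ev (\<lambda>\<sigma>. \<sigma> f = d) \<Longrightarrow> c = d"
  using ev_ex[OF ev_conj] by blast

lemma stable_iff_ev: "stable \<A> f \<longleftrightarrow> (\<exists>c. ev (\<lambda>\<sigma>. \<sigma> f = c))"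
proof
  assume "stable \<A> f"
  then obtain \<rho> where \<rho>: "\<rho> \<in> \<A>" "\<And>\<sigma>. \<sigma> \<in> \<A> \<Longrightarrow> \<rho> < \<sigma> \<Longrightarrow> \<rho> f = \<sigma> f" by (auto simp: stable_def)
  then have "\<forall>\<sigma>\<in>\<A>. \<rho> \<le> \<sigma> \<longrightarrow> \<sigma> f = \<rho> f" by (metis order_le_less)
  then show "\<exists>c. ev (\<lambda>\<sigma>. \<sigma> f = c)" using \<rho>(1) unfolding ev_def by blast
next
  assume "\<exists>c. ev (\<lambda>\<sigma>. \<sigma> f = c)"
  then show "stable \<A> f" unfolding ev_def stable_def by (metis order_less_imp_le order_refl)
qed

lemma stable_value_eqI:
  assumes "ev (\<lambda>\<sigma>. \<sigma> f = c)"
  shows "stable_value \<A> f = c"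
  unfolding stable_value_def
proof (rule the_equality)
  show "\<exists>\<rho>\<in>\<A>. \<rho> f = c \<and> (\<forall>\<sigma>\<in>\<A>. \<rho> < \<sigma> \<longrightarrow> \<sigma> f = c)"
    using assms unfolding ev_def by (metis order_less_imp_le order_refl)
  fix d assume "\<exists>\<rho>\<in>\<A>. \<rho> f = d \<and> (\<forall>\<sigma>\<in>\<A>. \<rho> < \<sigma> \<longrightarrow> \<sigma> f = d)"
  then have "ev (\<lambda>\<sigma>. \<sigma> f = d)" unfolding ev_def by (metis order_le_less)
  then show "d = c" using assms ev_value_unique by blast
qed

lemma ev_stable_value: "stable \<A> f \<Longrightarrow> ev (\<lambda>\<sigma>. \<sigma> f = stable_value \<A> f)"
  using stable_iff_ev stable_value_eqI by metis

lemma stableI: "(\<And>\<sigma>. \<sigma> \<in> \<A> \<Longrightarrow> \<sigma> f = c) \<Longrightarrow> stable \<A> f" and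
  stable_valueI: "(\<And>\<sigma>. \<sigma> \<in> \<A> \<Longrightarrow> \<sigma> f = c) \<Longrightarrow> stable_value \<A> f = c"
proof -
  have "ev (\<lambda>\<sigma>. \<sigma> f = c)" if "\<And>\<sigma>. \<sigma> \<in> \<A> \<Longrightarrow> \<sigma> f = c"
    using that ne unfolding ev_def by blast
  then show "(\<And>\<sigma>. \<sigma> \<in> \<A> \<Longrightarrow> \<sigma> f = c) \<Longrightarrow> stable \<A> f"
    "(\<And>\<sigma>. \<sigma> \<in> \<A> \<Longrightarrow> \<sigma> f = c) \<Longrightarrow> stable_value \<A> f = c"
    using stable_iff_ev stable_value_eqI by blast+
qed

lemma chain_T: "\<sigma> \<in> \<A> \<Longrightarrow> \<sigma> \<in> T"
  using in_T by blast

lemma chain_val: "\<sigma> \<in> \<A> \<Longrightarrow> is_valuation \<sigma>"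
  using in_T T_val by blast

lemma chain_finite: "\<sigma> \<in> \<A> \<Longrightarrow> f \<noteq> 0 \<Longrightarrow> \<sigma> f \<noteq> Infty"
  using no_max less_finite chain_T by metis

lemma stable_finite: "stable \<A> f \<Longrightarrow> f \<noteq> 0 \<Longrightarrow> stable_value \<A> f \<noteq> Infty"
  using ev_ex[OF ev_stable_value] chain_finite by metis

lemma stable_smult:
  assumes "stable \<A> f"
  shows "stable \<A> (smult c f)"
proof -
  have "ev (\<lambda>\<sigma>. \<sigma> (smult c f) = v c + stable_value \<A> f)"
    using ev_stable_value[OF assms] by (rule ev_mono) (simp add: T_smult chain_T)
  then show ?thesis using stable_iff_ev by blast
qed

lemma stable_const: "stable \<A> [:a:]" "stable_value \<A> [:a:] = v a"
  by (auto intro!: stableI[of _ "v a"] stable_valueI simp: T_const chain_T)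

lemma KP_inf_D:
  assumes "\<phi> \<in> KP_inf \<A>"
  shows "lead_coeff \<phi> = 1" "\<not> stable \<A> \<phi>" "degree f < degree \<phi> \<Longrightarrow> stable \<A> f" "0 < degree \<phi>"
proof -
  show 1: "lead_coeff \<phi> = 1" "\<not> stable \<A> \<phi>" using assms by (auto simp: KP_inf_def)
  show "stable \<A> f" if "degree f < degree \<phi>"
  proof (cases "f = 0")
    case True
    then show ?thesis using stable_const[of 0] by simp
  next
    case False
    then obtain g where g: "lead_coeff g = 1" "degree g = degree f" "f = smult (lead_coeff f) g"
      by (rule monic_multiple)
    have "stable \<A> g"
    proof (rule ccontr)
      assume "\<not> stable \<A> g"
      then have "degree \<phi> \<le> degree g" using assms g(1) by (simp add: KP_inf_def)
      then show False using that g(2) by simp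
    qed
    then show ?thesis by (subst g(3)) (rule stable_smult)
  qed
  show "0 < degree \<phi>"
  proof (rule ccontr)
    assume "\<not> 0 < degree \<phi>"
    then obtain c where "\<phi> = [:c:]" by (metis degree_eq_zeroE gr0I)
    then show False using 1(2) stable_const by simp
  qed
qed

lemma unstable_increases:
  assumes "\<not> stable \<A> f" "\<rho> \<in> \<A>"
  obtains \<sigma> where "\<sigma> \<in> \<A>" "\<rho> < \<sigma>" "\<rho> f < \<sigma> f"
proof -
  obtain \<sigma> where "\<sigma> \<in> \<A>" "\<rho> < \<sigma>" "\<rho> f \<noteq> \<sigma> f" using assms by (auto simp: stable_def)
  then show thesis using that le_funD[of \<rho> \<sigma> f] by (metis order_le_less order_less_imp_le)
qed

lemma unstable_values:
  assumes u: "\<not> stable \<A> f"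
  shows "f \<noteq> 0" and "(\<lambda>\<rho>. \<rho> f) ` \<A> = Fin ` {x. \<exists>\<rho>\<in>\<A>. \<rho> f = Fin x}"
    and "d \<in> {x. \<exists>\<rho>\<in>\<A>. \<rho> f = Fin x} \<Longrightarrow> \<exists>d'\<in>{x. \<exists>\<rho>\<in>\<A>. \<rho> f = Fin x}. d < d'"
proof -
  show f0: "f \<noteq> 0" using u stable_const[of 0] by auto
  have fin: "\<exists>x. \<rho> f = Fin x" if "\<rho> \<in> \<A>" for \<rho>
    using chain_finite[OF that f0] by (cases "\<rho> f") auto
  then show "(\<lambda>\<rho>. \<rho> f) ` \<A> = Fin ` {x. \<exists>\<rho>\<in>\<A>. \<rho> f = Fin x}"
    by (intro equalityI subsetI; clarsimp simp: image_iff; metis)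
  assume "d \<in> {x. \<exists>\<rho>\<in>\<A>. \<rho> f = Fin x}"
  then obtain \<rho> where \<rho>: "\<rho> \<in> \<A>" "\<rho> f = Fin d" by blast
  obtain \<sigma> where "\<sigma> \<in> \<A>" "\<rho> f < \<sigma> f" using unstable_increases[OF u \<rho>(1)] by metis
  then show "\<exists>d'\<in>{x. \<exists>\<rho>\<in>\<A>. \<rho> f = Fin x}. d < d'"
    using fin[of \<sigma>] \<rho>(2) by auto
qed

context
  fixes \<phi> :: "'k poly" and \<gamma> :: "'r vext"
  assumes \<phi>: "\<phi> \<in> KP_inf \<A>" and bound: "\<forall>\<rho>\<in>\<A>. \<rho> \<phi> \<le> \<gamma>"
begin

text \<open>Write \<open>a * b = e * \<phi> + c\<close> and go far enough along the chain that a, b,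
  c and e have their stable values. If c and \<open>a * b\<close> had different values, the value of
  \<open>e * \<phi>\<close> would be their constant minimum; but it keeps increasing with that of
  \<phi> unless \<open>e = 0\<close>. This replaces the primality argument of ordinary
  augmentations.\<close>

lemma stable_value_low_mult:
  assumes a: "degree a < degree \<phi>" and b: "degree b < degree \<phi>"
  shows "stable_value \<A> (a * b mod \<phi>) = stable_value \<A> a + stable_value \<A> b"
    "stable_value \<A> a + stable_value \<A> b \<le> stable_value \<A> (a * b div \<phi>) + \<gamma>"
proof -
  let ?w = "stable_value \<A>"
  define c e where "c = a * b mod \<phi>" and "e = a * b div \<phi>"
  have ab: "a * b = e * \<phi> + c" by (simp add: c_def e_def)
  have c: "degree c < degree \<phi>" unfolding c_def by (rule degree_mod_lt[OF KP_inf_D(4)[OF \<phi>]])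
  have e: "degree e < degree \<phi>" unfolding e_def by (rule degree_mult_div_less[OF a b])
  have st: "stable \<A> f" if "degree f < degree \<phi>" for f by (rule KP_inf_D(3)[OF \<phi> that])
  have "ev (\<lambda>\<sigma>. ((\<sigma> a = ?w a \<and> \<sigma> b = ?w b) \<and> \<sigma> c = ?w c) \<and> \<sigma> e = ?w e)"
    by (intro ev_conj ev_stable_value st a b c e)
  then obtain \<sigma> where \<sigma>: "\<sigma> \<in> \<A>" and s: "\<And>\<tau>. \<tau> \<in> \<A> \<Longrightarrow> \<sigma> \<le> \<tau> \<Longrightarrow> \<tau> a = ?w a \<and> \<tau> b = ?w b \<and> \<tau> c = ?w c \<and> \<tau> e = ?w e"
    using ev_ex by blast
  have eq: "?w c = ?w a + ?w b"
  proof (cases "e = 0")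
    case True
    then show ?thesis using ab s[OF \<sigma>] val_mult[OF chain_val[OF \<sigma>], of a b] by auto
  next
    case False
    obtain \<tau> where \<tau>: "\<tau> \<in> \<A>" "\<sigma> < \<tau>" "\<sigma> \<phi> < \<tau> \<phi>"
      by (rule unstable_increases[OF KP_inf_D(2)[OF \<phi>] \<sigma>])
    have "?w e \<noteq> Infty" by (rule stable_finite[OF st[OF e] False])
    then have "\<sigma> (e * \<phi>) < \<tau> (e * \<phi>)"
      using s[OF \<sigma>] s[OF \<tau>(1)] \<tau>(2) vext_add_less_mono(1)[OF \<tau>(3), of "?w e"]
      by (simp add: val_mult[OF chain_val[OF \<sigma>]] val_mult[OF chain_val[OF \<tau>(1)]])
    moreover have "\<rho> (e * \<phi>) = min (?w a + ?w b) (?w c)"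
      if \<rho>: "\<rho> \<in> \<A>" "\<sigma> \<le> \<rho>" and ne: "?w c \<noteq> ?w a + ?w b" for \<rho>
    proof -
      have "e * \<phi> = a * b + - c" using ab by simp
      then show ?thesis
        using val_add_neq[OF chain_val[OF \<rho>(1)], of "a * b" "- c"] s[OF \<rho>] ne
        by (simp add: val_minus[OF chain_val[OF \<rho>(1)]] val_mult[OF chain_val[OF \<rho>(1)]])
    qed
    ultimately show ?thesis using \<sigma> \<tau>(1,2) by (metis less_irrefl order_less_imp_le order_refl)
  qed
  then show "?w (a * b mod \<phi>) = ?w a + ?w b" by (simp add: c_def)
  have "e * \<phi> = a * b - c" using ab by simp
  then have "?w a + ?w b \<le> \<sigma> (e * \<phi>)"
    using val_le_diff[OF chain_val[OF \<sigma>], of "?w a + ?w b" "a * b" c] s[OF \<sigma>] eq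
    by (simp add: val_mult[OF chain_val[OF \<sigma>]])
  also have "\<dots> \<le> ?w e + \<gamma>"
    using s[OF \<sigma>] add_left_mono[OF bspec[OF bound \<sigma>], of "?w e"] by (simp add: val_mult[OF chain_val[OF \<sigma>]])
  finally show "?w a + ?w b \<le> ?w (a * b div \<phi>) + \<gamma>" by (simp add: e_def)
qed

lemma stable_value_0: "stable_value \<A> 0 = Infty"
  using stable_const(2)[of 0] by (simp add: val_0[OF v])

lemma lim_aug_low: "degree r < degree \<phi> \<Longrightarrow> lim_aug \<A> \<phi> \<gamma> r = stable_value \<A> r"
  unfolding lim_aug_def by (rule expansion_min_low[where w="stable_value \<A>", OF stable_value_0 KP_inf_D(4)[OF \<phi>]])

lemma lim_aug_const: "lim_aug \<A> \<phi> \<gamma> [:a:] = v a"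
  using lim_aug_low[of "[:a:]"] KP_inf_D(4)[OF \<phi>] stable_const by simp

lemma lim_aug_expansion: "expansion_valuation \<phi> (lim_aug \<A> \<phi> \<gamma>) \<gamma>"
  unfolding lim_aug_def
proof (rule expansion_min_valuation[OF KP_inf_D(4)[OF \<phi>] stable_value_0 _ _ stable_value_low_mult])
  let ?w = "stable_value \<A>"
  show "?w 1 = Fin 0" using stable_const(2)[of 1] by (simp add: val_1[OF v] pCons_one)
  fix a b :: "'k poly" assume a: "degree a < degree \<phi>" and b: "degree b < degree \<phi>"
  have "ev (\<lambda>\<sigma>. (\<sigma> a = ?w a \<and> \<sigma> b = ?w b) \<and> \<sigma> (a + b) = ?w (a + b))"
    by (intro ev_conj ev_stable_value KP_inf_D(3)[OF \<phi>] a b degree_add_less)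
  then obtain \<sigma> where "\<sigma> \<in> \<A>" "\<sigma> a = ?w a" "\<sigma> b = ?w b" "\<sigma> (a + b) = ?w (a + b)"
    using ev_ex by blast
  then show "min (?w a) (?w b) \<le> ?w (a + b)" using val_add[OF chain_val, of \<sigma> a b] by simp
qed

lemma lim_aug_T: "lim_aug \<A> \<phi> \<gamma> \<in> T"
  by (rule expansion_in_T[OF lim_aug_expansion lim_aug_const])

lemma lim_aug_KP: "\<gamma> \<noteq> Infty \<Longrightarrow> \<phi> \<in> KP (lim_aug \<A> \<phi> \<gamma>)"
  by (rule expansion_KP[OF lim_aug_expansion lim_aug_const KP_inf_D(1)[OF \<phi>]])

text \<open>Suppose f has greater value at \<rho>, hence at every later \<tau>, than under the
  augmentation. If the minimum comes from \<open>q * \<phi>\<close> alone, then \<open>f - r\<close>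
  has greater value than the induction hypothesis allows. Otherwise it comes from r, and
  \<open>q * \<phi>\<close> must cancel r at every late \<tau>; its value would be constant, while
  that of \<phi> increases.\<close>

lemma lim_aug_ge:
  assumes "\<rho> \<in> \<A>"
  shows "\<rho> \<le> lim_aug \<A> \<phi> \<gamma>"
proof (rule le_funI)
  let ?E = "lim_aug \<A> \<phi> \<gamma>" and ?w = "stable_value \<A>"
  interpret expansion_valuation \<phi> ?E \<gamma> by (rule lim_aug_expansion)
  fix f
  have "\<forall>\<rho>\<in>\<A>. \<rho> f \<le> ?E f"
  proof (induction f rule: expansion_induct)
    case zero
    then show ?case by (simp add: E_0)
  next
    case (step q r)
    let ?f = "q * \<phi> + r"
    show ?case
    proof
      fix \<rho> assume \<rho>: "\<rho> \<in> \<A>"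
      show "\<rho> ?f \<le> ?E ?f"
      proof (rule ccontr)
        assume "\<not> \<rho> ?f \<le> ?E ?f"
        then have less: "?E ?f < \<rho> ?f" by simp
        have "ev (\<lambda>\<sigma>. \<sigma> r = ?w r \<and> \<rho> \<le> \<sigma>)"
          by (intro ev_conj ev_stable_value KP_inf_D(3)[OF \<phi> step(1)] ev_ge[OF \<rho>])
        then obtain \<sigma> where \<sigma>: "\<sigma> \<in> \<A>" and s: "\<And>\<tau>. \<tau> \<in> \<A> \<Longrightarrow> \<sigma> \<le> \<tau> \<Longrightarrow> \<tau> r = ?E r \<and> \<rho> \<le> \<tau>"
          using ev_ex[of "\<lambda>\<sigma>. \<sigma> r = ?w r \<and> \<rho> \<le> \<sigma>"] unfolding lim_aug_low[OF step(1)] by blast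
        have less': "?E ?f < \<tau> ?f" if "\<tau> \<in> \<A>" "\<sigma> \<le> \<tau>" for \<tau>
          using less s[OF that] le_funD[of \<rho> \<tau> ?f] by auto
        have q\<phi>: "\<tau> (q * \<phi>) \<le> ?E q + \<gamma>" if "\<tau> \<in> \<A>" for \<tau>
          using step(2) bspec[OF bound that] that by (auto simp: val_mult[OF chain_val] intro: add_mono)
        show False
        proof (cases "?E q + \<gamma> < ?E r")
          case True
          then have "?E ?f = ?E q + \<gamma>" using rec[OF step(1), of q] by simp
          then have "?E q + \<gamma> < \<sigma> (?f - r)"
            using less'[OF \<sigma> order_refl] s[OF \<sigma> order_refl] True
            by (intro val_less_diff[OF chain_val[OF \<sigma>]]) auto
          then show False using q\<phi>[OF \<sigma>] by simp
        next
          case False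
          then have E: "?E ?f = ?E r" using rec[OF step(1), of q] by simp
          have eq: "\<tau> (q * \<phi>) = ?E r" if \<tau>: "\<tau> \<in> \<A>" "\<sigma> \<le> \<tau>" for \<tau>
            using val_add_eq'[OF chain_val[OF \<tau>(1)], of "- r" ?f] less'[OF \<tau>] E s[OF \<tau>]
            by (simp add: val_minus[OF chain_val[OF \<tau>(1)]])
          obtain \<tau> where \<tau>: "\<tau> \<in> \<A>" "\<sigma> < \<tau>" "\<sigma> \<phi> < \<tau> \<phi>"
            by (rule unstable_increases[OF KP_inf_D(2)[OF \<phi>] \<sigma>])
          have "?E r \<noteq> Infty" using less E by auto
          then have "\<sigma> q \<noteq> Infty" using eq[OF \<sigma>] by (auto simp: val_mult[OF chain_val[OF \<sigma>]])
          then have "\<sigma> (q * \<phi>) < \<tau> (q * \<phi>)"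
            using vext_add_le_less_mono(1)[OF _ \<tau>(3), of "\<sigma> q" "\<tau> q"] \<tau>(2)
            by (simp add: val_mult[OF chain_val[OF \<sigma>]] val_mult[OF chain_val[OF \<tau>(1)]] le_funD less_imp_le)
          then show False using eq[OF \<sigma>] eq[OF \<tau>(1)] \<tau>(2) by simp
        qed
      qed
    qed
  qed
  then show "\<rho> f \<le> ?E f" using assms by blast
qed

end

lemma stable_value_range:
  assumes sub: "\<A> \<subseteq> tree v L" and "stable \<A> f"
  shows "stable_value \<A> f \<in> insert Infty (Fin ` L)"
proof -
  obtain \<sigma> where "\<sigma> \<in> \<A>" "\<sigma> f = stable_value \<A> f" using ev_ex[OF ev_stable_value[OF assms(2)]] by blast
  moreover have "range \<sigma> \<subseteq> insert Infty (Fin ` L)" using sub \<open>\<sigma> \<in> \<A>\<close> by (auto simp: tree_def)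
  ultimately show ?thesis by (metis rangeI subsetD)
qed

end

section \<open>Nodes with incommensurable singular value\<close>

text \<open>Common form of the root and of all limit-primitive nodes: digits take values in
  \<Lambda>, and \<gamma> is torsion-free modulo \<Lambda>, so different terms of an expansion have
  different values.\<close>

locale incommensurable_node = base_valuation v + expansion_valuation \<phi>\<^sub>0 \<mu> "Fin \<gamma>"
  for v :: "'k::field \<Rightarrow> 'r::{linordered_ab_group_add,ordered_real_vector} vext"
    and \<phi>\<^sub>0 :: "'k poly" and \<mu> :: "'k poly \<Rightarrow> 'r vext" and \<gamma> :: 'r +
  assumes const: "\<mu> [:a:] = v a" and monic: "lead_coeff \<phi>\<^sub>0 = 1"
    and low_range: "degree r < degree \<phi>\<^sub>0 \<Longrightarrow> \<mu> r \<in> insert Infty (Fin ` div_hull (value_group v))"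
    and low_finite: "degree r < degree \<phi>\<^sub>0 \<Longrightarrow> r \<noteq> 0 \<Longrightarrow> \<mu> r \<noteq> Infty"
    and incomm: "\<gamma> \<notin> div_hull (value_group v)"
begin

lemma node_T: "\<mu> \<in> T"
  by (rule expansion_in_T[OF expansion_valuation_axioms const])

lemma node_KP: "\<phi>\<^sub>0 \<in> KP \<mu>"
  by (rule expansion_KP[OF expansion_valuation_axioms const monic]) simp

lemma scaled_notin: "real (Suc n) *\<^sub>R \<gamma> \<notin> \<Lambda>"
  using incomm \<Lambda>_divide[of "Suc n" \<gamma>] by blast

text \<open>Nonzero terms with different exponents s have values in different classes
  \<open>s \<gamma> + \<Lambda>\<close>. The minimum is therefore attained once, and every initial
  form is that of a monomial.\<close>

lemma initial_monomial:
  assumes "f \<noteq> 0"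
  shows "\<exists>a s. a \<noteq> 0 \<and> degree a < degree \<phi>\<^sub>0 \<and> \<mu> f < \<mu> (f - a * \<phi>\<^sub>0 ^ s) \<and>
    (\<exists>l\<in>\<Lambda>. \<mu> f = Fin (l + real s *\<^sub>R \<gamma>))"
  using assms
proof (induction f rule: expansion_induct)
  case zero
  then show ?case by simp
next
  case (step q r)
  have r0: ?case if "q * \<phi>\<^sub>0 + r \<noteq> 0" "\<mu> r < \<mu> q + Fin \<gamma>"
  proof -
    have "\<mu> (q * \<phi>\<^sub>0 + r) = \<mu> r" using that rec[OF step(1), of q] by simp
    moreover have "r \<noteq> 0" using that E_0 by auto
    moreover from this obtain l where "l \<in> \<Lambda>" "\<mu> r = Fin l"
      using low_range[OF step(1)] low_finite[OF step(1)] by auto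
    ultimately show ?thesis using step(1) that
      by (intro exI[of _ r] exI[of _ 0]) (auto simp: E_phi_mult)
  qed
  show ?case
  proof (cases "q = 0")
    case True
    then have "r \<noteq> 0" using step(3) by simp
    then show ?thesis using r0 True step low_finite[OF step(1)] by (simp add: E_0 vext_less_Infty_iff)
  next
    case False
    then obtain a s l where a: "a \<noteq> 0" "degree a < degree \<phi>\<^sub>0" "\<mu> q < \<mu> (q - a * \<phi>\<^sub>0 ^ s)"
      "l \<in> \<Lambda>" "\<mu> q = Fin (l + real s *\<^sub>R \<gamma>)" using step(2) by blast
    have val: "\<mu> q + Fin \<gamma> = Fin (l + real (Suc s) *\<^sub>R \<gamma>)"
      by (simp add: a(5) scaleR_add_left algebra_simps)
    have ne: "\<mu> r \<noteq> \<mu> q + Fin \<gamma>"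
    proof
      assume eq: "\<mu> r = \<mu> q + Fin \<gamma>"
      then obtain l' where "l' \<in> \<Lambda>" "\<mu> r = Fin l'" using low_range[OF step(1)] val by auto
      then have "real (Suc s) *\<^sub>R \<gamma> = l' - l" using eq val by (simp add: algebra_simps)
      then show False using scaled_notin[of s] \<Lambda>_diff[OF \<open>l' \<in> \<Lambda>\<close> a(4)] by simp
    qed
    show ?thesis
    proof (cases "\<mu> r < \<mu> q + Fin \<gamma>")
      case True
      then show ?thesis using r0 step(3) by blast
    next
      case False
      then have less: "\<mu> q + Fin \<gamma> < \<mu> r" using ne by simp
      then have eq: "\<mu> (q * \<phi>\<^sub>0 + r) = \<mu> q + Fin \<gamma>" using rec[OF step(1), of q] by simp
      have diff: "q * \<phi>\<^sub>0 + r - a * \<phi>\<^sub>0 ^ Suc s = (q - a * \<phi>\<^sub>0 ^ s) * \<phi>\<^sub>0 + r"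
        by (simp add: algebra_simps)
      have "\<mu> (q * \<phi>\<^sub>0 + r) < \<mu> (q * \<phi>\<^sub>0 + r - a * \<phi>\<^sub>0 ^ Suc s)"
        unfolding eq diff using rec[OF step(1), of "q - a * \<phi>\<^sub>0 ^ s"] less vext_add_less_mono(2)[OF a(3), of "Fin \<gamma>"] by simp
      moreover have "\<mu> (q * \<phi>\<^sub>0 + r) = Fin (l + real (Suc s) *\<^sub>R \<gamma>)" unfolding eq by (rule val)
      ultimately show ?thesis using a(1,2,4)
        by (intro exI[of _ a] exI[of _ "Suc s"] conjI bexI[of _ l])
    qed
  qed
qed

lemma node_finite: "f \<noteq> 0 \<Longrightarrow> \<mu> f \<noteq> Infty"
  using initial_monomial[of f] by auto

text \<open>A key polynomial of smaller degree would express \<open>\<gamma>\<close> through values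
  in \<Lambda>. One of larger degree has the initial form of some
  \<open>a * \<phi>\<^sub>0 ^ s\<close> and would, by primality, divide a factor of smaller degree.
  In equal degree \<open>\<psi> = \<phi>\<^sub>0 + a\<close>, and
  \<open>\<mu> a < Fin \<gamma>\<close> would make \<psi> equivalent to the digit a.\<close>

lemma KP_node:
  assumes \<psi>: "\<psi> \<in> KP \<mu>"
  shows "degree \<psi> = degree \<phi>\<^sub>0" "\<mu> \<psi> = Fin \<gamma>"
proof -
  note pos\<psi> = KP_degree_pos[OF valuation \<psi>]
  have "\<not> degree \<psi> < degree \<phi>\<^sub>0"
  proof
    assume less: "degree \<psi> < degree \<phi>\<^sub>0"
    define q r where "q = \<phi>\<^sub>0 div \<psi>" and "r = \<phi>\<^sub>0 mod \<psi>"
    have r: "degree r < degree \<psi>" unfolding r_def by (rule degree_mod_lt[OF pos\<psi>])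
    have q: "degree q < degree \<phi>\<^sub>0" unfolding q_def by (rule degree_div_less[OF pos pos\<psi>])
    have "Fin \<gamma> = min (\<mu> r) (\<mu> q + \<mu> \<psi>)"
      using KP_expansion[OF valuation \<psi> r, of q] E_phi by (simp add: q_def r_def)
    moreover have "\<mu> r \<in> insert Infty (Fin ` \<Lambda>)" using r less by (intro low_range) simp
    moreover have "\<mu> q + \<mu> \<psi> \<in> insert Infty (Fin ` \<Lambda>)"
      using low_range[OF q] low_range[OF less] \<Lambda>_add by auto
    ultimately show False using incomm by (auto simp: min_def split: if_splits)
  qed
  moreover have "\<not> degree \<phi>\<^sub>0 < degree \<psi>"
  proof
    assume less: "degree \<phi>\<^sub>0 < degree \<psi>"
    obtain a s where a: "a \<noteq> 0" "degree a < degree \<phi>\<^sub>0" "\<mu> \<psi> < \<mu> (\<psi> - a * \<phi>\<^sub>0 ^ s)"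
      using initial_monomial[OF KP_nonzero[OF valuation \<psi>]] by blast
    have "\<mu> (a * \<phi>\<^sub>0 ^ s) = \<mu> \<psi>" by (rule val_eq_of_diff[OF valuation a(3)])
    then have "\<mu> (a * \<phi>\<^sub>0 ^ s) < \<mu> (a * \<phi>\<^sub>0 ^ s - 1 * \<psi>)"
      using a(3) val_diff_commute[OF valuation, of \<psi> "a * \<phi>\<^sub>0 ^ s"] by simp
    then have "hdiv \<mu> \<psi> (a * \<phi>\<^sub>0 ^ s)" unfolding hdiv_def by blast
    moreover have "\<not> hdiv \<mu> \<psi> a" using KP_D(4)[OF valuation \<psi> a(1)] a(2) less by simp
    moreover have "\<not> hdiv \<mu> \<psi> (\<phi>\<^sub>0 ^ t)" for t
    proof (induction t)
      case 0
      then show ?case using KP_D(3)[OF valuation \<psi>] by simp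
    next
      case (Suc t)
      have "\<phi>\<^sub>0 \<noteq> 0" using pos by auto
      then have "\<not> hdiv \<mu> \<psi> \<phi>\<^sub>0" using KP_D(4)[OF valuation \<psi> _ less] by blast
      then show ?case using Suc KP_D(5)[OF valuation \<psi>, of \<phi>\<^sub>0 "\<phi>\<^sub>0 ^ t"] by auto
    qed
    ultimately show False using KP_D(5)[OF valuation \<psi>] by blast
  qed
  ultimately show deg: "degree \<psi> = degree \<phi>\<^sub>0" by simp
  define a where "a = \<psi> - \<phi>\<^sub>0"
  have a: "degree a < degree \<phi>\<^sub>0"
    unfolding a_def using monic_diff_degree_less[OF KP_D(1)[OF valuation \<psi>] monic deg pos\<psi>] deg by simp
  have \<psi>_eq: "\<psi> = 1 * \<phi>\<^sub>0 + a" by (simp add: a_def)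
  have "\<mu> \<psi> = min (\<mu> a) (\<mu> 1 + Fin \<gamma>)" unfolding \<psi>_eq by (rule rec[OF a])
  then have "\<mu> \<psi> = min (\<mu> a) (Fin \<gamma>)" by (simp add: E_1)
  moreover have "\<not> \<mu> a < Fin \<gamma>"
  proof
    assume less: "\<mu> a < Fin \<gamma>"
    then have "a \<noteq> 0" using E_0 by auto
    moreover have "\<mu> (a - 1 * \<psi>) = Fin \<gamma>" using E_minus[of \<phi>\<^sub>0] E_phi by (simp add: a_def)
    then have "hdiv \<mu> \<psi> a" unfolding hdiv_def using less by metis
    ultimately show False using KP_D(4)[OF valuation \<psi>] a deg by simp
  qed
  ultimately show "\<mu> \<psi> = Fin \<gamma>" by simp
qed

lemma deg_val_node: "deg_val \<mu> = degree \<phi>\<^sub>0"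
  unfolding deg_val_def
proof (rule Least_equality)
  show "\<exists>\<phi>\<in>KP \<mu>. degree \<phi> = degree \<phi>\<^sub>0" using node_KP by blast
  show "degree \<phi>\<^sub>0 \<le> d" if "\<exists>\<phi>\<in>KP \<mu>. degree \<phi> = d" for d
    using that KP_node(1) by (metis order_refl)
qed

lemma sv_node: "sv \<mu> = Fin \<gamma>"
  unfolding sv_def deg_val_node
proof (rule the_equality)
  show "\<exists>\<phi>\<in>KP \<mu>. degree \<phi> = degree \<phi>\<^sub>0 \<and> Fin \<gamma> = \<mu> \<phi>" using node_KP E_phi by metis
  show "s = Fin \<gamma>" if "\<exists>\<phi>\<in>KP \<mu>. degree \<phi> = degree \<phi>\<^sub>0 \<and> s = \<mu> \<phi>" for s
    using that KP_node(2) by blast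
qed

lemma expansion_at_KP:
  assumes "\<psi> \<in> KP \<mu>" "degree r < degree \<psi>"
  shows "\<mu> (q * \<psi> + r) = min (\<mu> r) (\<mu> q + Fin \<gamma>)"
  using KP_expansion[OF valuation assms] KP_node(2)[OF assms(1)] by simp

end

section \<open>Primitive nodes and finite leaves\<close>

lemma (in expansion_valuation) E_finite:
  assumes "\<gamma> \<noteq> Infty" and low: "\<And>r. degree r < degree \<phi> \<Longrightarrow> r \<noteq> 0 \<Longrightarrow> E r \<noteq> Infty" and "f \<noteq> 0"
  shows "E f \<noteq> Infty"
proof -
  have "E f = Infty \<longrightarrow> f = 0"
  proof (induction f rule: expansion_induct)
    case (step q r)
    then show ?case using rec[OF step(1), of q] assms(1) low[OF step(1)]
      by (cases "r = 0") (auto simp: min_def split: if_splits)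
  qed simp
  then show ?thesis using assms(3) by blast
qed

lemma deg_val_attained:
  assumes "KP \<mu> \<noteq> {}"
  obtains \<phi> where "\<phi> \<in> KP \<mu>" "degree \<phi> = deg_val \<mu>"
proof -
  have "\<exists>d. \<exists>\<phi>\<in>KP \<mu>. degree \<phi> = d" using assms by blast
  then have "\<exists>\<phi>\<in>KP \<mu>. degree \<phi> = deg_val \<mu>" unfolding deg_val_def by (rule LeastI_ex)
  then show thesis using that by blast
qed

lemma deg_val_le: "\<phi> \<in> KP \<mu> \<Longrightarrow> deg_val \<mu> \<le> degree \<phi>"
  unfolding deg_val_def by (rule Least_le) blast

locale sme_tree = base_valuation v
  for v :: "'k::field \<Rightarrow> 'r::{linordered_ab_group_add,ordered_real_vector} vext" +
  fixes S :: "'r set"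
  assumes emb: "embeds_small_extensions (value_group v)"
    and rep: "sme_representatives (value_group v) S"
begin

abbreviation "TQ \<equiv> T_Q v"
abbreviation "leaves \<equiv> finite_leaves (T_Q v)"

lemma TQ_T: "\<mu> \<in> TQ \<Longrightarrow> \<mu> \<in> T"
  unfolding T_Q_def by (rule tree_T)

lemma TQ_range: "\<mu> \<in> TQ \<Longrightarrow> \<mu> f \<in> insert Infty (Fin ` \<Lambda>)"
  unfolding T_Q_def tree_def by blast

lemma TQ_I: "\<mu> \<in> T \<Longrightarrow> range \<mu> \<subseteq> insert Infty (Fin ` \<Lambda>) \<Longrightarrow> \<mu> \<in> TQ"
  unfolding T_Q_def tree_def by blast

lemma \<Lambda>_S: "x \<in> \<Lambda> \<Longrightarrow> x \<in> S"
  using rep unfolding sme_representatives_def by blast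

lemma const_range: "v a \<in> insert Infty (Fin ` \<Lambda>)"
proof (cases "v a")
  case (Fin x)
  then have "a \<noteq> 0" using v_eq_Infty[of a] by auto
  then have "x \<in> \<Gamma>" using Fin by (auto simp: value_group_def)
  then show ?thesis using Fin \<Gamma>_\<Lambda> by simp
qed simp

lemma root_incommensurable: "incommensurable_node v [:0, 1:] (root_node v S) (LEAST x. x \<in> S)"
proof -
  interpret expansion_valuation "[:0, 1:]" "root_node v S" "Fin (LEAST x. x \<in> S)"
    unfolding root_node_eq_gauss by (rule gauss_expansion)
  have const: "root_node v S [:a:] = v a" for a
    unfolding root_node_eq_gauss by (rule gauss_const)
  show ?thesis
  proof
    fix r :: "'k poly" assume "degree r < degree [:0, 1 :: 'k:]"
    then obtain a where a: "r = [:a:]" using degree_less_x by blast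
    show "root_node v S r \<in> insert Infty (Fin ` \<Lambda>)" unfolding a const by (rule const_range)
    show "root_node v S r \<noteq> Infty" if "r \<noteq> 0" using that unfolding a const by simp
  qed (auto simp: const Least_cut(2)[OF emb rep])
qed

lemma essential_chain: "essential_family v \<A> \<Longrightarrow> valuation_chain v \<A>"
  unfolding essential_family_def by unfold_locales (use tree_T in blast)+

lemma deg_inf_eq:
  fixes \<phi> :: "'k poly"
  assumes \<phi>: "\<phi> \<in> KP_inf \<A>"
  shows "deg_inf \<A> = enat (degree \<phi>)"
  unfolding deg_inf_def
proof (rule antisym[OF INF_lower[OF \<phi>]], rule INF_greatest)
  fix \<psi> assume "\<psi> \<in> KP_inf \<A>"
  then have "degree \<phi> \<le> degree \<psi>" using \<phi> by (simp add: KP_inf_def)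
  then show "enat (degree \<phi>) \<le> enat (degree \<psi>)" by simp
qed

text \<open>The values of an unstable polynomial along the chain lie in \<Lambda> and have no
  maximum, so their supremum in \<open>S\<close> is a new value; digits keep their stable values in
  \<Lambda>.\<close>

lemma lim_aug_incommensurable:
  assumes chain: "valuation_chain v \<A>" and sub: "\<A> \<subseteq> TQ" and \<phi>: "\<phi> \<in> KP_inf \<A>"
  defines "\<gamma> \<equiv> sup_in S ((\<lambda>\<rho>. \<rho> \<phi>) ` \<A>)"
  shows "\<gamma> \<in> S" "\<forall>\<rho>\<in>\<A>. \<rho> \<phi> \<le> Fin \<gamma>" "\<And>z. z \<in> S \<Longrightarrow> z < \<gamma> \<Longrightarrow> \<exists>\<rho>\<in>\<A>. Fin z < \<rho> \<phi>"
    "incommensurable_node v \<phi> (lim_aug \<A> \<phi> (Fin \<gamma>)) \<gamma>"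
proof -
  interpret valuation_chain v \<A> by (rule chain)
  define D where "D = {x. \<exists>\<rho>\<in>\<A>. \<rho> \<phi> = Fin x}"
  note u = KP_inf_D(2)[OF \<phi>]
  have im: "(\<lambda>\<rho>. \<rho> \<phi>) ` \<A> = Fin ` D" unfolding D_def by (rule unstable_values(2)[OF u])
  have nomax: "\<forall>d\<in>D. \<exists>d'\<in>D. d < d'" unfolding D_def using unstable_values(3)[OF u] by blast
  have D: "D \<subseteq> \<Lambda>"
  proof
    fix x assume "x \<in> D"
    then obtain \<rho> where "\<rho> \<in> TQ" "\<rho> \<phi> = Fin x" using sub by (auto simp: D_def)
    then show "x \<in> \<Lambda>" using TQ_range[of \<rho> \<phi>] by auto
  qed
  have \<gamma>: "\<gamma> = sup_in S (Fin ` D)" by (simp add: \<gamma>_def im)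
  note cut = sup_in_cut[OF emb rep D nomax, folded \<gamma>]
  show "\<gamma> \<in> S" by (rule cut)
  show le: "\<forall>\<rho>\<in>\<A>. \<rho> \<phi> \<le> Fin \<gamma>"
  proof
    fix \<rho> assume "\<rho> \<in> \<A>"
    then have "\<rho> \<phi> \<in> Fin ` D" using im by blast
    then show "\<rho> \<phi> \<le> Fin \<gamma>" using cut(3) by auto
  qed
  show "\<exists>\<rho>\<in>\<A>. Fin z < \<rho> \<phi>" if z: "z \<in> S" "z < \<gamma>" for z
  proof (rule ccontr)
    assume "\<not> (\<exists>\<rho>\<in>\<A>. Fin z < \<rho> \<phi>)"
    then have "d \<le> z" if "d \<in> D" for d using that unfolding D_def by (force simp: not_less)
    then show False using cut(4)[OF z(1)] z(2) by force
  qed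
  interpret expansion_valuation \<phi> "lim_aug \<A> \<phi> (Fin \<gamma>)" "Fin \<gamma>" by (rule lim_aug_expansion[OF \<phi> le])
  show "incommensurable_node v \<phi> (lim_aug \<A> \<phi> (Fin \<gamma>)) \<gamma>"
  proof
    show "lim_aug \<A> \<phi> (Fin \<gamma>) [:a:] = v a" for a by (rule lim_aug_const[OF \<phi> le])
    show "lead_coeff \<phi> = 1" by (rule KP_inf_D[OF \<phi>])
    show "\<gamma> \<notin> \<Lambda>" by (rule cut)
    fix r :: "'k poly" assume r: "degree r < degree \<phi>"
    note low = lim_aug_low[OF \<phi> le r] and st = KP_inf_D(3)[OF \<phi> r]
    show "lim_aug \<A> \<phi> (Fin \<gamma>) r \<in> insert Infty (Fin ` \<Lambda>)"
      unfolding low using stable_value_range[OF _ st] sub unfolding T_Q_def .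
    show "lim_aug \<A> \<phi> (Fin \<gamma>) r \<noteq> Infty" if "r \<noteq> 0" unfolding low by (rule stable_finite[OF st that])
  qed
qed

text \<open>Needed for uniqueness: nodes of smaller degree come arbitrarily close to \<rho> from
  below, measured at \<phi> by elements of \<open>S\<close>. They are late members of the family.
  For the root nothing has to be approximated, because no z in \<open>S\<close> is smaller than the
  least one.\<close>

lemma limit_primitive_approx:
  assumes "limit_primitive v S \<rho>"
  obtains \<phi> \<gamma> where "incommensurable_node v \<phi> \<rho> \<gamma>" "\<gamma> \<in> S"
    "\<And>z. z \<in> S \<Longrightarrow> z < \<gamma> \<Longrightarrow> \<exists>\<sigma>\<in>TQ. \<sigma> < \<rho> \<and> Fin z < \<sigma> \<phi> \<and> deg_val \<sigma> < degree \<phi>"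
  using assms unfolding limit_primitive_def
proof (elim disjE exE conjE)
  assume root: "\<rho> = root_node v S"
  show thesis
  proof (rule that)
    show "incommensurable_node v [:0, 1:] \<rho> (LEAST x. x \<in> S)"
      unfolding root by (rule root_incommensurable)
    show "(LEAST x. x \<in> S) \<in> S" by (rule Least_cut[OF emb rep])
    show "\<exists>\<sigma>\<in>TQ. \<sigma> < \<rho> \<and> Fin z < \<sigma> [:0, 1:] \<and> deg_val \<sigma> < degree [:0, 1 :: 'k:]"
      if "z \<in> S" "z < (LEAST x. x \<in> S)" for z
      using Least_cut(3)[OF emb rep that(1)] that(2) by simp
  qed
next
  fix \<A> \<phi>
  assume ess: "essential_family v \<A>" and \<phi>: "\<phi> \<in> KP_inf \<A>"
    and \<rho>: "\<rho> = lim_aug \<A> \<phi> (Fin (sup_in S ((\<lambda>\<rho>. \<rho> \<phi>) ` \<A>)))"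
  interpret valuation_chain v \<A> by (rule essential_chain[OF ess])
  have sub: "\<A> \<subseteq> TQ" using ess by (simp add: essential_family_def T_Q_def)
  define \<gamma> where "\<gamma> = sup_in S ((\<lambda>\<rho>. \<rho> \<phi>) ` \<A>)"
  note lim = lim_aug_incommensurable[OF essential_chain[OF ess] sub \<phi>, folded \<gamma>_def]
  show thesis
  proof (rule that)
    show "incommensurable_node v \<phi> \<rho> \<gamma>" unfolding \<rho> \<gamma>_def[symmetric] by (rule lim)
    show "\<gamma> \<in> S" by (rule lim)
    fix z assume z: "z \<in> S" "z < \<gamma>"
    obtain \<rho>1 where \<rho>1: "\<rho>1 \<in> \<A>" "Fin z < \<rho>1 \<phi>" using lim(3)[OF z] by blast
    obtain m where m: "\<exists>\<rho>\<in>\<A>. \<forall>\<sigma>\<in>\<A>. \<rho> \<le> \<sigma> \<longrightarrow> deg_val \<sigma> = m" "enat m < deg_inf \<A>"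
      using ess by (auto simp: essential_family_def)
    have "ev (\<lambda>\<sigma>. deg_val \<sigma> = m \<and> \<rho>1 \<le> \<sigma>)"
      using m(1) ev_ge[OF \<rho>1(1)] by (intro ev_conj) (simp_all add: ev_def)
    then obtain \<sigma> where \<sigma>: "\<sigma> \<in> \<A>" "deg_val \<sigma> = m" "\<rho>1 \<le> \<sigma>" using ev_ex by blast
    obtain \<tau> where \<tau>: "\<tau> \<in> \<A>" "\<sigma> < \<tau>" using no_max[OF \<sigma>(1)] by blast
    have "\<tau> \<le> \<rho>" unfolding \<rho> \<gamma>_def[symmetric] by (rule lim_aug_ge[OF \<phi> lim(2) \<tau>(1)])
    then have "\<sigma> < \<rho>" using \<tau>(2) by simp
    moreover have "Fin z < \<sigma> \<phi>" using \<rho>1(2) le_funD[OF \<sigma>(3), of \<phi>] by simp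
    moreover have "deg_val \<sigma> < degree \<phi>" using m(2) \<sigma>(2) deg_inf_eq[OF \<phi>] by simp
    ultimately show "\<exists>\<sigma>\<in>TQ. \<sigma> < \<rho> \<and> Fin z < \<sigma> \<phi> \<and> deg_val \<sigma> < degree \<phi>"
      using sub \<sigma>(1) by blast
  qed
qed

section \<open>Directions at primitive nodes and the leaves they lead to\<close>

definition dirs :: "('k poly \<Rightarrow> 'r vext) \<Rightarrow> 'k poly set" where
  "dirs \<rho> = (if ordinary_primitive v \<rho> then KP_str \<rho> else KP \<rho>)"

lemma dirs_KP: "\<phi> \<in> dirs \<rho> \<Longrightarrow> \<phi> \<in> KP \<rho>"
  by (auto simp: dirs_def KP_str_def split: if_splits)

lemma Prim_T: "\<rho> \<in> Prim v S \<Longrightarrow> \<rho> \<in> T"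
  by (auto simp: Prim_def T_sme_def inner_node_def TQ_T)

lemma Prim_cases:
  assumes "\<rho> \<in> Prim v S"
  obtains (ordinary) "ordinary_primitive v \<rho>" "\<rho> \<in> TQ" "\<And>\<phi>. \<phi> \<in> dirs \<rho> \<Longrightarrow> deg_val \<rho> < degree \<phi>"
  | (limit) \<phi> \<gamma> where "\<not> ordinary_primitive v \<rho>" "incommensurable_node v \<phi> \<rho> \<gamma>" "\<gamma> \<in> S"
    "\<And>z. z \<in> S \<Longrightarrow> z < \<gamma> \<Longrightarrow> \<exists>\<sigma>\<in>TQ. \<sigma> < \<rho> \<and> Fin z < \<sigma> \<phi> \<and> deg_val \<sigma> < degree \<phi>"
proof (cases "ordinary_primitive v \<rho>")
  case True
  then show thesis
    by (intro ordinary) (auto simp: ordinary_primitive_def inner_node_def dirs_def KP_str_def)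
next
  case False
  then have "limit_primitive v S \<rho>" using assms by (simp add: Prim_def)
  then show thesis by (rule limit_primitive_approx) (rule limit[OF False])
qed

lemma leaf_TQ: "F \<in> leaves \<Longrightarrow> F \<in> TQ"
  by (simp add: finite_leaves_def leaf_def)

lemma leaf_support:
  assumes "F \<in> leaves"
  obtains f where "f \<noteq> 0" "F f = Infty"
proof -
  have "0 \<in> val_support F" using val_0[OF T_val[OF TQ_T[OF leaf_TQ[OF assms]]]] by (simp add: val_support_def)
  then show thesis using assms that by (auto simp: finite_leaves_def val_support_def)
qed

lemma leaf_of_direction:
  assumes \<rho>: "\<rho> \<in> Prim v S" and \<phi>: "\<phi> \<in> dirs \<rho>"
  shows "ord_aug \<rho> \<phi> Infty \<in> leaves"
proof -
  let ?F = "ord_aug \<rho> \<phi> Infty"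
  note KP = dirs_KP[OF \<phi>] and T = Prim_T[OF \<rho>]
  note pos = KP_degree_pos[OF T_val[OF T] KP]
  have FT: "?F \<in> T" and F\<phi>: "?F \<phi> = Infty" using ord_aug_T[OF T KP, of Infty] by auto
  have "?F f \<in> insert Infty (Fin ` \<Lambda>)" for f
    unfolding ord_aug_Infty[OF T KP]
    using \<rho>
  proof (cases rule: Prim_cases)
    case ordinary
    then show "\<rho> (f mod \<phi>) \<in> insert Infty (Fin ` \<Lambda>)" using TQ_range by blast
  next
    case (limit \<phi>0 \<gamma>)
    interpret incommensurable_node v \<phi>0 \<rho> \<gamma> by (rule limit)
    show "\<rho> (f mod \<phi>) \<in> insert Infty (Fin ` \<Lambda>)"
      using degree_mod_lt[OF KP_degree_pos[OF T_val[OF T] KP], of f] KP_node(1)[OF KP]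
      by (intro low_range) simp
  qed
  then have FQ: "?F \<in> TQ" using FT by (intro TQ_I) blast+
  have \<phi>0: "\<phi> \<noteq> 0" using pos by auto
  have "leaf TQ ?F"
    unfolding leaf_def
  proof (intro conjI FQ notI)
    assume "\<exists>\<nu>\<in>TQ. ?F < \<nu>"
    then obtain \<nu> where "\<nu> \<in> TQ" "?F < \<nu>" by blast
    then show False 
      using nonzero_support_maximal[OF FT TQ_T _ \<phi>0 F\<phi>, of \<nu>] by (metis less_imp_le less_irrefl)
  qed
  moreover have "\<phi> \<in> val_support ?F" using F\<phi> by (simp add: val_support_def)
  ultimately show ?thesis using \<phi>0 by (auto simp: finite_leaves_def)
qed

lemma direction_tangent:
  assumes T: "\<rho> \<in> T" and KP: "\<phi> \<in> KP \<rho>"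
  shows "\<rho> < ord_aug \<rho> \<phi> Infty" "\<phi> \<in> tangent \<rho> (ord_aug \<rho> \<phi> Infty)"
    "tangent \<rho> (ord_aug \<rho> \<phi> Infty) = tdir \<rho> \<phi>"
proof -
  have less: "\<rho> \<phi> < Infty" using KP_D(2)[OF T_val[OF T] KP] by (simp add: vext_less_Infty_iff)
  have *: "\<rho> \<phi> \<le> Infty" by simp
  show tan: "\<phi> \<in> tangent \<rho> (ord_aug \<rho> \<phi> Infty)" by (rule ord_aug_T(5)[OF T KP * less])
  show "tangent \<rho> (ord_aug \<rho> \<phi> Infty) = tdir \<rho> \<phi>"
    by (rule tangent_eq_tdir[OF T ord_aug_T(1,2)[OF T KP *] tan])
  have "\<rho> \<noteq> ord_aug \<rho> \<phi> Infty" using less ord_aug_T(3)[OF T KP *] by force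
  then show "\<rho> < ord_aug \<rho> \<phi> Infty" using ord_aug_T(2)[OF T KP *] by simp
qed

text \<open>An augmentation with finite \<gamma> has trivial support, so among those in
  \<open>prim_set\<close> only \<gamma> = Infty gives a finite leaf; and a limit node itself takes a
  value outside \<Lambda>.\<close>

lemma mem_prim_set_iff:
  assumes \<rho>: "\<rho> \<in> Prim v S" and F: "F \<in> leaves"
  shows "F \<in> prim_set v S \<rho> \<longleftrightarrow> (\<exists>\<phi>\<in>dirs \<rho>. F = ord_aug \<rho> \<phi> Infty)"
proof
  note T = Prim_T[OF \<rho>]
  obtain f where f: "f \<noteq> 0" "F f = Infty" by (rule leaf_support[OF F])
  assume "F \<in> prim_set v S \<rho>"
  then consider "\<not> ordinary_primitive v \<rho>" "F = \<rho>" | \<phi> where "\<phi> \<in> dirs \<rho>" "F \<in> aug_path S \<rho> \<phi>"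
    unfolding prim_set_def dirs_def by (auto split: if_splits)
  then show "\<exists>\<phi>\<in>dirs \<rho>. F = ord_aug \<rho> \<phi> Infty"
  proof cases
    case 1
    from \<rho> show ?thesis
    proof (cases rule: Prim_cases)
      case (limit \<phi>0 \<gamma>)
      interpret incommensurable_node v \<phi>0 \<rho> \<gamma> by (rule limit)
      show ?thesis using TQ_range[OF leaf_TQ[OF F], of \<phi>0] incomm 1(2) E_phi by auto
    qed (use 1 in simp)
  next
    case 2
    then obtain \<gamma> where \<gamma>: "F = ord_aug \<rho> \<phi> \<gamma>" "\<rho> \<phi> < \<gamma>" by (auto simp: aug_path_def)
    note KP = dirs_KP[OF 2(1)]
    have *: "\<rho> \<phi> \<le> \<gamma>" using \<gamma>(2) by simp
    interpret expansion_valuation \<phi> "ord_aug \<rho> \<phi> \<gamma>" \<gamma> by (rule ord_aug_expansion[OF T KP *])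
    have "\<gamma> = Infty"
    proof (rule ccontr)
      assume "\<gamma> \<noteq> Infty"
      then have "F f \<noteq> Infty" unfolding \<gamma>(1)
        using ord_aug_expansion(2)[OF T KP *] KP_low_finite[OF T_val[OF T] KP]
        by (intro E_finite[OF \<open>\<gamma> \<noteq> Infty\<close> _ f(1)]) metis
      then show False using f(2) by simp
    qed
    then show ?thesis using 2(1) \<gamma>(1) by blast
  qed
next
  assume "\<exists>\<phi>\<in>dirs \<rho>. F = ord_aug \<rho> \<phi> Infty"
  then obtain \<phi> where \<phi>: "\<phi> \<in> dirs \<rho>" "F = ord_aug \<rho> \<phi> Infty" by blast
  then have "F \<in> aug_path S \<rho> \<phi>"
    using KP_D(2)[OF T_val[OF Prim_T[OF \<rho>]] dirs_KP[OF \<phi>(1)]]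
    by (auto simp: aug_path_def vext_less_Infty_iff)
  then show "F \<in> prim_set v S \<rho>"
    using \<phi>(1) unfolding prim_set_def dirs_def by (auto split: if_splits)
qed

text \<open>The leaf determines \<phi> as the monic polynomial of least degree with value Infty, and
  below that degree the leaf agrees with the node it comes from.\<close>

lemma direction_unique:
  assumes \<rho>: "\<rho> \<in> T" "\<phi> \<in> KP \<rho>" and \<rho>': "\<rho>' \<in> T" "\<phi>' \<in> KP \<rho>'"
    and eq: "ord_aug \<rho> \<phi> Infty = ord_aug \<rho>' \<phi>' Infty"
  shows "\<phi> = \<phi>'" "\<And>f. degree f < degree \<phi> \<Longrightarrow> \<rho> f = \<rho>' f"
proof -
  let ?F = "ord_aug \<rho> \<phi> Infty"
  have FT: "?F \<in> T" using ord_aug_T[OF \<rho>, of Infty] by simp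
  have Inf: "?F \<phi> = Infty" "?F \<phi>' = Infty"
    using ord_aug_T(3)[OF \<rho>, of Infty] ord_aug_T(3)[OF \<rho>', of Infty] eq by simp_all
  have low: "?F f \<noteq> Infty" if "f \<noteq> 0" "degree f < degree \<phi>" for f
    using KP_low_finite[OF T_val[OF \<rho>(1)] \<rho>(2)] that by (simp add: ord_aug_Infty[OF \<rho>] mod_poly_less)
  have low': "?F f \<noteq> Infty" if "f \<noteq> 0" "degree f < degree \<phi>'" for f
    using KP_low_finite[OF T_val[OF \<rho>'(1)] \<rho>'(2)] that by (simp add: eq ord_aug_Infty[OF \<rho>'] mod_poly_less)
  have nz: "\<phi> \<noteq> 0" "\<phi>' \<noteq> 0" using KP_nonzero T_val \<rho> \<rho>' by auto
  have deg: "degree \<phi> = degree \<phi>'" using low[OF nz(2)] low'[OF nz(1)] Inf by (meson linorder_neqE_nat)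
  have "degree (\<phi> - \<phi>') < degree \<phi>"
    using monic_diff_degree_less[OF KP_D(1)[OF T_val[OF \<rho>(1)] \<rho>(2)] KP_D(1)[OF T_val[OF \<rho>'(1)] \<rho>'(2)] deg]
      KP_degree_pos[OF T_val[OF \<rho>(1)] \<rho>(2)] by simp
  moreover have "?F (\<phi> - \<phi>') = Infty" using val_diff[OF T_val[OF FT], of \<phi> \<phi>'] Inf by simp
  ultimately show \<phi>: "\<phi> = \<phi>'" using low[of "\<phi> - \<phi>'"] by auto
  show "\<rho> f = \<rho>' f" if "degree f < degree \<phi>" for f
    using ord_aug_Infty[OF \<rho>, of f] ord_aug_Infty[OF \<rho>', of f] eq \<phi> that by (simp add: mod_poly_less)
qed

section \<open>Uniqueness of the previous primitive node\<close>

lemma deg_val_ge_tangent: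
  assumes \<rho>: "\<rho> \<in> T" and \<sigma>: "\<sigma> \<in> T" and F: "F \<in> T" and less: "\<rho> < \<sigma>" "\<sigma> < F" and p: "p \<in> tangent \<rho> F"
  shows "degree p \<le> deg_val \<sigma>"
proof -
  obtain \<theta> where "\<theta> \<in> tangent \<sigma> F" using tangent_exists[OF \<sigma> F less(2)] .
  then have "KP \<sigma> \<noteq> {}" using tangent_KP[OF \<sigma> F] less(2) by fastforce
  then obtain \<psi> where \<psi>: "\<psi> \<in> KP \<sigma>" "degree \<psi> = deg_val \<sigma>" by (rule deg_val_attained)
  \<comment> \<open>The direction towards F is already the direction towards any intermediate node,
    so p bounds the degrees of key polynomials of \<sigma>.\<close>
  have "p \<in> tangent \<rho> \<sigma>" using p tangent_between[OF \<rho> \<sigma> F less(1)] less(2) by simp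
  then show ?thesis using KP_degree_ge_tangent[OF \<rho> \<sigma> _ _ \<psi>(1)] less(1) \<psi>(2) by simp
qed

lemma prim_unique_le:
  assumes \<rho>: "\<rho> \<in> Prim v S" "p \<in> dirs \<rho>" and \<rho>': "\<rho>' \<in> Prim v S" "p \<in> dirs \<rho>'"
    and eq: "ord_aug \<rho> p Infty = ord_aug \<rho>' p Infty" and le: "\<rho> \<le> \<rho>'"
  shows "\<rho> = \<rho>'"
proof (rule ccontr)
  let ?F = "ord_aug \<rho> p Infty"
  assume "\<rho> \<noteq> \<rho>'"
  then have less: "\<rho> < \<rho>'" using le by simp
  note T = Prim_T[OF \<rho>(1)] and T' = Prim_T[OF \<rho>'(1)] and KP = dirs_KP[OF \<rho>(2)] and KP' = dirs_KP[OF \<rho>'(2)]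
  have FT: "?F \<in> T" using ord_aug_T[OF T KP, of Infty] by simp
  note tan = direction_tangent[OF T KP]
  have \<rho>'F: "\<rho>' < ?F" using direction_tangent[OF T' KP'] eq by simp
  note deg = deg_val_ge_tangent[OF T _ FT _ _ tan(2)]
  from \<rho>'(1) show False
  proof (cases rule: Prim_cases)
    case ordinary
    then show False using deg[OF T' less \<rho>'F] \<rho>'(2) by fastforce
  next
    case (limit \<phi>' \<gamma>')
    interpret L: incommensurable_node v \<phi>' \<rho>' \<gamma>' by (rule limit)
    have deg_p: "degree p = degree \<phi>'" by (rule L.KP_node(1)[OF KP'])
    \<comment> \<open>An element of \<open>S\<close> separating the two nodes at
      \<open>\<phi>'\<close> suffices: an approximating \<sigma> whose value there exceeds z is not
      below \<rho>, hence lies strictly between \<rho> and F, with degree less than that of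
      p.\<close>
    have "\<exists>z\<in>S. z < \<gamma>' \<and> \<rho> \<phi>' \<le> Fin z"
      using \<rho>(1)
    proof (cases rule: Prim_cases)
      case ordinary
      have "\<rho> \<phi>' \<le> Fin \<gamma>'" using le_funD[OF le, of \<phi>'] L.E_phi by simp
      then obtain z where z: "\<rho> \<phi>' = Fin z" "z \<le> \<gamma>'" by (cases "\<rho> \<phi>'") auto
      then have "z \<in> \<Lambda>" using TQ_range[OF ordinary(2), of \<phi>'] by auto
      \<comment> \<open>An ordinary node separates by its own value, which lies in \<Lambda> while
        \<open>\<gamma>'\<close> does not.\<close>
      then have "z \<noteq> \<gamma>'" "z \<in> S" using L.incomm \<Lambda>_S by auto
      then show ?thesis using z by (intro bexI[of _ z]) auto
    next
      case lim: (limit \<phi> \<gamma>)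
      interpret M: incommensurable_node v \<phi> \<rho> \<gamma> by (rule lim)
      have c: "degree (\<phi>' - p) < degree p"
        using monic_diff_degree_less[OF L.monic KP_D(1)[OF T_val[OF T] KP]] deg_p L.pos by simp
      have "\<rho> (1 * p + (\<phi>' - p)) = min (\<rho> (\<phi>' - p)) (\<rho> 1 + Fin \<gamma>)"
        by (rule M.expansion_at_KP[OF KP c])
      then have 1: "\<rho> \<phi>' \<le> Fin \<gamma>" by (simp add: M.E_1)
      \<comment> \<open>Between two limit nodes \<gamma> separates: they agree below the degree of p
        and take the values \<gamma> and \<open>\<gamma>'\<close> at p, so
        \<open>\<gamma>' \<le> \<gamma>\<close> would reverse their order.\<close>
      have "\<not> \<gamma>' \<le> \<gamma>"
      proof
        assume \<gamma>: "\<gamma>' \<le> \<gamma>"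
        have "\<rho>' \<le> \<rho>"
        proof (rule le_if_expansion_le[where \<phi>=p and \<gamma>="Fin \<gamma>'"])
          show "0 < degree p" by (rule KP_degree_pos[OF T_val[OF T] KP])
          show "is_valuation \<rho>" by (rule T_val[OF T])
          show "\<rho>' (q * p + r) = min (\<rho>' r) (\<rho>' q + Fin \<gamma>')" if "degree r < degree p" for q r
            by (rule L.expansion_at_KP[OF KP' that])
          show "\<rho>' r \<le> \<rho> r" if "degree r < degree p" for r
            using direction_unique(2)[OF T KP T' KP' eq that] by simp
          show "Fin \<gamma>' \<le> \<rho> p" using \<gamma> M.KP_node(2)[OF KP] by simp
        qed
        then show False using less by simp
      qed
      then show ?thesis using 1 lim(3) by (intro bexI[of _ \<gamma>]) auto
    qed
    then obtain z where z: "z \<in> S" "z < \<gamma>'" "\<rho> \<phi>' \<le> Fin z" by blast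
    obtain \<sigma> where \<sigma>: "\<sigma> \<in> TQ" "\<sigma> < \<rho>'" "Fin z < \<sigma> \<phi>'" "deg_val \<sigma> < degree \<phi>'"
      using limit(4)[OF z(1,2)] by blast
    have \<sigma>F: "\<sigma> < ?F" using \<sigma>(2) \<rho>'F by simp
    have "\<not> \<sigma> \<le> \<rho>" using z(3) \<sigma>(3) by (metis le_funD leD order_less_le_trans)
    then have "\<rho> < \<sigma>" using below_comparable[OF T TQ_T[OF \<sigma>(1)] FT tan(1) \<sigma>F] by (auto simp: less_le)
    then show False using deg[OF TQ_T[OF \<sigma>(1)] _ \<sigma>F] \<sigma>(4) deg_p by simp
  qed
qed

lemma prim_unique:
  assumes "\<rho> \<in> Prim v S" "\<phi> \<in> dirs \<rho>" "\<rho>' \<in> Prim v S" "\<phi>' \<in> dirs \<rho>'"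
    and eq: "ord_aug \<rho> \<phi> Infty = ord_aug \<rho>' \<phi>' Infty"
  shows "\<rho> = \<rho>'"
proof -
  note T = Prim_T[OF assms(1)] dirs_KP[OF assms(2)] and T' = Prim_T[OF assms(3)] dirs_KP[OF assms(4)]
  have \<phi>: "\<phi>' = \<phi>" using direction_unique(1)[OF T T' eq] by simp
  have "\<rho> < ord_aug \<rho> \<phi> Infty" "\<rho>' < ord_aug \<rho> \<phi> Infty"
    using direction_tangent(1)[OF T] direction_tangent(1)[OF T'] eq by simp_all
  moreover have "ord_aug \<rho> \<phi> Infty \<in> T" using ord_aug_T[OF T, of Infty] by simp
  ultimately have "\<rho> \<le> \<rho>' \<or> \<rho>' \<le> \<rho>" using below_comparable[OF T(1) T'(1)] by blast
  then show ?thesis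
    using prim_unique_le[OF assms(1,2,3) _ eq[unfolded \<phi>]] prim_unique_le[OF assms(3) _ assms(1,2) eq[unfolded \<phi>, symmetric]]
      assms(4) \<phi> by auto
qed

section \<open>Existence of the previous primitive node\<close>

lemma truncation_below:
  assumes E: "expansion_valuation \<phi> E (F \<phi>)" "E \<in> T" and F: "F \<in> TQ"
    and eq: "\<And>r. degree r < degree \<phi> \<Longrightarrow> E r = F r"
    and p: "p \<noteq> 0" "F p = Infty" and fin: "\<And>r. r \<noteq> 0 \<Longrightarrow> degree r \<le> degree \<phi> \<Longrightarrow> F r \<noteq> Infty"
  shows "E \<in> TQ" "E < F"
proof -
  interpret expansion_valuation \<phi> E "F \<phi>" by (rule E)
  have "range E \<subseteq> insert Infty (Fin ` \<Lambda>)"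
    by (rule range_E) (use eq TQ_range[OF F] \<Lambda>_add in auto)
  then show "E \<in> TQ" by (rule TQ_I[OF E(2)])
  have "E \<le> F" by (rule le_if_expansion_le[OF pos T_val[OF TQ_T[OF F]] rec]) (auto simp: eq)
  moreover have "F \<phi> \<noteq> Infty" using fin[of \<phi>] pos by fastforce
  \<comment> \<open>All digits and \<phi> itself have finite value under F, so the truncation has
    trivial support and differs from F at p.\<close>
  then have "E p \<noteq> Infty" using eq fin by (intro E_finite[OF _ _ p(1)]) auto
  then have "E \<noteq> F" using p(2) by metis
  ultimately show "E < F" by simp
qed

lemma prim_exists:
  assumes F: "F \<in> leaves"
  shows "\<exists>\<rho>\<in>Prim v S. \<exists>\<phi>\<in>dirs \<rho>. F = ord_aug \<rho> \<phi> Infty"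
proof -
  note FQ = leaf_TQ[OF F]
  note FT = TQ_T[OF FQ]
  note val = T_val[OF FT]
  obtain p0 where p0: "p0 \<noteq> 0 \<and> F p0 = Infty" using leaf_support[OF F] by metis
  define p1 where "p1 = arg_min degree (\<lambda>f. f \<noteq> 0 \<and> F f = Infty)"
  have p1: "p1 \<noteq> 0" "F p1 = Infty" and min: "\<And>f. f \<noteq> 0 \<Longrightarrow> F f = Infty \<Longrightarrow> degree p1 \<le> degree f"
    using arg_min_natI[of "\<lambda>f. f \<noteq> 0 \<and> F f = Infty" p0 degree, OF p0]
      arg_min_nat_le[of "\<lambda>f. f \<noteq> 0 \<and> F f = Infty" _ degree] unfolding p1_def by auto
  obtain p where p: "lead_coeff p = 1" "degree p = degree p1" "F p1 = v (lead_coeff p1) + F p"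
    using T_monic_multiple[OF p1(1)] FT by metis
  have Fp: "F p = Infty"
    using p(3) p1 v_eq_Infty[of "lead_coeff p1"] by (metis leading_coeff_0_iff vext_plus_eq_Infty)
  have low: "F f \<noteq> Infty" if "f \<noteq> 0" "degree f < degree p" for f
    using min[OF that(1)] that(2) p(2) by auto
  have p_nz: "p \<noteq> 0" using p(1) by auto
  have n: "0 < degree p"
  proof (rule ccontr)
    assume "\<not> 0 < degree p"
    then obtain c where "p = [:c:]" by (metis degree_eq_zeroE gr0I)
    then show False using p_nz Fp T_const[OF FT] by simp
  qed
  \<comment> \<open>Agreement below the degree of p is enough: p is then a direction, and F depends
    only on remainders modulo p, as does the augmentation.\<close>
  have reach: "p \<in> KP \<mu>" "F = ord_aug \<mu> p Infty"
    if \<mu>: "\<mu> \<in> T" "\<mu> < F" and eq: "\<And>f. degree f < degree p \<Longrightarrow> \<mu> f = F f" for \<mu>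
  proof -
    have "\<mu> p < F p" using less_finite[OF \<mu>(1) FT \<mu>(2) p_nz] Fp by (simp add: vext_less_Infty_iff)
    then have "p \<in> tangent \<mu> F" by (rule tangentI[OF \<mu>(1) FT p(1) _ eq])
    then show KP: "p \<in> KP \<mu>" using tangent_KP[OF \<mu>(1) FT] \<mu>(2) by simp
    show "F = ord_aug \<mu> p Infty"
    proof
      fix f
      show "F f = ord_aug \<mu> p Infty f"
        using eq[OF degree_mod_lt[OF n], of f] val_mod_supp[OF val Fp, of f] ord_aug_Infty[OF \<mu>(1) KP] by simp
    qed
  qed
  \<comment> \<open>The key polynomial \<phi> of smaller degree only serves to show that p is
    strong.\<close>
  have finish_ordinary: ?thesis
    if \<mu>: "\<mu> \<in> TQ" "\<mu> < F" and eq: "\<And>f. degree f < degree p \<Longrightarrow> \<mu> f = F f"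
      and \<phi>: "\<phi> \<in> KP \<mu>" "degree \<phi> < degree p" for \<mu> \<phi>
  proof -
    note r = reach[OF TQ_T[OF \<mu>(1)] \<mu>(2) eq]
    have str: "p \<in> KP_str \<mu>" using r(1) deg_val_le[OF \<phi>(1)] \<phi>(2) by (simp add: KP_str_def)
    have "inner_node TQ \<mu>" using \<mu> FQ unfolding inner_node_def leaf_def by blast
    then have ord: "ordinary_primitive v \<mu>" using str unfolding ordinary_primitive_def by blast
    then have "\<mu> \<in> Prim v S" using \<mu>(1) by (simp add: Prim_def T_sme_def)
    moreover have "p \<in> dirs \<mu>" using ord str by (simp add: dirs_def)
    ultimately show ?thesis using r(2) by blast
  qed
  \<comment> \<open>The node takes the value \<gamma> outside \<Lambda>, so it cannot be
    ordinary-primitive, and every key polynomial counts as a direction there.\<close>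
  have finish_limit: ?thesis
    if lim: "limit_primitive v S \<mu>" and inc: "incommensurable_node v \<phi> \<mu> \<gamma>" and \<gamma>: "\<gamma> \<in> S"
      and less: "\<mu> < F" and eq: "\<And>f. degree f < degree p \<Longrightarrow> \<mu> f = F f" for \<mu> \<phi> \<gamma>
  proof -
    interpret incommensurable_node v \<phi> \<mu> \<gamma> by (rule inc)
    note r = reach[OF node_T less eq]
    have "inner_node T \<mu>" using node_T FT less unfolding inner_node_def leaf_def by blast
    then have "\<mu> \<in> T_sme v S" using sv_node \<gamma> by (simp add: T_sme_def)
    moreover have "\<mu> \<notin> TQ" using TQ_range[of \<mu> \<phi>] E_phi incomm by auto
    then have "\<not> ordinary_primitive v \<mu>" by (simp add: ordinary_primitive_def inner_node_def)
    ultimately show ?thesis using lim r by (auto simp: Prim_def dirs_def)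
  qed
  show ?thesis
  proof (cases "degree p = 1")
    case True
    define \<gamma> where "\<gamma> = (LEAST x. x \<in> S)"
    let ?w = "root_node v S"
    have inc: "incommensurable_node v [:0, 1:] ?w \<gamma>" unfolding \<gamma>_def by (rule root_incommensurable)
    interpret incommensurable_node v "[:0, 1:]" ?w \<gamma> by (rule inc)
    have eq: "?w f = F f" if "degree f < 1" for f
      using degree_less_x[of f] that const T_const[OF FT] by auto
    have "?w \<le> F"
    proof (rule le_if_expansion_le[OF pos val rec])
      show "?w r \<le> F r" if "degree r < degree [:0, 1 :: 'k:]" for r using eq[of r] that by simp
      show "Fin \<gamma> \<le> F [:0, 1:]"
        using TQ_range[OF FQ, of "[:0, 1:]"] Least_cut(3)[OF emb rep \<Lambda>_S] by (auto simp: \<gamma>_def)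
    qed
    moreover have "?w \<noteq> F" using node_finite[OF p_nz] Fp by auto
    ultimately have "?w < F" by simp
    then show ?thesis
      using finish_limit[OF _ inc Least_cut(1)[OF emb rep, folded \<gamma>_def]] eq True
      by (simp add: limit_primitive_def)
  next
    case False
    with n have n1: "1 < degree p" by simp
    \<comment> \<open>All directions from one node to F have the same degree, and this degree cannot
      drop on the way to F. For the largest k below \<open>degree p\<close> that occurs,
      \<open>N k\<close> is thus the last stage before degree \<open>degree p\<close>.\<close>
    define N where "N k = {\<mu> \<in> TQ. \<mu> < F \<and> (\<exists>\<phi>\<in>tangent \<mu> F. degree \<phi> = k)}" for k
    show ?thesis
    proof (cases "\<exists>k<degree p. N k \<noteq> {}")
      case False
      define \<gamma> where "\<gamma> = F [:0, 1:]"
      \<comment> \<open>The node \<open>[\<omega>; x, F x]\<close>, written directly as the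
        valuation with prescribed value at x; that value is finite because p has degree above
        1.\<close>
      let ?w = "gauss \<gamma>"
      have fin: "\<gamma> \<noteq> Infty" unfolding \<gamma>_def using n1 by (intro low) auto
      have lowx: "?w r = F r" if "degree r < degree [:0, 1 :: 'k:]" for r
        using degree_less_x[OF that] gauss_const T_const[OF FT] by auto
      note below = truncation_below[OF gauss_expansion[of "F [:0, 1:]"] gauss_T FQ lowx[unfolded \<gamma>_def] p_nz Fp,
          folded \<gamma>_def]
      have wQ: "?w \<in> TQ" and less: "?w < F" using low n1 by (auto intro!: below)
      obtain \<theta> where \<theta>: "\<theta> \<in> tangent ?w F" using tangent_exists[OF gauss_T FT less] .
      then have "degree p \<le> degree \<theta>" using False wQ less unfolding N_def by (metis (mono_tags, lifting) empty_iff mem_Collect_eq not_less)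
      then have "?w f = F f" if "degree f < degree p" for f
        using tangent_low[OF gauss_T FT _ \<theta>, of f] less that by simp
      then show ?thesis using finish_ordinary[OF wQ less _ gauss_KP[OF fin]] n1 by simp
    next
      case True
      define k where "k = (GREATEST k. k < degree p \<and> N k \<noteq> {})"
      have k: "k < degree p" "N k \<noteq> {}"
        using GreatestI_ex_nat[of "\<lambda>k. k < degree p \<and> N k \<noteq> {}" "degree p"] True unfolding k_def by auto
      have kmax: "j \<le> k" if "j < degree p" "N j \<noteq> {}" for j
        unfolding k_def using that by (intro Greatest_le_nat[of _ j "degree p"]) auto
      \<comment> \<open>Beyond a member of \<open>N k\<close> directions have degree at least k.
        Outside \<open>N k\<close> they cannot have degree k, and by maximality of k no degree
        between k and \<open>degree p\<close> occurs, so \<mu> agrees with F below the degree of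
        p.\<close>
      have finish_above: ?thesis
        if \<mu>: "\<mu> \<in> TQ" "\<mu> < F" "\<mu> \<notin> N k" and \<nu>: "\<nu> \<in> N k" "\<nu> \<le> \<mu>"
          and \<phi>: "\<phi> \<in> KP \<mu>" "degree \<phi> < degree p" for \<mu> \<nu> \<phi>
      proof (rule finish_ordinary[OF \<mu>(1,2) _ \<phi>])
        obtain \<theta> where \<theta>: "\<theta> \<in> tangent \<mu> F" using tangent_exists[OF TQ_T[OF \<mu>(1)] FT \<mu>(2)] .
        obtain \<psi> where \<psi>: "\<psi> \<in> tangent \<nu> F" "degree \<psi> = k" using \<nu>(1) by (auto simp: N_def)
        have "\<nu> \<theta> < F \<theta>" using tangentD(2)[OF \<theta>] le_funD[OF \<nu>(2), of \<theta>] by simp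
        then have "k \<le> degree \<theta>" using tangentD(4)[OF \<psi>(1) tangentD(1)[OF \<theta>]] \<psi>(2) by simp
        moreover have "\<mu> \<in> N (degree \<theta>)" using \<mu> \<theta> by (auto simp: N_def)
        ultimately have "degree p \<le> degree \<theta>" using kmax[of "degree \<theta>"] \<mu>(3) by (metis empty_iff le_antisym not_le)
        then show "\<mu> f = F f" if "degree f < degree p" for f
          using tangent_low[OF TQ_T[OF \<mu>(1)] FT _ \<theta>, of f] \<mu>(2) that by simp
      qed
      show ?thesis
      proof (cases "\<exists>\<mu>\<in>N k. \<forall>\<nu>\<in>N k. \<not> \<mu> < \<nu>")
        case True
        then obtain \<mu> where \<mu>: "\<mu> \<in> N k" "\<And>\<nu>. \<nu> \<in> N k \<Longrightarrow> \<not> \<mu> < \<nu>" by blast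
        then obtain \<phi> where \<phi>: "\<mu> \<in> TQ" "\<mu> < F" "\<phi> \<in> tangent \<mu> F" "degree \<phi> = k" by (auto simp: N_def)
        note \<mu>T = TQ_T[OF \<phi>(1)]
        have le: "\<mu> \<le> F" using \<phi>(2) by simp
        note KP = tangent_KP[OF \<mu>T FT le \<phi>(3)]
        note less\<phi> = tangentD(2)[OF \<phi>(3)]
        have le\<phi>: "\<mu> \<phi> \<le> F \<phi>" using less\<phi> by simp
        have fin: "F \<phi> \<noteq> Infty" using low[OF KP_nonzero[OF T_val[OF \<mu>T] KP]] \<phi>(4) k(1) by simp
        let ?\<mu>1 = "ord_aug \<mu> \<phi> (F \<phi>)"
        note aug = ord_aug_T[OF \<mu>T KP le\<phi>] and aug_low = ord_aug_expansion(2)[OF \<mu>T KP le\<phi>]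
        have aug_F: "?\<mu>1 r = F r" if "degree r < degree \<phi>" for r
          using aug_low[OF that] tangent_low[OF \<mu>T FT le \<phi>(3) that] by simp
        note below = truncation_below[OF ord_aug_expansion(1)[OF \<mu>T KP le\<phi>] aug(1) FQ aug_F p_nz Fp]
        have Q: "?\<mu>1 \<in> TQ" and lessF: "?\<mu>1 < F" using low \<phi>(4) k(1) by (auto intro!: below)
        have "\<mu> \<noteq> ?\<mu>1"
        proof
          assume "\<mu> = ?\<mu>1"
          then have "\<mu> \<phi> = ?\<mu>1 \<phi>" by (rule fun_cong)
          then show False using aug(3) less\<phi> by simp
        qed
        \<comment> \<open>The augmentation is strictly above \<mu>, which is maximal in
          \<open>N k\<close>; so it has left \<open>N k\<close>.\<close>
        then have less: "\<mu> < ?\<mu>1" using aug(2) by simp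
        show ?thesis
          by (rule finish_above[OF Q lessF _ \<mu>(1) aug(2) aug(4)[OF fin]]) (use \<mu>(2) less \<phi>(4) k(1) in auto)
      next
        case no_max: False
        interpret valuation_chain v "N k"
        proof
          show "N k \<subseteq> T" using TQ_T by (auto simp: N_def)
          show "N k \<noteq> {}" by (rule k)
          show "\<rho> \<le> \<sigma> \<or> \<sigma> \<le> \<rho>" if "\<rho> \<in> N k" "\<sigma> \<in> N k" for \<rho> \<sigma>
            using that below_comparable[OF TQ_T TQ_T FT] by (auto simp: N_def)
          show "\<exists>\<sigma>\<in>N k. \<rho> < \<sigma>" if "\<rho> \<in> N k" for \<rho> using no_max that by blast
        qed
        have chainF: "\<rho> < F" if "\<rho> \<in> N k" for \<rho> using that by (simp add: N_def)
        have chainQ: "N k \<subseteq> TQ" by (auto simp: N_def)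
        \<comment> \<open>A value that stops growing along the chain has already reached F: by
          \<open>less_between_iff\<close> any polynomial that still grows towards F grows at the
          next member.\<close>
        have stable_F: "stable_value (N k) f = F f" if st: "stable (N k) f" for f
        proof -
          obtain \<rho> where \<rho>: "\<rho> \<in> N k" "\<And>\<sigma>. \<sigma> \<in> N k \<Longrightarrow> \<rho> \<le> \<sigma> \<Longrightarrow> \<sigma> f = stable_value (N k) f"
            using ev_ex[OF ev_stable_value[OF st]] by blast
          obtain \<sigma> where \<sigma>: "\<sigma> \<in> N k" "\<rho> < \<sigma>" using valuation_chain_axioms \<rho>(1) no_max by blast
          have \<rho>f: "\<rho> f = stable_value (N k) f" by (rule \<rho>(2)[OF \<rho>(1) order_refl])
          have "\<sigma> f = stable_value (N k) f" using \<sigma> by (intro \<rho>(2)) simp_all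
          then have "\<rho> f = \<sigma> f" using \<rho>f by simp
          then have "\<not> \<rho> f < F f"
            using less_between_iff[OF chain_T[OF \<rho>(1)] chain_T[OF \<sigma>(1)] FT \<sigma>(2), of f] chainF[OF \<sigma>(1)] by simp
          then have "\<rho> f = F f" using chainF[OF \<rho>(1)] le_funD[of \<rho> F f] by simp
          then show ?thesis using \<rho>f by simp
        qed
        \<comment> \<open>A stable value of p would be both finite and equal to
          \<open>F p = Infty\<close>; so unstable monic polynomials exist, of degree at most that of
          p.\<close>
        have unst: "\<not> stable (N k) p" using stable_F[of p] stable_finite[OF _ p_nz] Fp by auto
        define \<phi> where "\<phi> = arg_min degree (\<lambda>\<phi>. lead_coeff \<phi> = 1 \<and> \<not> stable (N k) \<phi>)"
        have \<phi>: "\<phi> \<in> KP_inf (N k)"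
          using arg_min_natI[of "\<lambda>\<phi>. lead_coeff \<phi> = 1 \<and> \<not> stable (N k) \<phi>" p degree] p(1) unst
            arg_min_nat_le[of "\<lambda>\<phi>. lead_coeff \<phi> = 1 \<and> \<not> stable (N k) \<phi>" _ degree]
          unfolding \<phi>_def KP_inf_def by auto
        then have \<phi>p: "degree \<phi> \<le> degree p" using p(1) unst by (simp add: KP_inf_def)
        show ?thesis
        proof (cases "degree \<phi> < degree p")
          case True
          have le: "\<forall>\<rho>\<in>N k. \<rho> \<phi> \<le> F \<phi>" using le_funD[OF less_imp_le[OF chainF]] by blast
          \<comment> \<open>Members of \<open>N k\<close> stay strictly below
            \<open>F \<phi>\<close> at \<phi>, whereas the limit augmentation attains it; hence the
            latter is not in \<open>N k\<close>.\<close>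
          have strict: "\<sigma> \<phi> < F \<phi>" if \<sigma>: "\<sigma> \<in> N k" for \<sigma>
            
            using unstable_increases[OF KP_inf_D(2)[OF \<phi>] \<sigma>] le by (metis order_less_le_trans)
          have "\<phi> \<noteq> 0" using KP_inf_D(1)[OF \<phi>] by auto
          then have fin: "F \<phi> \<noteq> Infty" using low True by blast
          let ?\<mu>1 = "lim_aug (N k) \<phi> (F \<phi>)"
          have aug_F: "?\<mu>1 r = F r" if "degree r < degree \<phi>" for r
            using lim_aug_low[OF \<phi> le that] stable_F[OF KP_inf_D(3)[OF \<phi> that]] by simp
          note E = lim_aug_expansion[OF \<phi> le]
          note below = truncation_below[OF E lim_aug_T[OF \<phi> le] FQ aug_F p_nz Fp]
          have Q: "?\<mu>1 \<in> TQ" and lessF: "?\<mu>1 < F" using low True by (auto intro!: below)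
          have notin: "?\<mu>1 \<notin> N k" using strict[of ?\<mu>1] expansion_valuation.E_phi[OF E] by auto
          obtain \<rho> where \<rho>: "\<rho> \<in> N k" using k(2) by blast
          show ?thesis
            by (rule finish_above[OF Q lessF notin \<rho> lim_aug_ge[OF \<phi> le \<rho>] lim_aug_KP[OF \<phi> le fin] True])
        next
          case False
          then have pinf: "p \<in> KP_inf (N k)" using \<phi> \<phi>p p(1) unst unfolding KP_inf_def by auto
          \<comment> \<open>The direction of degree k is itself a key polynomial of \<sigma>, and a
            direction of degree k from an earlier \<rho> bounds all key polynomials of \<sigma> from
            below. As an earlier member is required, the constant degree is claimed from
            \<open>\<rho>1\<close> on.\<close>
          have deg_val: "deg_val \<sigma> = k" if \<rho>: "\<rho> \<in> N k" and \<sigma>: "\<sigma> \<in> N k" "\<rho> < \<sigma>" for \<rho> \<sigma>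
          proof (rule antisym)
            obtain \<theta> where \<theta>: "\<theta> \<in> tangent \<sigma> F" "degree \<theta> = k" using \<sigma>(1) by (auto simp: N_def)
            have "\<theta> \<in> KP \<sigma>" using tangent_KP[OF chain_T[OF \<sigma>(1)] FT _ \<theta>(1)] chainF[OF \<sigma>(1)] by simp
            then show "deg_val \<sigma> \<le> k" using deg_val_le \<theta>(2) by blast
            obtain \<psi> where "\<psi> \<in> tangent \<rho> F" "degree \<psi> = k" using \<rho> by (auto simp: N_def)
            then show "k \<le> deg_val \<sigma>"
              using deg_val_ge_tangent[OF chain_T[OF \<rho>] chain_T[OF \<sigma>(1)] FT \<sigma>(2) chainF[OF \<sigma>(1)]] by blast
          qed
          obtain \<rho>0 where \<rho>0: "\<rho>0 \<in> N k" using k(2) by blast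
          obtain \<rho>1 where \<rho>1: "\<rho>1 \<in> N k" "\<rho>0 < \<rho>1" using no_max \<rho>0 by blast
          have "\<forall>\<sigma>\<in>N k. \<rho>1 \<le> \<sigma> \<longrightarrow> deg_val \<sigma> = k"
            using deg_val[OF \<rho>0] \<rho>1(2) by (meson order_less_le_trans)
          then have ess: "essential_family v (N k)"
            unfolding essential_family_def deg_inf_eq[OF pinf]
            using k chainQ total no_max \<rho>1(1) unfolding T_Q_def
            by (intro conjI exI[of _ k]) auto
          define \<gamma> where "\<gamma> = sup_in S ((\<lambda>\<rho>. \<rho> p) ` N k)"
          note lim = lim_aug_incommensurable[OF valuation_chain_axioms chainQ pinf, folded \<gamma>_def]
          let ?\<mu> = "lim_aug (N k) p (Fin \<gamma>)"
          interpret incommensurable_node v p ?\<mu> \<gamma> by (rule lim(4))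
          have eq: "?\<mu> r = F r" if "degree r < degree p" for r
            using lim_aug_low[OF pinf lim(2) that] stable_F[OF KP_inf_D(3)[OF pinf that]] by simp
          \<comment> \<open>At p the value of F is Infty, so only the digits have to be compared,
            and there both agree.\<close>
          have "?\<mu> \<le> F" by (rule le_if_expansion_le[OF pos val rec]) (auto simp: eq Fp)
          moreover have "?\<mu> \<noteq> F" using E_phi Fp by (metis vext.distinct(1))
          ultimately have "?\<mu> < F" by simp
          moreover have "limit_primitive v S ?\<mu>" unfolding limit_primitive_def \<gamma>_def using ess pinf by blast
          ultimately show ?thesis using finish_limit[OF _ lim(4,1) _ eq] by blast
        qed
      qed
    qed
  qed
qed

section \<open>Passage to tangent vectors and Okutsu classes\<close>

lemma prev_prim_eqI:
  assumes \<rho>: "\<rho> \<in> Prim v S" and \<phi>: "\<phi> \<in> dirs \<rho>"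
  shows "prev_prim v S (ord_aug \<rho> \<phi> Infty) = \<rho>"
  unfolding prev_prim_def
proof (rule the_equality)
  note F = leaf_of_direction[OF assms]
  show "\<rho> \<in> Prim v S \<and> ord_aug \<rho> \<phi> Infty \<in> prim_set v S \<rho>"
    using \<rho> \<phi> mem_prim_set_iff[OF \<rho> F] by blast
  fix \<rho>' assume \<rho>': "\<rho>' \<in> Prim v S \<and> ord_aug \<rho> \<phi> Infty \<in> prim_set v S \<rho>'"
  then obtain \<phi>' where "\<phi>' \<in> dirs \<rho>'" "ord_aug \<rho> \<phi> Infty = ord_aug \<rho>' \<phi>' Infty"
    using mem_prim_set_iff[OF _ F, of \<rho>'] by blast
  then show "\<rho>' = \<rho>" using prim_unique[OF assms] \<rho>' by metis
qed

lemma td_eq: "td \<rho> = tdir \<rho> ` KP \<rho>"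
  unfolding td_def quotient_def tdir_def by (auto simp: Image_def)

text \<open>Members of the class of \<phi> are directions towards the same leaf, so none has smaller
  degree than \<phi>; the class of a strong key polynomial therefore consists of strong
  ones.\<close>

lemma prim_tangent_vectors_eq:
  "prim_tangent_vectors v S = {(\<rho>, tdir \<rho> \<phi>) | \<rho> \<phi>. \<rho> \<in> Prim v S \<and> \<phi> \<in> dirs \<rho>}"
proof -
  have "prim_td v \<rho> = tdir \<rho> ` dirs \<rho>" if \<rho>: "\<rho> \<in> Prim v S" for \<rho>
  proof (cases "ordinary_primitive v \<rho>")
    case True
    note T = Prim_T[OF \<rho>]
    have "tdir \<rho> \<phi> \<subseteq> KP_str \<rho>" if \<phi>: "\<phi> \<in> KP_str \<rho>" for \<phi>
    proof
      fix \<psi> assume "\<psi> \<in> tdir \<rho> \<phi>"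
      have KP: "\<phi> \<in> KP \<rho>" using \<phi> by (simp add: KP_str_def)
      let ?F = "ord_aug \<rho> \<phi> Infty"
      have \<psi>: "\<psi> \<in> tangent \<rho> ?F" using direction_tangent(3)[OF T KP] \<open>\<psi> \<in> tdir \<rho> \<phi>\<close> by simp
      have "degree \<phi> \<le> degree \<psi>"
        using tangentD(4)[OF direction_tangent(2)[OF T KP] tangentD(1,2)[OF \<psi>]] .
      then show "\<psi> \<in> KP_str \<rho>" using \<open>\<psi> \<in> tdir \<rho> \<phi>\<close> \<phi> by (auto simp: KP_str_def tdir_def)
    qed
    moreover have "\<phi> \<in> tdir \<rho> \<phi>" if "\<phi> \<in> KP \<rho>" for \<phi>
      using that by (simp add: tdir_def mu_equiv_def)
    moreover have "KP_str \<rho> \<subseteq> KP \<rho>" by (auto simp: KP_str_def)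
    ultimately have "{t \<in> tdir \<rho> ` KP \<rho>. t \<subseteq> KP_str \<rho>} = tdir \<rho> ` KP_str \<rho>" by blast
    then show ?thesis using True by (simp add: prim_td_def dirs_def td_eq)
  qed (simp add: prim_td_def dirs_def td_eq)
  then show ?thesis unfolding prim_tangent_vectors_def by auto
qed

lemma leaf_decomposition:
  assumes "f \<in> leaves"
  obtains \<phi> where "prev_prim v S f \<in> Prim v S" "\<phi> \<in> dirs (prev_prim v S f)"
    "tangent (prev_prim v S f) f = tdir (prev_prim v S f) \<phi>"
proof -
  obtain \<rho> \<phi> where *: "\<rho> \<in> Prim v S" "\<phi> \<in> dirs \<rho>" "f = ord_aug \<rho> \<phi> Infty" using prim_exists[OF assms] by blast
  then have "prev_prim v S f = \<rho>" using prev_prim_eqI by simp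
  then show thesis using * direction_tangent(3)[OF Prim_T[OF *(1)] dirs_KP[OF *(2)]] that by simp
qed

end

theorem theorem2p2:
  fixes v :: "'k::field \<Rightarrow> 'r::{linordered_ab_group_add,ordered_real_vector} vext"
    and S :: "'r set"
  assumes "is_valuation v"
    and "embeds_small_extensions (value_group v)"
    and "sme_representatives (value_group v) S"
  shows "\<exists>\<Theta>. bij_betw \<Theta> (prim_tangent_vectors v S) (finite_leaves (T_Q v) // okutsu v S) \<and>
     (\<forall>\<rho> \<phi>. \<phi> \<in> KP \<rho> \<and> (\<rho>, tdir \<rho> \<phi>) \<in> prim_tangent_vectors v S \<longrightarrow>
        \<Theta> (\<rho>, tdir \<rho> \<phi>) = okutsu v S `` {ord_aug \<rho> \<phi> Infty}) \<and>
     (\<forall>f\<in>finite_leaves (T_Q v).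
        inv_into (prim_tangent_vectors v S) \<Theta> (okutsu v S `` {f})
          = (prev_prim v S f, tangent (prev_prim v S f) f))"
proof -
  interpret sme_tree v S by unfold_locales (rule assms)+
  \<comment> \<open>The inverse map before passing to classes: Okutsu equivalence of leaves is
    equality under \<tau>, so the classes are its nonempty fibres.\<close>
  define \<tau> where "\<tau> f = (prev_prim v S f, tangent (prev_prim v S f) f)" for f
  \<comment> \<open>Taking a fibre of \<tau> as value involves no choice of a polynomial in a
    tangent direction; the formula through \<open>ord_aug\<close> then holds for every
    representative by \<open>\<tau>_aug\<close>.\<close>
  define \<Theta> where "\<Theta> x = {f \<in> leaves. \<tau> f = x}" for x
  let ?P = "prim_tangent_vectors v S"
  have cls: "okutsu v S `` {f} = \<Theta> (\<tau> f)" if "f \<in> leaves" for f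
  proof -
    have "(f, f') \<in> okutsu v S \<longleftrightarrow> f \<in> leaves \<and> f' \<in> leaves \<and> \<tau> f = \<tau> f'" for f f'
      unfolding okutsu_def \<tau>_def prod.inject by (simp cong: conj_cong)
    then show ?thesis using that by (auto simp: \<Theta>_def)
  qed
  have \<tau>_P: "\<tau> f \<in> ?P" if "f \<in> leaves" for f
    using leaf_decomposition[OF that] unfolding prim_tangent_vectors_eq \<tau>_def by blast
  have \<tau>_aug: "\<tau> (ord_aug \<rho> \<phi> Infty) = (\<rho>, tdir \<rho> \<phi>)" if "\<rho> \<in> Prim v S" "\<phi> \<in> dirs \<rho>" for \<rho> \<phi>
    using that prev_prim_eqI direction_tangent(3)[OF Prim_T dirs_KP] by (simp add: \<tau>_def)
  have ex: "\<exists>f\<in>leaves. \<tau> f = x" if "x \<in> ?P" for x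
    using that leaf_of_direction \<tau>_aug unfolding prim_tangent_vectors_eq by blast
  have inj: "inj_on \<Theta> ?P"
  proof (rule inj_onI)
    fix x y assume "x \<in> ?P" "\<Theta> x = \<Theta> y"
    then obtain f where "f \<in> \<Theta> x" "\<tau> f = x" using ex[of x] by (auto simp: \<Theta>_def)
    then show "x = y" using \<open>\<Theta> x = \<Theta> y\<close> by (auto simp: \<Theta>_def)
  qed
  have "\<Theta> ` ?P = leaves // okutsu v S"
  proof (intro equalityI subsetI)
    fix X assume "X \<in> \<Theta> ` ?P"
    then obtain f where "f \<in> leaves" "X = \<Theta> (\<tau> f)" using ex by blast
    then show "X \<in> leaves // okutsu v S" using cls quotientI by metis
  next
    fix X assume "X \<in> leaves // okutsu v S"
    then obtain f where "f \<in> leaves" "X = okutsu v S `` {f}" by (rule quotientE)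
    then show "X \<in> \<Theta> ` ?P" using cls \<tau>_P by blast
  qed
  then have "bij_betw \<Theta> ?P (leaves // okutsu v S)" using inj by (simp add: bij_betw_def)
  moreover have "\<Theta> (\<rho>, tdir \<rho> \<phi>) = okutsu v S `` {ord_aug \<rho> \<phi> Infty}"
    if KP: "\<phi> \<in> KP \<rho>" and P: "(\<rho>, tdir \<rho> \<phi>) \<in> ?P" for \<rho> \<phi>
  proof -
    have \<rho>: "\<rho> \<in> Prim v S" and td: "tdir \<rho> \<phi> \<in> prim_td v \<rho>"
      using P by (auto simp: prim_tangent_vectors_def)
    have "\<phi> \<in> tdir \<rho> \<phi>" using KP by (simp add: tdir_def mu_equiv_def)
    \<comment> \<open>The class contains \<phi>, so if it consists of strong key polynomials, \<phi>
      is strong.\<close>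
    then have "\<phi> \<in> dirs \<rho>" using td KP by (auto simp: prim_td_def dirs_def split: if_splits)
    then show ?thesis using cls[OF leaf_of_direction[OF \<rho>]] \<tau>_aug[OF \<rho>] by simp
  qed
  moreover have "inv_into ?P \<Theta> (okutsu v S `` {f}) = (prev_prim v S f, tangent (prev_prim v S f) f)"
    if "f \<in> leaves" for f
    using inv_into_f_f[OF inj \<tau>_P[OF that]] cls[OF that] by (simp add: \<tau>_def)
  ultimately show ?thesis by blast
qed

end
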